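(* Let $A$ be a self-adjoint operator in a separable Hilbert space $\mathcal H$ whose spectrum is $\sigma(A)=\{\mu_k\}_{k\in\mathbb N}$ with $0<\mu_1<\mu_2<\dots$ and $\mu_k\to+\infty$; the eigenvalues $\mu_k$ may have arbitrary, possibly infinite, multiplicities. Let $P_k^0$ be the orthogonal spectral projection of $A$ onto the eigenspace of $\mu_k$, and let $r_1=\frac12(\mu_2-\mu_1)$, $r_k=\frac12\min\{\mu_k-\mu_{k-1},\mu_{k+1}-\mu_k\}$ for $k\ge2$. Let $v:\operatorname{Dom}(A^{1/2})\times\operatorname{Dom}(A^{1/2})\to\mathbb C$ be a sesquilinear form, and suppose that there is a sequence $\{\omega_j\}_{j\in\mathbb N}$ of non-negative numbers such that $$|v(P_j^0f,P_k^0g)|\le\omega_j\omega_k\|P_j^0f\|\|P_k^0g\|,\qquad j,k\in\mathbb N,\ f,g\in\operatorname{Dom}(A^{1/2}),$$ and $$\sum_{j=1}^\infty\frac{\omega_j^2}{\mu_j}<\infty,\qquad \sum_{\substack{j=1\\ j\ne n}}^\infty\frac{\omega_j^2}{|\mu_n-\mu_j|}+\frac{\omega_n^2}{r_n}=o(1),\quad n\to\infty.$$ Let $T$ be the m-sectorial operator associated with the closed sectorial form $t=a+v$, $\operatorname{Dom}(t)=\operatorname{Dom}(A^{1/2})$, where $a(f,g)=\langle A^{1/2}f,A^{1/2}g\rangle$. Then there exist $N_0\in\mathbb N$ and $h_1,h_2>0$ such that $$\sigma(T)\subset\Pi_0\cup\bigcup_{k>N_0}\Pi_k,$$ where $\Pi_0=\{z\in\mathbb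 C: -h_1<\operatorname{Re}z\le\mu_{N_0}+r_{N_0},\ |\operatorname{Im}z|\le h_2\}$ and $\Pi_k=\{z\in\mathbb C:|z-\mu_k|<r_k\}$. Moreover, with these $N_0,h_1,h_2$, the Riesz projections $$S_0=\frac1{2\pi i}\int_{\partial\Pi_0}(z-T)^{-1}\,dz,\qquad P_k=\frac1{2\pi i}\int_{\partial\Pi_k}(z-T)^{-1}\,dz,\quad k>N_0,$$ are well-defined, disjoint, and $$\operatorname{rank}(S_0)=\operatorname{rank}\Big(\sum_{k=1}^{N_0}P_k^0\Big),\qquad\operatorname{rank}(P_k)=\operatorname{rank}(P_k^0),\quad k>N_0.$$
   Context: $T$ is obtained from $t$ by Kato's first representation theorem: $\operatorname{Dom}(T)\subset\operatorname{Dom}(t)$ and $\langle Tf,g\rangle=t(f,g)$ for $f\in\operatorname{Dom}(T)$, $g\in\operatorname{Dom}(t)$; under the hypotheses $v$ is relatively form-bounded with respect to $a$ with bound $0$, so $t$ is closed and sectorial. Contours are positively oriented. "Well-defined" includes that the contours lie in the resolvent set of $T$; "disjoint" means that products of two different projections of the system vanish. Rank is the dimension of the range, a value in $\{0,1,2,\dots\}\cup\{\infty\}$. *)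

theory Defs
  imports
    "HOL-Complex_Analysis.Complex_Analysis"
    "HOL-Library.Extended_Nat"
    "HOL-Library.Landau_Symbols"
begin

section \<open>Complex Hilbert spaces\<close>

class scaleC = scaleR +
  fixes scaleC :: "complex \<Rightarrow> 'a \<Rightarrow> 'a"  (infixr \<open>*\<^sub>C\<close> 75)
  assumes scaleR_scaleC: "scaleR r = scaleC (complex_of_real r)"

class complex_vector = real_vector + scaleC +
  assumes scaleC_add_right: "a *\<^sub>C (x + y) = a *\<^sub>C x + a *\<^sub>C y"
    and scaleC_add_left: "(a + b) *\<^sub>C x = a *\<^sub>C x + b *\<^sub>C x"
    and scaleC_scaleC: "a *\<^sub>C (b *\<^sub>C x) = (a * b) *\<^sub>C x"
    and scaleC_one: "1 *\<^sub>C x = x"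

text \<open>The inner product is linear in its first and conjugate-linear in its second argument.\<close>

class complex_inner = complex_vector + real_normed_vector +
  fixes cinner :: "'a \<Rightarrow> 'a \<Rightarrow> complex"
  assumes cinner_commute: "cinner x y = cnj (cinner y x)"
    and cinner_add_left: "cinner (x + y) z = cinner x z + cinner y z"
    and cinner_scaleC_left: "cinner (c *\<^sub>C x) y = c * cinner x y"
    and cinner_ge_zero: "0 \<le> Re (cinner x x)"
    and cinner_eq_zero_iff: "cinner x x = 0 \<longleftrightarrow> x = 0"
    and norm_eq_sqrt_cinner: "norm x = sqrt (Re (cinner x x))"

class chilbert_space = complex_inner + complete_space

subclass (in chilbert_space) banach ..

global_interpretation complex_vector: vector_space "scaleC :: complex \<Rightarrow> 'a \<Rightarrow> 'a::complex_vector"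
  defines csubspace = complex_vector.subspace
    and cspan = complex_vector.span
    and cdim = complex_vector.dim
  by unfold_locales (simp_all add: scaleC_add_right scaleC_add_left scaleC_scaleC scaleC_one)

text \<open>Since \<^const>\<open>cdim\<close> takes a junk value on infinite-dimensional spaces, the rank is
  made \<^typ>\<open>enat\<close>-valued.\<close>

definition rank_op :: "('a::complex_vector \<Rightarrow> 'a) \<Rightarrow> enat" where
  "rank_op P = (if \<exists>E. finite E \<and> range P \<subseteq> cspan E then enat (cdim (range P)) else \<infinity>)"

definition orth_proj :: "'a::complex_inner set \<Rightarrow> 'a \<Rightarrow> 'a" where
  "orth_proj M f = (THE p. p \<in> M \<and> (\<forall>m\<in>M. cinner (f - p) m = 0))"


section \<open>Unbounded operators\<close>

text \<open>The action of an operator is relevant on its domain only; no predicate below looks at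
  its values elsewhere.\<close>

datatype 'a operator = Operator (Dom: "'a set") (app: "'a \<Rightarrow> 'a")

notation app (infixr \<open>\<cdot>\<close> 80)

definition linear_operator :: "'a::complex_vector operator \<Rightarrow> bool" where
  "linear_operator T \<longleftrightarrow> csubspace (Dom T) \<and>
     (\<forall>f\<in>Dom T. \<forall>g\<in>Dom T. T \<cdot> (f + g) = T \<cdot> f + T \<cdot> g) \<and>
     (\<forall>c. \<forall>f\<in>Dom T. T \<cdot> (c *\<^sub>C f) = c *\<^sub>C (T \<cdot> f))"

definition densely_defined :: "'a::complex_inner operator \<Rightarrow> bool" where
  "densely_defined T \<longleftrightarrow> closure (Dom T) = UNIV"

definition graph :: "'a operator \<Rightarrow> ('a \<times> 'a) set" where
  "graph T = {(f, T \<cdot> f) | f. f \<in> Dom T}"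

definition adjoint_graph :: "'a::complex_inner operator \<Rightarrow> ('a \<times> 'a) set" where
  "adjoint_graph T = {(g, h). \<forall>f\<in>Dom T. cinner (T \<cdot> f) g = cinner f h}"

definition self_adjoint :: "'a::complex_inner operator \<Rightarrow> bool" where
  "self_adjoint A \<longleftrightarrow> linear_operator A \<and> densely_defined A \<and> adjoint_graph A = graph A"

text \<open>\<^term>\<open>positive_sqrt A B\<close>: the operator $B$ is $A^{1/2}$, the non-negative self-adjoint
  operator with $B^2 = A$ (equality of unbounded operators, domains included).\<close>

definition positive_sqrt :: "'a::complex_inner operator \<Rightarrow> 'a operator \<Rightarrow> bool" where
  "positive_sqrt A B \<longleftrightarrow> self_adjoint B \<and> (\<forall>f\<in>Dom B. 0 \<le> Re (cinner (B \<cdot> f) f)) \<and>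
     Dom A = {f \<in> Dom B. B \<cdot> f \<in> Dom B} \<and> (\<forall>f\<in>Dom A. A \<cdot> f = B \<cdot> B \<cdot> f)"

definition eigenspace :: "'a::complex_vector operator \<Rightarrow> complex \<Rightarrow> 'a set" where
  "eigenspace T z = {f \<in> Dom T. T \<cdot> f = z *\<^sub>C f}"

text \<open>\<^term>\<open>resolvent T z\<close> is $(z - T)^{-1}$. It is automatically complex-linear when $T$ is
  linear, hence \<^const>\<open>bounded_linear\<close> (over the reals) only adds boundedness.\<close>

definition resolvent :: "'a::complex_vector operator \<Rightarrow> complex \<Rightarrow> 'a \<Rightarrow> 'a" where
  "resolvent T z = inv_into (Dom T) (\<lambda>f. z *\<^sub>C f - T \<cdot> f)"

definition resolvent_set :: "'a::complex_inner operator \<Rightarrow> complex set" where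
  "resolvent_set T =
     {z. bij_betw (\<lambda>f. z *\<^sub>C f - T \<cdot> f) (Dom T) UNIV \<and> bounded_linear (resolvent T z)}"

definition spectrum :: "'a::complex_inner operator \<Rightarrow> complex set" where
  "spectrum T = - resolvent_set T"


section \<open>Sectorial forms and operators\<close>

text \<open>Terminology of Kato, \<^emph>\<open>Perturbation Theory for Linear Operators\<close>, V.3.10 and VI.1--2.
  Note that \<^prop>\<open>Arg 0 = 0\<close>, so a sector contains its vertex.\<close>

definition sector :: "real \<Rightarrow> real \<Rightarrow> complex set" where
  "sector \<gamma> \<theta> = {z. \<bar>Arg (z - complex_of_real \<gamma>)\<bar> \<le> \<theta>}"

definition sesquilinear_on :: "'a::complex_vector set \<Rightarrow> ('a \<Rightarrow> 'a \<Rightarrow> complex) \<Rightarrow> bool" where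
  "sesquilinear_on D t \<longleftrightarrow> csubspace D \<and>
     (\<forall>f\<in>D. \<forall>g\<in>D. \<forall>h\<in>D. t (f + g) h = t f h + t g h \<and> t h (f + g) = t h f + t h g) \<and>
     (\<forall>c. \<forall>f\<in>D. \<forall>g\<in>D. t (c *\<^sub>C f) g = c * t f g \<and> t f (c *\<^sub>C g) = cnj c * t f g)"

definition sectorial_form :: "'a::complex_inner set \<Rightarrow> ('a \<Rightarrow> 'a \<Rightarrow> complex) \<Rightarrow> bool" where
  "sectorial_form D t \<longleftrightarrow> sesquilinear_on D t \<and>
     (\<exists>\<gamma> \<theta>. 0 \<le> \<theta> \<and> \<theta> < pi / 2 \<and> (\<forall>f\<in>D. norm f = 1 \<longrightarrow> t f f \<in> sector \<gamma> \<theta>))"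

definition closed_form :: "'a::complex_inner set \<Rightarrow> ('a \<Rightarrow> 'a \<Rightarrow> complex) \<Rightarrow> bool" where
  "closed_form D t \<longleftrightarrow>
     (\<forall>F f. (\<forall>n. F n \<in> D) \<and> F \<longlonglongrightarrow> f \<and>
        (\<forall>\<epsilon>>0. \<exists>M. \<forall>m\<ge>M. \<forall>n\<ge>M. cmod (t (F m - F n) (F m - F n)) < \<epsilon>) \<longrightarrow>
        f \<in> D \<and> (\<lambda>n. t (F n - f) (F n - f)) \<longlonglongrightarrow> 0)"

definition m_accretive :: "'a::complex_inner operator \<Rightarrow> bool" where
  "m_accretive T \<longleftrightarrow> linear_operator T \<and> densely_defined T \<and>
     (\<forall>z. 0 < Re z \<longrightarrow> - z \<in> resolvent_set T \<and> onorm (resolvent T (- z)) \<le> 1 / Re z)"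

definition quasi_m_accretive :: "'a::complex_inner operator \<Rightarrow> bool" where
  "quasi_m_accretive T \<longleftrightarrow>
     (\<exists>\<alpha>::complex. m_accretive (Operator (Dom T) (\<lambda>f. T \<cdot> f + \<alpha> *\<^sub>C f)))"

definition m_sectorial :: "'a::complex_inner operator \<Rightarrow> bool" where
  "m_sectorial T \<longleftrightarrow> quasi_m_accretive T \<and>
     (\<exists>\<gamma> \<theta>. 0 \<le> \<theta> \<and> \<theta> < pi / 2 \<and>
        (\<forall>f\<in>Dom T. norm f = 1 \<longrightarrow> cinner (T \<cdot> f) f \<in> sector \<gamma> \<theta>))"

text \<open>The relation between form and operator in the first representation theorem. For a closed
  sectorial densely defined form it determines $T$ uniquely.\<close>

definition associated_operator ::
    "'a::complex_inner set \<Rightarrow> ('a \<Rightarrow> 'a \<Rightarrow> complex) \<Rightarrow> 'a operator \<Rightarrow> bool" where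
  "associated_operator D t T \<longleftrightarrow> m_sectorial T \<and> Dom T \<subseteq> D \<and>
     (\<forall>f\<in>Dom T. \<forall>g\<in>D. cinner (T \<cdot> f) g = t f g)"


section \<open>Riesz projections\<close>

text \<open>The integrand of $\int_\gamma (z - T)^{-1}\,dz$, pulled back to $[0,1]$ as in
  \<^const>\<open>contour_integral\<close>. It takes values in the Banach space of bounded operators, so that
  the integral below is taken in operator norm.\<close>

definition resolvent_integrand ::
    "'a::complex_inner operator \<Rightarrow> (real \<Rightarrow> complex) \<Rightarrow> real \<Rightarrow> 'a \<Rightarrow>\<^sub>L 'a" where
  "resolvent_integrand T \<gamma> s =
     Blinfun (\<lambda>f. vector_derivative \<gamma> (at s within {0..1}) *\<^sub>C resolvent T (\<gamma> s) f)"

definition riesz_well_defined :: "'a::chilbert_space operator \<Rightarrow> (real \<Rightarrow> complex) \<Rightarrow> bool" where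
  "riesz_well_defined T \<gamma> \<longleftrightarrow>
     path_image \<gamma> \<subseteq> resolvent_set T \<and> resolvent_integrand T \<gamma> integrable_on {0..1}"

definition riesz_projection ::
    "'a::chilbert_space operator \<Rightarrow> (real \<Rightarrow> complex) \<Rightarrow> 'a \<Rightarrow> 'a" where
  "riesz_projection T \<gamma> f =
     (1 / (2 * complex_of_real pi * \<i>)) *\<^sub>C
       blinfun_apply (integral {0..1} (resolvent_integrand T \<gamma>)) f"


section \<open>Gap radii\<close>

definition gap_radius :: "(nat \<Rightarrow> real) \<Rightarrow> nat \<Rightarrow> real" where
  "gap_radius \<mu> k = (if k = 1 then (\<mu> 2 - \<mu> 1) / 2
     else min (\<mu> k - \<mu> (k - 1)) (\<mu> (k + 1) - \<mu> k) / 2)"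

end

theory Submission
  imports Defs
begin

text \<open>Write \<open>t - z\<close> as the form of \<open>A\<^sup>1\<^sup>/\<^sup>2 (I + V - z A\<^sup>-\<^sup>1) A\<^sup>1\<^sup>/\<^sup>2\<close> with the bounded operator
  \<open>V = A\<^sup>-\<^sup>1\<^sup>/\<^sup>2 v A\<^sup>-\<^sup>1\<^sup>/\<^sup>2\<close>. By the Cauchy--Schwarz inequality \<open>V\<close> is dominated by \<open>s(z) \<bar>I - z A\<^sup>-\<^sup>1\<bar>\<close>,
  where \<open>s(z) = \<Sum>\<^sub>j \<omega>\<^sub>j\<^sup>2 / \<bar>\<mu>\<^sub>j - z\<bar>\<close>, so \<open>z\<close> lies in the resolvent set of \<open>T\<close> as soon as \<open>s(z) < 1\<close>.
  Comparing \<open>z\<close> with the eigenvalue nearest to \<open>Re z\<close>, the hypotheses give \<open>s(z) \<le> 1/2\<close> on and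
  outside all contours. The same bound holds for \<open>\<tau> V\<close> with \<open>0 \<le> \<tau> \<le> 1\<close>; hence the Riesz
  projections depend Lipschitz continuously on \<open>\<tau>\<close>, and their rank, being locally constant, equals
  the one at \<open>\<tau> = 0\<close>.

  Form boundedness of \<open>v\<close> is not assumed and is deduced from the closedness
  of \<open>t\<close>. Contours may touch each other, so disjointness of the projections is obtained after
  shrinking them slightly. The completeness of the eigenvectors of \<open>A\<close> is proved directly: for \<open>x\<close>
  orthogonal to all of them, \<open>z \<mapsto> \<langle>(z - A)\<^sup>-\<^sup>1 x, x\<rangle>\<close> extends to an entire function, and its
  Taylor coefficients at \<open>0\<close> decay too fast for \<open>x \<noteq> 0\<close>.\<close>

section \<open>Hilbert space preliminaries\<close>

text \<open>\<open>T\<close> is known only through its form, so neither its domain nor a difference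
  \<open>T - A\<close> is available. The resolvent is therefore identified weakly: the factorised
  inverse solves the form equation, and m-sectoriality turns a form solution into an element of
  \<open>Dom T\<close>. For intermediate \<tau> no operator is constructed at all; the families
  \<open>R \<tau>\<close> satisfy the resolvent identity, and this alone carries holomorphy,
  idempotence and products of the contour integrals. The threshold is 1/2 and not merely below 1
  because one lower bound for \<open>I + \<tau> V - z J\<close> has to serve all points of a contour
  and all \<tau> at once; then finitely many steps of equal length lead from 0 to 1. Eigenvalues may
  have infinite multiplicity, so ranks cannot be compared through traces: two idempotents at norm
  distance below 1 are injective on each other's range, which compares dimensions, finite or not.
  Operator-valued integrals are tested against vectors, which leaves scalar contour integrals and
  the theorems of Cauchy and Fubini.\<close>

lemma cinner_add_right: "cinner x (y + z) = cinner x y + cinner (x::'a::complex_inner) z"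
  by (subst (1 2 3) cinner_commute) (simp add: cinner_add_left)

lemma cinner_scaleC_right: "cinner (x::'a::complex_inner) (c *\<^sub>C y) = cnj c * cinner x y"
  by (subst (1 2) cinner_commute) (simp add: cinner_scaleC_left)

lemma scaleC_scaleR: "complex_of_real r *\<^sub>C x = r *\<^sub>R (x::'a::complex_vector)"
  by (simp add: scaleR_scaleC)

lemma scaleC_zero_left [simp]: "0 *\<^sub>C x = (0::'a::complex_vector)"
  using scaleC_scaleR[of 0 x] by simp

lemma scaleC_minus_one: "(- 1) *\<^sub>C x = - (x::'a::complex_vector)"
  using scaleC_scaleR[of "-1" x] by simp

lemma scaleC_one' [simp]: "1 *\<^sub>C x = (x::'a::complex_vector)"
  by (rule scaleC_one)

lemma scaleC_zero_right [simp]: "c *\<^sub>C 0 = (0::'a::complex_vector)"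
  using scaleC_add_right[of c 0 0] by simp

lemma scaleC_minus_left: "(- c) *\<^sub>C x = - (c *\<^sub>C (x::'a::complex_vector))"
  using scaleC_scaleC[of "-1" c x] by (simp add: scaleC_minus_one)

lemma scaleC_minus_right: "c *\<^sub>C (- x) = - (c *\<^sub>C (x::'a::complex_vector))"
  using scaleC_scaleC[of c "-1" x] by (simp add: scaleC_minus_one scaleC_minus_left)

lemma scaleC_diff_left: "(c - d) *\<^sub>C x = c *\<^sub>C x - d *\<^sub>C (x::'a::complex_vector)"
  using scaleC_add_left[of c "-d" x] by (simp add: scaleC_minus_left)

lemma scaleC_diff_right: "c *\<^sub>C (x - y) = c *\<^sub>C x - c *\<^sub>C (y::'a::complex_vector)"
  using scaleC_add_right[of c x "-y"] by (simp add: scaleC_minus_right)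

lemma scaleC_cancel: "c \<noteq> 0 \<Longrightarrow> c *\<^sub>C x = c *\<^sub>C y \<longleftrightarrow> x = (y::'a::complex_vector)"
  by (metis left_inverse scaleC_one scaleC_scaleC)

lemma cinner_zero_left [simp]: "cinner 0 (x::'a::complex_inner) = 0"
  using cinner_scaleC_left[of 0 x x] by simp

lemma cinner_zero_right [simp]: "cinner (x::'a::complex_inner) 0 = 0"
  using cinner_scaleC_right[of x 0 x] by simp

lemma cinner_minus_left: "cinner (- x) (y::'a::complex_inner) = - cinner x y"
  using cinner_scaleC_left[of "-1" x y] by (simp add: scaleC_minus_one)

lemma cinner_minus_right: "cinner x (- y::'a::complex_inner) = - cinner x y"
  using cinner_scaleC_right[of x "-1" y] by (simp add: scaleC_minus_one)

lemma cinner_diff_left: "cinner (x - y) (z::'a::complex_inner) = cinner x z - cinner y z"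
  using cinner_add_left[of x "-y" z] by (simp add: cinner_minus_left)

lemma cinner_diff_right: "cinner z (x - y::'a::complex_inner) = cinner z x - cinner z y"
  using cinner_add_right[of z x "-y"] by (simp add: cinner_minus_right)

lemmas cinner_simps = cinner_add_left cinner_add_right cinner_diff_left cinner_diff_right
  cinner_scaleC_left cinner_scaleC_right cinner_minus_left cinner_minus_right

lemma cinner_self: "cinner x x = complex_of_real ((norm (x::'a::complex_inner))\<^sup>2)"
proof -
  have "Im (cinner x x) = 0"
    using cinner_commute[of x x] by (metis complex_cnj_cancel_iff Reals_cnj_iff complex_is_Real_iff)
  then show ?thesis
    using cinner_ge_zero[of x] by (simp add: complex_eq_iff norm_eq_sqrt_cinner)
qed

lemma cinner_sum_left: "cinner (sum f S) (y::'a::complex_inner) = (\<Sum>i\<in>S. cinner (f i) y)"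
  by (induction S rule: infinite_finite_induct) (auto simp: cinner_add_left)

lemma cinner_sum_right: "cinner (y::'a::complex_inner) (sum f S) = (\<Sum>i\<in>S. cinner y (f i))"
  by (induction S rule: infinite_finite_induct) (auto simp: cinner_add_right)

lemma cinner_ext: "(\<And>y. cinner x y = cinner x' y) \<Longrightarrow> x = (x'::'a::complex_inner)"
  using cinner_eq_zero_iff[of "x - x'"] by (simp add: cinner_diff_left)

lemma norm_scaleC [simp]: "norm (c *\<^sub>C (x::'a::complex_inner)) = cmod c * norm x"
proof -
  have "complex_of_real ((norm (c *\<^sub>C x))\<^sup>2) = c * (cnj c * cinner x x)"
    by (simp add: cinner_self[symmetric] cinner_scaleC_left cinner_scaleC_right del: of_real_power)
  also have "\<dots> = (c * cnj c) * complex_of_real ((norm x)\<^sup>2)"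
    by (simp only: cinner_self mult.assoc)
  also have "\<dots> = complex_of_real ((cmod c * norm x)\<^sup>2)"
    by (simp only: complex_norm_square[symmetric] power_mult_distrib of_real_mult)
  finally have "complex_of_real ((norm (c *\<^sub>C x))\<^sup>2) = complex_of_real ((cmod c * norm x)\<^sup>2)" .
  then have "(norm (c *\<^sub>C x))\<^sup>2 = (cmod c * norm x)\<^sup>2"
    using of_real_eq_iff by blast
  then show ?thesis
    by (simp add: power2_eq_iff_nonneg)
qed

lemma norm_add_square:
  "(norm (x + y))\<^sup>2 = (norm x)\<^sup>2 + (norm y)\<^sup>2 + 2 * Re (cinner x (y::'a::complex_inner))"
proof -
  have "cinner (x + y) (x + y) = cinner x x + cinner y y + (cinner x y + cnj (cinner x y))"
    by (simp add: cinner_simps cinner_commute[of y x])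
  then have "Re (cinner (x + y) (x + y)) = Re (cinner x x + cinner y y + (cinner x y + cnj (cinner x y)))"
    by simp
  then show ?thesis
    by (simp add: cinner_self)
qed

lemma norm_diff_square:
  "(norm (x - y))\<^sup>2 = (norm x)\<^sup>2 + (norm y)\<^sup>2 - 2 * Re (cinner x (y::'a::complex_inner))"
  using norm_add_square[of x "-y"] by (simp add: cinner_minus_right)

lemma parallelogram_law:
  "(norm (x + y))\<^sup>2 + (norm (x - y))\<^sup>2 = 2 * (norm x)\<^sup>2 + 2 * (norm (y::'a::complex_inner))\<^sup>2"
  by (simp add: norm_add_square norm_diff_square)

lemma Cauchy_Schwarz_cinner: "cmod (cinner x y) \<le> norm x * norm (y::'a::complex_inner)"
proof (cases "y = 0")
  case False
  define c where "c = cinner x y"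
  define b where "b = (norm y)\<^sup>2"
  have b: "b > 0" using False by (simp add: b_def)
  have inner: "cinner (complex_of_real b *\<^sub>C x) (c *\<^sub>C y) = complex_of_real (b * (cmod c)\<^sup>2)"
    unfolding cinner_scaleC_left cinner_scaleC_right c_def[symmetric]
    using complex_norm_square[of c] by (simp add: mult_ac)
  \<comment> \<open>The vector \<open>b x - c y\<close> is \<open>b\<close> times the component of
    \<open>x\<close> orthogonal to \<open>y\<close>; scaling by \<open>b\<close> avoids a
    division.\<close>
  have "0 \<le> (norm (complex_of_real b *\<^sub>C x - c *\<^sub>C y))\<^sup>2" by simp
  also have "\<dots> = (b * norm x)\<^sup>2 + (cmod c)\<^sup>2 * b - 2 * (b * (cmod c)\<^sup>2)"
    unfolding norm_diff_square inner using b by (simp add: power_mult_distrib b_def norm_power flip: power_mult)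
  also have "\<dots> = b * (b * (norm x)\<^sup>2 - (cmod c)\<^sup>2)"
    by (simp add: algebra_simps power2_eq_square)
  finally have "(cmod c)\<^sup>2 \<le> (norm x * norm y)\<^sup>2"
    using b by (simp add: zero_le_mult_iff b_def power_mult_distrib mult.commute)
  then show ?thesis
    unfolding c_def by (rule power2_le_imp_le) simp
qed simp

lemma bounded_bilinear_cinner: "bounded_bilinear (cinner :: 'a::complex_inner \<Rightarrow> 'a \<Rightarrow> complex)"
  by (rule bounded_bilinear.intro)
     (auto simp: cinner_simps scaleC_scaleR[symmetric] scaleR_conv_of_real
           intro!: exI[of _ 1] Cauchy_Schwarz_cinner)

lemma bounded_bilinear_scaleC: "bounded_bilinear (scaleC :: complex \<Rightarrow> 'a::complex_inner \<Rightarrow> 'a)"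
  by (rule bounded_bilinear.intro)
     (auto simp: scaleC_add_left scaleC_add_right scaleC_scaleR[symmetric] scaleR_conv_of_real
       mult.commute intro!: exI[of _ 1])

lemmas tendsto_cinner = bounded_bilinear.tendsto[OF bounded_bilinear_cinner]
lemmas tendsto_scaleC = bounded_bilinear.tendsto[OF bounded_bilinear_scaleC]
lemmas continuous_on_cinner = bounded_bilinear.continuous_on[OF bounded_bilinear_cinner]
lemmas bounded_linear_cinner_left = bounded_bilinear.bounded_linear_left[OF bounded_bilinear_cinner]
lemmas bounded_linear_scaleC = bounded_bilinear.bounded_linear_right[OF bounded_bilinear_scaleC]

text \<open>The choice \<open>y = x\<close> gives the square of the norm on the left. Norm bounds
  for contour integrals and for represented operators are obtained this way, from their scalar
  products.\<close>

lemma norm_le_by_cinner: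
  fixes x :: "'a::complex_inner"
  assumes "0 \<le> c" "\<And>y. cmod (cinner x y) \<le> c * norm y"
  shows "norm x \<le> c"
proof (cases "x = 0")
  case False
  have "norm x * norm x \<le> c * norm x"
    using assms(2)[of x] by (simp add: cinner_self norm_mult power2_eq_square)
  then show ?thesis using False by simp
qed (use assms in simp)

section \<open>Bounded complex-linear maps\<close>

definition bounded_clinear :: "('a::complex_inner \<Rightarrow> 'b::complex_inner) \<Rightarrow> bool" where
  "bounded_clinear F \<longleftrightarrow> bounded_linear F \<and> (\<forall>c x. F (c *\<^sub>C x) = c *\<^sub>C F x)"

lemma bounded_clinearI:
  assumes "\<And>x y. F (x + y) = F x + F y" "\<And>c x. F (c *\<^sub>C x) = c *\<^sub>C F x" "\<And>x. norm (F x) \<le> K * norm x"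
  shows "bounded_clinear F"
  unfolding bounded_clinear_def
proof
  show "bounded_linear F"
    by (rule bounded_linear_intro[where K=K])
       (use assms in \<open>auto simp: scaleC_scaleR[symmetric] mult.commute\<close>)
qed (use assms in auto)

lemma bounded_clinearD:
  assumes "bounded_clinear F"
  shows "bounded_linear F" "F (x + y) = F x + F y" "F (c *\<^sub>C x) = c *\<^sub>C F x" "F 0 = 0"
    "F (x - y) = F x - F y" "F (- x) = - F x" "norm (F x) \<le> onorm F * norm x"
proof -
  show *: "bounded_linear F" "F (c *\<^sub>C x) = c *\<^sub>C F x"
    using assms by (auto simp: bounded_clinear_def)
  interpret bounded_linear F by fact
  show "F (x + y) = F x + F y" "F 0 = 0" "F (x - y) = F x - F y" "F (- x) = - F x"
    using add diff zero diff[of 0 x] by simp_all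
  show "norm (F x) \<le> onorm F * norm x" by (rule Operator_Norm.onorm[OF *(1)])
qed

lemma bounded_clinear_compose:
  "bounded_clinear F \<Longrightarrow> bounded_clinear G \<Longrightarrow> bounded_clinear (\<lambda>x. F (G x))"
  unfolding bounded_clinear_def by (auto intro: bounded_linear_compose)

lemma bounded_clinear_add:
  "bounded_clinear F \<Longrightarrow> bounded_clinear G \<Longrightarrow> bounded_clinear (\<lambda>x. F x + G x)"
  unfolding bounded_clinear_def by (auto intro: bounded_linear_add simp: scaleC_add_right)

lemma bounded_clinear_diff:
  "bounded_clinear F \<Longrightarrow> bounded_clinear G \<Longrightarrow> bounded_clinear (\<lambda>x. F x - G x)"
  unfolding bounded_clinear_def by (auto intro: bounded_linear_sub simp: scaleC_diff_right)

lemma bounded_clinear_scaleC: "bounded_clinear F \<Longrightarrow> bounded_clinear (\<lambda>x. c *\<^sub>C F x)"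
  unfolding bounded_clinear_def
  by (auto intro: bounded_linear_compose[OF bounded_linear_scaleC] simp: scaleC_scaleC mult.commute)

lemma bounded_clinear_minus: "bounded_clinear F \<Longrightarrow> bounded_clinear (\<lambda>x. - F x)"
  using bounded_clinear_scaleC[of F "-1"] by (simp add: scaleC_minus_one)

lemma bounded_clinear_ident: "bounded_clinear (\<lambda>x. x)"
  unfolding bounded_clinear_def by (auto intro: bounded_linear_ident)

section \<open>Complex subspaces and orthogonal projections\<close>

lemma csubspaceI:
  assumes "0 \<in> M" "\<And>x y. x \<in> M \<Longrightarrow> y \<in> M \<Longrightarrow> x + y \<in> M" "\<And>c x. x \<in> M \<Longrightarrow> c *\<^sub>C x \<in> M"
  shows "csubspace M"
  unfolding complex_vector.subspace_def using assms by auto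

lemma csubspaceD:
  assumes "csubspace M"
  shows "0 \<in> M" "x \<in> M \<Longrightarrow> y \<in> M \<Longrightarrow> x + y \<in> M" "x \<in> M \<Longrightarrow> c *\<^sub>C x \<in> M"
    "x \<in> M \<Longrightarrow> y \<in> M \<Longrightarrow> x - y \<in> M" "x \<in> M \<Longrightarrow> - x \<in> M"
proof -
  show 1: "0 \<in> M" "x \<in> M \<Longrightarrow> y \<in> M \<Longrightarrow> x + y \<in> M" "\<And>c. x \<in> M \<Longrightarrow> c *\<^sub>C x \<in> M" for x y
    using assms unfolding complex_vector.subspace_def by auto
  show 2: "x \<in> M \<Longrightarrow> - x \<in> M" for x
    using 1(3)[of x "-1"] by (simp add: scaleC_minus_one)
  show "x \<in> M \<Longrightarrow> y \<in> M \<Longrightarrow> x - y \<in> M"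
    using 1(2)[of x "-y"] 2[of y] by simp
qed

lemma csubspace_sum: "csubspace M \<Longrightarrow> (\<And>i. i \<in> I \<Longrightarrow> f i \<in> M) \<Longrightarrow> sum f I \<in> M"
  by (induction I rule: infinite_finite_induct) (auto simp: csubspaceD)

lemma csubspace_closure:
  assumes "csubspace (M::'a::complex_inner set)" shows "csubspace (closure M)"
proof (rule csubspaceI)
  show "0 \<in> closure M" using csubspaceD(1)[OF assms] closure_subset by blast
next
  fix x y assume "x \<in> closure M" "y \<in> closure M"
  then obtain f g where "\<forall>n. f n \<in> M" "f \<longlonglongrightarrow> x" "\<forall>n. g n \<in> M" "g \<longlonglongrightarrow> y"
    unfolding closure_sequential by auto
  then show "x + y \<in> closure M"
    unfolding closure_sequential
    by (intro exI[of _ "\<lambda>n. f n + g n"]) (auto intro: tendsto_add csubspaceD[OF assms])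
next
  fix c x assume "x \<in> closure M"
  then obtain f where "\<forall>n. f n \<in> M" "f \<longlonglongrightarrow> x"
    unfolding closure_sequential by auto
  then show "c *\<^sub>C x \<in> closure M"
    unfolding closure_sequential
    by (intro exI[of _ "\<lambda>n. c *\<^sub>C f n"]) (auto intro!: tendsto_scaleC tendsto_const csubspaceD[OF assms])
qed

text \<open>A minimising sequence is Cauchy by the parallelogram law: midpoints stay in
  \<open>M\<close>, so they cannot be closer to \<open>x\<close> than the infimum
  \<open>d\<close>.\<close>

lemma nearest_point:
  fixes M :: "'a::chilbert_space set"
  assumes M: "csubspace M" and "closed M"
  obtains p where "p \<in> M" "\<And>m. m \<in> M \<Longrightarrow> norm (x - p) \<le> norm (x - m)"
proof -
  define d where "d = (INF m\<in>M. norm (x - m))"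
  have bdd: "bdd_below ((\<lambda>m. norm (x - m)) ` M)" by (auto intro: bdd_belowI[of _ 0])
  have ne: "M \<noteq> {}" using csubspaceD(1)[OF M] by auto
  have d_le: "d \<le> norm (x - m)" if "m \<in> M" for m
    unfolding d_def using bdd that by (rule cINF_lower)
  have d0: "0 \<le> d" unfolding d_def using ne by (intro cINF_greatest) auto
  have "\<exists>m\<in>M. norm (x - m) < d + 1 / real (Suc n)" for n
    using cInf_lessD[of "(\<lambda>m. norm (x - m)) ` M" "d + 1 / real (Suc n)"] ne unfolding d_def by auto
  then obtain f where f: "\<And>n. f n \<in> M" "\<And>n. norm (x - f n) < d + 1 / real (Suc n)"
    by metis
  \<comment> \<open>The law gives \<open>4 * d * (a + b) + 2 * (a * a + b * b)\<close> for the
    excesses \<open>a\<close> and \<open>b\<close> over \<open>d\<close>; as both are at most 1,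
    their squares are absorbed and the bound becomes linear in \<open>a + b\<close>.\<close>
  have close: "(norm (f m - f n))\<^sup>2 \<le> (4 * d + 2) * (1 / real (Suc m) + 1 / real (Suc n))" for m n
  proof -
    define a b where "a = 1 / real (Suc m)" and "b = 1 / real (Suc n)"
    have ab: "0 < a" "a \<le> 1" "0 < b" "b \<le> 1" by (auto simp: a_def b_def)
    have mid: "(1/2) *\<^sub>C (f m + f n) \<in> M"
      by (intro csubspaceD[OF M] f)
    have "(x - f m) + (x - f n) = 2 *\<^sub>C (x - (1/2) *\<^sub>C (f m + f n))"
      using scaleC_add_left[of 1 1 x] by (simp add: scaleC_diff_right scaleC_scaleC algebra_simps)
    then have "norm ((x - f m) + (x - f n)) = 2 * norm (x - (1/2) *\<^sub>C (f m + f n))"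
      by simp
    then have "2 * d \<le> norm ((x - f m) + (x - f n))"
      using d_le[OF mid] by simp
    then have "(2 * d)\<^sup>2 \<le> (norm ((x - f m) + (x - f n)))\<^sup>2"
      using d0 by (intro power_mono) auto
    moreover have "(norm (x - f m))\<^sup>2 \<le> (d + a)\<^sup>2" "(norm (x - f n))\<^sup>2 \<le> (d + b)\<^sup>2"
      using f(2)[of m] f(2)[of n] by (auto intro!: power_mono simp: a_def b_def less_imp_le)
    moreover have "(x - f m) - (x - f n) = f n - f m" by simp
    ultimately have "(norm (f n - f m))\<^sup>2 \<le> 2 * (d + a)\<^sup>2 + 2 * (d + b)\<^sup>2 - (2 * d)\<^sup>2"
      using parallelogram_law[of "x - f m" "x - f n"] by simp
    also have "\<dots> = 4 * d * (a + b) + 2 * (a * a + b * b)"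
      by (simp add: power2_eq_square algebra_simps)
    also have "\<dots> \<le> 4 * d * (a + b) + 2 * (a + b)"
      using add_mono[OF mult_left_le[OF ab(2) less_imp_le[OF ab(1)]] mult_left_le[OF ab(4) less_imp_le[OF ab(3)]]]
      by (intro add_left_mono mult_left_mono) auto
    also have "\<dots> = (4 * d + 2) * (a + b)" by (simp add: algebra_simps)
    finally show ?thesis
      unfolding a_def b_def by (subst norm_minus_commute)
  qed
  have "Cauchy f"
  proof (rule metric_CauchyI)
    fix e :: real assume "e > 0"
    then have "e\<^sup>2 / (2 * (4 * d + 2)) > 0" using d0 by simp
    then obtain N where N: "inverse (real (Suc N)) < e\<^sup>2 / (2 * (4 * d + 2))"
      using reals_Archimedean by blast
    have "dist (f m) (f n) < e" if "m \<ge> N" "n \<ge> N" for m n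
    proof -
      have "1 / real (Suc m) \<le> inverse (real (Suc N))" "1 / real (Suc n) \<le> inverse (real (Suc N))"
        using that by (simp_all add: inverse_eq_divide frac_le)
      then have "1 / real (Suc m) + 1 / real (Suc n) < 2 * (e\<^sup>2 / (2 * (4 * d + 2)))"
        using N by linarith
      then have "(4 * d + 2) * (1 / real (Suc m) + 1 / real (Suc n)) < (4 * d + 2) * (2 * (e\<^sup>2 / (2 * (4 * d + 2))))"
        using d0 by (intro mult_strict_left_mono) auto
      also have "\<dots> = e\<^sup>2"
      proof -
        have "K * (2 * (E / (2 * K))) = E" if "K \<noteq> 0" for K E :: real using that by simp
        then show ?thesis using d0 by (metis add_nonneg_pos mult_nonneg_nonneg order_less_irrefl zero_le_numeral zero_less_numeral)
      qed
      finally have "(4 * d + 2) * (1 / real (Suc m) + 1 / real (Suc n)) < e\<^sup>2" .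
      then have "(norm (f m - f n))\<^sup>2 < e\<^sup>2" using close[of m n] by linarith
      then show ?thesis using \<open>e > 0\<close> by (simp add: dist_norm power2_less_imp_less)
    qed
    then show "\<exists>N. \<forall>m\<ge>N. \<forall>n\<ge>N. dist (f m) (f n) < e" by blast
  qed
  then obtain p where p: "f \<longlonglongrightarrow> p"
    using convergent_eq_Cauchy by blast
  have "p \<in> M" using \<open>closed M\<close> f(1) p closed_sequentially by blast
  moreover have "norm (x - p) \<le> d"
  proof (rule LIMSEQ_le[of "\<lambda>n. norm (x - f n)" _ "\<lambda>n. d + 1 / real (Suc n)"])
    show "(\<lambda>n. norm (x - f n)) \<longlonglongrightarrow> norm (x - p)" by (intro tendsto_intros p)
    show "(\<lambda>n. d + 1 / real (Suc n)) \<longlonglongrightarrow> d"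
      using tendsto_add[OF tendsto_const[of d] LIMSEQ_inverse_real_of_nat] by (simp add: inverse_eq_divide)
  qed (use f(2) less_imp_le in blast)
  ultimately show ?thesis using that d_le order_trans by blast
qed

text \<open>If the residual at a nearest point \<open>p\<close> had the inner product
  \<open>c \<noteq> 0\<close> with some \<open>m\<close>, then moving \<open>p\<close> by
  \<open>(c / b) m\<close>, where \<open>b\<close> is the squared norm of \<open>m\<close>, would
  lower the squared distance by \<open>(cmod c)\<^sup>2 / b\<close>.\<close>

lemma orthogonal_projection_exists:
  fixes M :: "'a::chilbert_space set"
  assumes M: "csubspace M" and "closed M"
  obtains p where "p \<in> M" "\<And>m. m \<in> M \<Longrightarrow> cinner (x - p) m = 0"
proof -
  obtain p where p: "p \<in> M" "\<And>m. m \<in> M \<Longrightarrow> norm (x - p) \<le> norm (x - m)"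
    using nearest_point[OF assms] by blast
  have "cinner (x - p) m = 0" if "m \<in> M" for m
  proof (rule ccontr)
    assume ne: "cinner (x - p) m \<noteq> 0"
    then have "m \<noteq> 0" by auto
    define c where "c = cinner (x - p) m"
    define b where "b = (norm m)\<^sup>2"
    have "b > 0" using \<open>m \<noteq> 0\<close> by (simp add: b_def)
    define q where "q = (c / complex_of_real b) *\<^sub>C m"
    have "p + q \<in> M" unfolding q_def by (intro csubspaceD[OF M] p that)
    then have "norm (x - p) \<le> norm ((x - p) - q)"
      using p(2)[of "p + q"] by (simp add: algebra_simps)
    then have "(norm (x - p))\<^sup>2 \<le> (norm ((x - p) - q))\<^sup>2" by (rule power_mono) simp
    then have "2 * Re (cinner (x - p) q) \<le> (norm q)\<^sup>2"
      unfolding norm_diff_square[of "x - p" q] by simp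
    moreover have "cinner (x - p) q = complex_of_real ((cmod c)\<^sup>2 / b)"
      unfolding q_def cinner_scaleC_right c_def[symmetric] using complex_norm_square[of c]
      by (simp add: mult.commute)
    moreover have "(norm q)\<^sup>2 = (cmod c)\<^sup>2 / b"
      using \<open>b > 0\<close> unfolding q_def norm_scaleC power_mult_distrib b_def[symmetric]
      by (simp add: norm_divide power_divide power2_eq_square[of b])
    ultimately have "(cmod c)\<^sup>2 / b \<le> 0" by simp
    then show False
      using ne \<open>b > 0\<close> by (simp add: c_def divide_le_0_iff)
  qed
  with p show ?thesis using that by blast
qed

lemma orthogonal_projection_unique:
  assumes "csubspace (M::'a::complex_inner set)" "p \<in> M" "\<And>m. m \<in> M \<Longrightarrow> cinner (x - p) m = 0"
    "q \<in> M" "\<And>m. m \<in> M \<Longrightarrow> cinner (x - q) m = 0"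
  shows "p = q"
proof -
  have "cinner (p - q) (p - q) = cinner (x - q) (p - q) - cinner (x - p) (p - q)"
    by (simp add: cinner_simps)
  also have "\<dots> = 0" using assms csubspaceD(4)[OF assms(1)] by simp
  finally show ?thesis using cinner_eq_zero_iff[of "p - q"] by simp
qed

lemma orth_proj:
  assumes "csubspace (M::'a::chilbert_space set)" "closed M"
  shows orth_proj_in: "orth_proj M x \<in> M"
    and orth_proj_orth: "m \<in> M \<Longrightarrow> cinner (x - orth_proj M x) m = 0"
proof -
  have "\<exists>!p. p \<in> M \<and> (\<forall>m\<in>M. cinner (x - p) m = 0)"
  proof (rule ex_ex1I)
    show "\<exists>p. p \<in> M \<and> (\<forall>m\<in>M. cinner (x - p) m = 0)"
      using orthogonal_projection_exists[OF assms, of x] by metis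
    show "p = q" if "p \<in> M \<and> (\<forall>m\<in>M. cinner (x - p) m = 0)" "q \<in> M \<and> (\<forall>m\<in>M. cinner (x - q) m = 0)" for p q
      by (rule orthogonal_projection_unique[OF assms(1), of p x q]) (use that in auto)
  qed
  from theI'[OF this] show "orth_proj M x \<in> M" "m \<in> M \<Longrightarrow> cinner (x - orth_proj M x) m = 0"
    unfolding orth_proj_def by blast+
qed

lemma orth_proj_eq:
  assumes "csubspace (M::'a::chilbert_space set)" "closed M" "p \<in> M" "\<And>m. m \<in> M \<Longrightarrow> cinner (x - p) m = 0"
  shows "orth_proj M x = p"
  using orthogonal_projection_unique[OF assms(1) orth_proj_in[OF assms(1,2)] orth_proj_orth[OF assms(1,2)] assms(3,4)] .

text \<open>The residual of a projection on the closure of \<open>M\<close> is orthogonal to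
  \<open>M\<close> and hence zero.\<close>

lemma dense_csubspaceI:
  assumes "csubspace (M::'a::chilbert_space set)" "\<And>y. (\<And>m. m \<in> M \<Longrightarrow> cinner m y = 0) \<Longrightarrow> y = 0"
  shows "closure M = UNIV"
proof -
  have "x \<in> closure M" for x
  proof -
    obtain p where p: "p \<in> closure M" "\<And>m. m \<in> closure M \<Longrightarrow> cinner (x - p) m = 0"
      using orthogonal_projection_exists[OF csubspace_closure[OF assms(1)] closed_closure] by blast
    have "x - p = 0"
    proof (rule assms(2))
      fix m assume "m \<in> M"
      then have "cinner (x - p) m = 0" using p(2) closure_subset by blast
      then show "cinner m (x - p) = 0" using cinner_commute[of m "x - p"] by simp
    qed
    with p show ?thesis by simp
  qed
  then show ?thesis by blast
qed

text \<open>The functional is conjugate-linear because it is to be represented in the second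
  argument of \<open>cinner\<close>. If it does not vanish, a residual \<open>e\<close> of the
  projection on its kernel spans the orthogonal complement of the kernel.\<close>

lemma Riesz_representation:
  fixes \<phi> :: "'a::chilbert_space \<Rightarrow> complex"
  assumes add0: "\<And>x y. \<phi> (x + y) = \<phi> x + \<phi> y" and scale0: "\<And>c x. \<phi> (c *\<^sub>C x) = cnj c * \<phi> x"
    and bound: "\<And>x. cmod (\<phi> x) \<le> K * norm x"
  obtains u where "\<And>x. \<phi> x = cinner u x"
proof -
  interpret bounded_linear \<phi>
    by (rule bounded_linear_intro[where K=K])
       (use assms in \<open>auto simp: scaleC_scaleR[symmetric] mult.commute scaleR_conv_of_real\<close>)
  define N where "N = {x. \<phi> x = 0}"
  have "csubspace N" by (rule csubspaceI) (auto simp: N_def add0 scale0 zero)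
  moreover have "closed N"
    unfolding N_def by (intro closed_Collect_eq linear_continuous_on[OF bounded_linear_axioms] continuous_intros)
  ultimately have *: "\<exists>p. p \<in> N \<and> (\<forall>m\<in>N. cinner (x - p) m = 0)" for x
    using orthogonal_projection_exists by metis
  show ?thesis
  proof (cases "\<forall>x. \<phi> x = 0")
    case True then show ?thesis using that[of 0] by simp
  next
    case False
    then obtain x where "\<phi> x \<noteq> 0" by blast
    obtain p where p: "p \<in> N" "\<And>m. m \<in> N \<Longrightarrow> cinner (x - p) m = 0" using * by blast
    define e where "e = x - p"
    have e: "\<phi> e \<noteq> 0" using \<open>\<phi> x \<noteq> 0\<close> p(1) by (simp add: e_def diff N_def)
    then have "e \<noteq> 0" using zero by auto
    define b where "b = cinner e e"
    have "b \<noteq> 0" using \<open>e \<noteq> 0\<close> cinner_eq_zero_iff by (auto simp: b_def)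
    have "\<phi> y = cinner ((\<phi> e / b) *\<^sub>C e) y" for y
    proof -
      \<comment> \<open>The conjugate compensates for the conjugate-linearity of \<phi>.\<close>
      have "y - cnj (\<phi> y / \<phi> e) *\<^sub>C e \<in> N" using e by (simp add: N_def diff scale0)
      then have "cinner e (y - cnj (\<phi> y / \<phi> e) *\<^sub>C e) = 0" using p(2) by (simp add: e_def)
      then have "cinner e y = \<phi> y / \<phi> e * b" by (simp add: cinner_simps b_def)
      then show ?thesis using e \<open>b \<noteq> 0\<close> by (simp add: cinner_scaleC_left)
    qed
    then show ?thesis using that by blast
  qed
qed

text \<open>Coercivity bounds \<open>N\<close> from below, which gives injectivity and closed range.
  A vector orthogonal to the range, tested with its own image, contradicts coercivity unless it is
  zero.\<close>

lemma Lax_Milgram: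
  fixes N :: "'a::chilbert_space \<Rightarrow> 'a"
  assumes N: "bounded_clinear N" and "c > 0" and coercive: "\<And>x. c * (norm x)\<^sup>2 \<le> cmod (cinner (N x) x)"
  shows "bij N" and "c * norm x \<le> norm (N x)"
proof -
  have lower: "c * norm x \<le> norm (N x)" for x
  proof (cases "x = 0")
    case False
    have "c * (norm x)\<^sup>2 \<le> norm (N x) * norm x"
      using coercive Cauchy_Schwarz_cinner order_trans by blast
    then show ?thesis using False by (simp add: power2_eq_square flip: mult.assoc)
  qed simp
  then show "c * norm x \<le> norm (N x)" .
  have "inj N"
  proof (rule injI)
    fix x y assume "N x = N y"
    then have "c * norm (x - y) \<le> 0" using lower[of "x - y"] by (simp add: bounded_clinearD[OF N])
    then show "x = y" using \<open>c > 0\<close> by (simp add: mult_le_0_iff)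
  qed
  moreover have "csubspace (range N)"
  proof (rule csubspaceI)
    show "0 \<in> range N" using bounded_clinearD(4)[OF N] by (metis rangeI)
    show "x + y \<in> range N" if "x \<in> range N" "y \<in> range N" for x y
      using that bounded_clinearD(2)[OF N] by (metis (no_types, lifting) imageE rangeI)
    show "a *\<^sub>C x \<in> range N" if "x \<in> range N" for a x
      using that bounded_clinearD(3)[OF N] by (metis (no_types, lifting) imageE rangeI)
  qed
  moreover have "closed (range N)"
  proof -
    interpret bounded_linear N using bounded_clinearD(1)[OF N] .
    have "complete (range N)"
      by (rule complete_isometric_image[OF \<open>c > 0\<close> subspace_UNIV bounded_linear_axioms])
         (use lower in \<open>auto simp: mult.commute complete_UNIV\<close>)
    then show ?thesis by (rule complete_imp_closed)
  qed
  moreover have "closure (range N) = UNIV"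
  proof (rule dense_csubspaceI[OF \<open>csubspace (range N)\<close>])
    fix y assume "\<And>m. m \<in> range N \<Longrightarrow> cinner m y = 0"
    then have "c * (norm y)\<^sup>2 \<le> 0" using coercive[of y] by simp
    then show "y = 0" using \<open>c > 0\<close> by (simp add: mult_le_0_iff)
  qed
  ultimately show "bij N" by (simp add: bij_def closure_closed)
qed

lemma bounded_clinear_inv:
  assumes N: "bounded_clinear N" and "bij N" and "c > 0" and lower: "\<And>x. c * norm x \<le> norm (N x)"
  shows "bounded_clinear (inv N)" and "norm (inv N x) \<le> norm x / c"
proof -
  have N_inv: "N (inv N x) = x" for x using \<open>bij N\<close> by (simp add: bij_is_surj surj_f_inv_f)
  have eq: "inv N y = x" if "N x = y" for x y using that \<open>bij N\<close> by (simp add: bij_is_inj inv_f_eq)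
  show bound: "norm (inv N x) \<le> norm x / c" for x
    using lower[of "inv N x"] \<open>c > 0\<close> by (simp add: N_inv field_simps)
  show "bounded_clinear (inv N)"
  proof (rule bounded_clinearI)
    show "inv N (x + y) = inv N x + inv N y" for x y
      by (rule eq) (simp add: bounded_clinearD(2)[OF N] N_inv)
    show "inv N (a *\<^sub>C x) = a *\<^sub>C inv N x" for a x
      by (rule eq) (simp add: bounded_clinearD(3)[OF N] N_inv)
    show "norm (inv N x) \<le> (1 / c) * norm x" for x using bound[of x] by simp
  qed
qed

text \<open>The hypothesis says that \<open>Q\<close> is injective on the range of \<open>P\<close>.
  It therefore maps a basis of that range to independent vectors in the range of
  \<open>Q\<close>.\<close>

lemma rank_op_mono:
  fixes P Q :: "'a::complex_inner \<Rightarrow> 'a"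
  assumes P: "bounded_clinear P" and Q: "bounded_clinear Q" and inj: "\<And>x. Q (P x) = 0 \<Longrightarrow> P x = 0"
  shows "rank_op P \<le> rank_op Q"
proof (cases "\<exists>E. finite E \<and> range Q \<subseteq> cspan E")
  case True
  then obtain E where E: "finite E" "range Q \<subseteq> cspan E" by blast
  obtain B where B: "B \<subseteq> range P" "complex_vector.independent B" "range P \<subseteq> cspan B" "card B = cdim (range P)"
    using complex_vector.basis_exists[of "range P"] by blast
  obtain B' where B': "B' \<subseteq> range Q" "complex_vector.independent B'" "range Q \<subseteq> cspan B'" "card B' = cdim (range Q)"
    using complex_vector.basis_exists[of "range Q"] by blast
  have "csubspace (range P)"
  proof (rule csubspaceI)
    show "0 \<in> range P" using bounded_clinearD(4)[OF P] by (metis rangeI)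
    show "x + y \<in> range P" if "x \<in> range P" "y \<in> range P" for x y
      using that bounded_clinearD(2)[OF P] by (metis (no_types, lifting) imageE rangeI)
    show "a *\<^sub>C x \<in> range P" if "x \<in> range P" for a x
      using that bounded_clinearD(3)[OF P] by (metis (no_types, lifting) imageE rangeI)
  qed
  then have span: "cspan B \<subseteq> range P"
    using B(1) by (rule complex_vector.span_minimal[rotated])
  interpret Q: Vector_Spaces.linear scaleC scaleC Q
    by unfold_locales (simp_all add: bounded_clinearD[OF Q])
  have "inj_on Q (cspan B)"
  proof (rule inj_onI)
    fix x y assume xy: "x \<in> cspan B" "y \<in> cspan B" "Q x = Q y"
    then have "x - y \<in> range P" using span complex_vector.span_diff by blast
    moreover have "Q (x - y) = 0" using xy by (simp add: bounded_clinearD[OF Q])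
    ultimately have "x - y = 0" using inj by (metis imageE)
    then show "x = y" by simp
  qed
  then have indep: "complex_vector.independent (Q ` B)" and injB: "inj_on Q B"
    using Q.independent_injective_image[OF B(2)] complex_vector.span_superset unfolding cspan_def by (auto intro: inj_on_subset)
  have "finite B'"
    using complex_vector.independent_span_bound[OF E(1) B'(2)] B'(1) E(2) by blast
  then have "finite (Q ` B)" "card (Q ` B) \<le> card B'"
    using complex_vector.independent_span_bound[OF _ indep, of B'] B'(3) by auto
  then have "finite B" "cdim (range P) \<le> cdim (range Q)"
    using B(4) B'(4) card_image[OF injB] finite_image_iff[OF injB] by simp_all
  moreover have "\<exists>E. finite E \<and> range P \<subseteq> cspan E" using \<open>finite B\<close> B(3) by blast
  ultimately show ?thesis using True by (simp add: rank_op_def)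
next
  case False
  then have "rank_op Q = \<infinity>" unfolding rank_op_def by (rule if_not_P)
  then show ?thesis by simp
qed

text \<open>A vector \<open>y\<close> in the range of \<open>P\<close> satisfies
  \<open>P y = y\<close>. If also \<open>Q y = 0\<close>, closeness reads
  \<open>norm y \<le> c * norm y\<close>, so \<open>y = 0\<close>; the situation is symmetric in
  \<open>P\<close> and \<open>Q\<close>.\<close>

lemma rank_op_eq_of_close_projections:
  fixes P Q :: "'a::complex_inner \<Rightarrow> 'a"
  assumes P: "bounded_clinear P" "\<And>x. P (P x) = P x" and Q: "bounded_clinear Q" "\<And>x. Q (Q x) = Q x"
    and "c < 1" and close: "\<And>x. norm (P x - Q x) \<le> c * norm x"
  shows "rank_op P = rank_op Q"
proof (rule antisym)
  have *: "y = 0" if "norm y \<le> c * norm y" for y :: 'a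
    using that \<open>c < 1\<close> by (cases "norm y = 0") auto
  have "P x = 0" if "Q (P x) = 0" for x
    using * close[of "P x"] that P(2) by simp
  then show "rank_op P \<le> rank_op Q" using P(1) Q(1) rank_op_mono by blast
  have "Q x = 0" if "P (Q x) = 0" for x
    using * close[of "Q x"] that Q(2) by simp
  then show "rank_op Q \<le> rank_op P" using P(1) Q(1) rank_op_mono by blast
qed

section \<open>Contour integrals of operator-valued functions\<close>

text \<open>This lets the contour integrand be written as a composition of two continuous
  operator-valued maps, multiplication by the derivative of the path and the operator
  family.\<close>

lemma bounded_linear_Blinfun_scaleC:
  "bounded_linear (\<lambda>c. Blinfun (\<lambda>x::'a::complex_inner. c *\<^sub>C x))"
proof (rule bounded_linear_intro[where K=1])
  have apply_eq: "blinfun_apply (Blinfun (\<lambda>x::'a. c *\<^sub>C x)) = (\<lambda>x. c *\<^sub>C x)" for c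
    by (rule bounded_linear_Blinfun_apply[OF bounded_linear_scaleC])
  show "norm (Blinfun (\<lambda>x::'a. c *\<^sub>C x)) \<le> norm c * 1" for c
    by (rule norm_blinfun_bound) (auto simp: apply_eq)
  show "Blinfun (\<lambda>x::'a. (c + d) *\<^sub>C x) = Blinfun (\<lambda>x. c *\<^sub>C x) + Blinfun (\<lambda>x. d *\<^sub>C x)" for c d
    by (rule blinfun_eqI, unfold blinfun.bilinear_simps apply_eq) (rule scaleC_add_left)
  show "Blinfun (\<lambda>x::'a. (r *\<^sub>R c) *\<^sub>C x) = r *\<^sub>R Blinfun (\<lambda>x. c *\<^sub>C x)" for r c
    by (rule blinfun_eqI, unfold blinfun.bilinear_simps apply_eq)
       (simp add: scaleC_scaleR[symmetric] scaleC_scaleC scaleR_conv_of_real)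
qed

text \<open>The integrand of \<open>resolvent_integrand\<close> with an arbitrary operator family in
  place of the resolvent, so that the integrals also make sense for the factorised families at every
  \<tau>.\<close>

definition cintegrand :: "(complex \<Rightarrow> 'a::complex_inner \<Rightarrow> 'a) \<Rightarrow> (real \<Rightarrow> complex) \<Rightarrow> real \<Rightarrow> 'a \<Rightarrow>\<^sub>L 'a" where
  "cintegrand R \<gamma> s = Blinfun (\<lambda>f. vector_derivative \<gamma> (at s within {0..1}) *\<^sub>C R (\<gamma> s) f)"

definition cintegral :: "(complex \<Rightarrow> 'a::chilbert_space \<Rightarrow> 'a) \<Rightarrow> (real \<Rightarrow> complex) \<Rightarrow> 'a \<Rightarrow> 'a" where
  "cintegral R \<gamma> x = (1 / (2 * complex_of_real pi * \<i>)) *\<^sub>C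
     blinfun_apply (integral {0..1} (cintegrand R \<gamma>)) x"

text \<open>Continuity is meant in operator norm, hence it is imposed on the \<open>Blinfun\<close>
  images: plain functions do not carry that norm.\<close>

definition opcont_on :: "complex set \<Rightarrow> (complex \<Rightarrow> 'a::complex_inner \<Rightarrow> 'a) \<Rightarrow> bool" where
  "opcont_on K R \<longleftrightarrow> (\<forall>z\<in>K. bounded_clinear (R z)) \<and> continuous_on K (\<lambda>z. Blinfun (R z))"

lemma opcont_onD:
  assumes "opcont_on K R"
  shows "z \<in> K \<Longrightarrow> bounded_clinear (R z)" "continuous_on K (\<lambda>z. Blinfun (R z))"
    "z \<in> K \<Longrightarrow> blinfun_apply (Blinfun (R z)) = R z"
  using assms by (auto simp: opcont_on_def bounded_clinear_def bounded_linear_Blinfun_apply)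

lemma opcont_on_subset: "opcont_on K R \<Longrightarrow> L \<subseteq> K \<Longrightarrow> opcont_on L R"
  by (auto simp: opcont_on_def intro: continuous_on_subset)

lemma opcont_on_apply:
  assumes "opcont_on K R" shows "continuous_on K (\<lambda>z. R z x)"
proof -
  have "continuous_on K (\<lambda>z. blinfun_apply (Blinfun (R z)) x)"
    by (intro continuous_intros opcont_onD assms)
  then show ?thesis
    by (rule continuous_on_eq) (simp add: opcont_onD(3)[OF assms])
qed

text \<open>Off the two endpoints the integrand agrees with a norm-continuous function, and finitely
  many points do not affect integrability. The endpoints have to be left out because the derivative
  of a rectangular path jumps there.\<close>

lemma cintegrand_integrable_piece:
  fixes R :: "complex \<Rightarrow> 'a::chilbert_space \<Rightarrow> 'a"
  assumes R: "opcont_on (path_image \<gamma>) R" and \<gamma>: "path \<gamma>" and ab: "0 \<le> a" "a \<le> b" "b \<le> 1"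
    and h: "continuous_on {a..b} h"
    and deriv: "\<And>s. a < s \<Longrightarrow> s < b \<Longrightarrow> vector_derivative \<gamma> (at s within {0..1}) = h s"
  shows "cintegrand R \<gamma> integrable_on {a..b}"
proof (rule integrable_spike_finite[where S="{a,b}"])
  have \<gamma>_in: "\<gamma> s \<in> path_image \<gamma>" if "s \<in> {a..b}" for s using that ab by (auto simp: path_image_def)
  have "continuous_on {a..b} \<gamma>" using \<gamma> ab by (auto simp: path_def intro: continuous_on_subset)
  then have "continuous_on {a..b} (\<lambda>s. Blinfun (R (\<gamma> s)))"
    using opcont_onD(2)[OF R] \<gamma>_in by (auto intro: continuous_on_compose2)
  moreover have "continuous_on {a..b} (\<lambda>s. Blinfun (\<lambda>x::'a. h s *\<^sub>C x))"
    by (intro bounded_linear.continuous_on[OF bounded_linear_Blinfun_scaleC] h)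
  ultimately have "continuous_on {a..b} (\<lambda>s. Blinfun (\<lambda>x. h s *\<^sub>C x) o\<^sub>L Blinfun (R (\<gamma> s)))"
    by (intro bounded_bilinear.continuous_on[OF bounded_bilinear_blinfun_compose])
  then show "(\<lambda>s. Blinfun (\<lambda>x. h s *\<^sub>C x) o\<^sub>L Blinfun (R (\<gamma> s))) integrable_on {a..b}"
    by (rule integrable_continuous_real)
  fix s assume s: "s \<in> {a..b} - {a,b}"
  then have R': "bounded_linear (R (\<gamma> s))" using \<gamma>_in[of s] opcont_onD(1)[OF R] by (auto simp: bounded_clinear_def)
  have bl: "bounded_linear (\<lambda>f. h s *\<^sub>C R (\<gamma> s) f)"
    by (rule bounded_linear_compose[OF bounded_linear_scaleC R'])
  show "cintegrand R \<gamma> s = Blinfun (\<lambda>x. h s *\<^sub>C x) o\<^sub>L Blinfun (R (\<gamma> s))"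
    unfolding cintegrand_def using s deriv[of s]
    by (intro blinfun_eqI) (simp add: bounded_linear_Blinfun_apply bl R' bounded_linear_scaleC)
qed simp

lemma cintegrand_integrable_circlepath:
  fixes R :: "complex \<Rightarrow> 'a::chilbert_space \<Rightarrow> 'a"
  assumes "opcont_on (path_image (circlepath c r)) R"
  shows "cintegrand R (circlepath c r) integrable_on {0..1}"
  by (rule cintegrand_integrable_piece[OF assms,
        where h = "\<lambda>x. 2 * pi * \<i> * r * exp(2 * of_real pi * \<i> * x)"])
     (auto intro!: continuous_intros simp: vector_derivative_circlepath01)

lemma vector_derivative_affine_piece:
  fixes \<gamma> :: "real \<Rightarrow> complex"
  assumes "\<And>s. a < s \<Longrightarrow> s < b \<Longrightarrow> \<gamma> s = p + s *\<^sub>R q" "0 \<le> a" "b \<le> 1" "a < s" "s < b"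
  shows "vector_derivative \<gamma> (at s within {0..1}) = q"
proof -
  have "((\<lambda>s. p + s *\<^sub>R q) has_vector_derivative q) (at s)"
    by (auto intro!: derivative_eq_intros)
  then have "(\<gamma> has_vector_derivative q) (at s)"
    by (rule has_vector_derivative_transform_within_open[where S="{a<..<b}"]) (use assms in auto)
  then show ?thesis
    using assms by (intro vector_derivative_at_within_ivl) auto
qed

lemma cintegrand_integrable_rectpath:
  fixes R :: "complex \<Rightarrow> 'a::chilbert_space \<Rightarrow> 'a"
  assumes R: "opcont_on (path_image (rectpath p q)) R"
  shows "cintegrand R (rectpath p q) integrable_on {0..1}"
proof -
  define p2 where "p2 = Complex (Re q) (Im p)"
  define p4 where "p4 = Complex (Re p) (Im q)"
  have eq: "rectpath p q = linepath p p2 +++ linepath p2 q +++ linepath q p4 +++ linepath p4 p"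
    by (simp add: rectpath_def Let_def p2_def p4_def)
  have piece: "cintegrand R (rectpath p q) integrable_on {a..b}"
    if "0 \<le> a" "a < b" "b \<le> 1" "\<And>s. a < s \<Longrightarrow> s < b \<Longrightarrow> rectpath p q s = u + s *\<^sub>R w" for a b u w
    by (rule cintegrand_integrable_piece[OF R, where h="\<lambda>_. w"])
       (use that in \<open>auto intro!: vector_derivative_affine_piece[where a=a and b=b]\<close>)
  \<comment> \<open>The joins nest to the right and each of them halves the remaining parameter
    interval, so the corners sit at 1/2, 3/4 and 7/8, and the four sides are run through with the
    speed factors 2, 4, 8, 8.\<close>
  have 1: "cintegrand R (rectpath p q) integrable_on {0..1/2}"
    by (rule piece[where u=p and w="2 *\<^sub>R (p2 - p)"])
       (auto simp: eq joinpaths_def linepath_def algebra_simps scaleR_conv_of_real)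
  have 2: "cintegrand R (rectpath p q) integrable_on {1/2..3/4}"
    by (rule piece[where u="p2 - 2 *\<^sub>R (q - p2)" and w="4 *\<^sub>R (q - p2)"])
       (auto simp: eq joinpaths_def linepath_def algebra_simps scaleR_conv_of_real)
  have 3: "cintegrand R (rectpath p q) integrable_on {3/4..7/8}"
    by (rule piece[where u="q - 6 *\<^sub>R (p4 - q)" and w="8 *\<^sub>R (p4 - q)"])
       (auto simp: eq joinpaths_def linepath_def algebra_simps scaleR_conv_of_real)
  have 4: "cintegrand R (rectpath p q) integrable_on {7/8..1}"
    by (rule piece[where u="p4 - 7 *\<^sub>R (p - p4)" and w="8 *\<^sub>R (p - p4)"])
       (auto simp: eq joinpaths_def linepath_def algebra_simps scaleR_conv_of_real)
  have "cintegrand R (rectpath p q) integrable_on {7/8..1}" by fact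
  then have "cintegrand R (rectpath p q) integrable_on {3/4..1}"
    using Henstock_Kurzweil_Integration.integrable_combine[OF _ _ 3] by simp
  then have "cintegrand R (rectpath p q) integrable_on {1/2..1}"
    using Henstock_Kurzweil_Integration.integrable_combine[OF _ _ 2] by simp
  then show ?thesis
    using Henstock_Kurzweil_Integration.integrable_combine[OF _ _ 1] by simp
qed

text \<open>The map that sends an operator \<open>G\<close> to the inner product of
  \<open>W (G x)\<close> with \<open>y\<close> is bounded and linear, so it passes under the
  integral. The factor \<open>W\<close> is there for products of two contour integrals, where it is
  the value of the family at a point of the other contour.\<close>

lemma has_contour_integral_cintegral:
  assumes int: "cintegrand R \<gamma> integrable_on {0..1}" and R: "\<And>z. z \<in> path_image \<gamma> \<Longrightarrow> bounded_clinear (R z)"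
    and W: "bounded_clinear W"
  shows "((\<lambda>z. cinner (W (R z x)) y) has_contour_integral (2 * complex_of_real pi * \<i>) * cinner (W (cintegral R \<gamma> x)) y) \<gamma>"
proof -
  have "bounded_linear (\<lambda>G. cinner (W (blinfun_apply G x)) y)"
    by (intro bounded_linear_compose[OF bounded_linear_cinner_left] bounded_linear_compose[OF bounded_clinearD(1)[OF W]]
          blinfun.bounded_linear_left)
  from has_integral_linear[OF integrable_integral[OF int] this]
  have "((\<lambda>s. cinner (W (blinfun_apply (cintegrand R \<gamma> s) x)) y) has_integral
      cinner (W (blinfun_apply (integral {0..1} (cintegrand R \<gamma>)) x)) y) {0..1}"
    by (simp add: o_def)
  moreover have "cinner (W (blinfun_apply (cintegrand R \<gamma> s) x)) y =
      cinner (W (R (\<gamma> s) x)) y * vector_derivative \<gamma> (at s within {0..1})" if "s \<in> {0..1}" for s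
  proof -
    have "bounded_clinear (R (\<gamma> s))" using that R by (auto simp: path_image_def)
    then have "blinfun_apply (cintegrand R \<gamma> s) = (\<lambda>f. vector_derivative \<gamma> (at s within {0..1}) *\<^sub>C R (\<gamma> s) f)"
      unfolding cintegrand_def by (intro bounded_linear_Blinfun_apply bounded_clinearD bounded_clinear_scaleC)
    then show ?thesis by (simp add: bounded_clinearD[OF W] cinner_scaleC_left)
  qed
  ultimately have "((\<lambda>s. cinner (W (R (\<gamma> s) x)) y * vector_derivative \<gamma> (at s within {0..1})) has_integral
      cinner (W (blinfun_apply (integral {0..1} (cintegrand R \<gamma>)) x)) y) {0..1}"
    by (rule has_integral_eq[rotated]) auto
  then show ?thesis
    unfolding has_contour_integral_def cintegral_def by (simp add: bounded_clinearD[OF W] cinner_scaleC_left)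
qed

lemma cinner_cintegral:
  assumes "cintegrand R \<gamma> integrable_on {0..1}" "\<And>z. z \<in> path_image \<gamma> \<Longrightarrow> bounded_clinear (R z)"
  shows "cinner (cintegral R \<gamma> x) y = contour_integral \<gamma> (\<lambda>z. cinner (R z x) y) / (2 * complex_of_real pi * \<i>)"
  using contour_integral_unique[OF has_contour_integral_cintegral[OF assms bounded_clinear_ident]] by simp

lemma cintegral_cong:
  assumes "\<And>z. z \<in> path_image \<gamma> \<Longrightarrow> R z = R' z"
  shows "cintegral R \<gamma> = cintegral R' \<gamma>"
    and "cintegrand R \<gamma> integrable_on {0..1} \<longleftrightarrow> cintegrand R' \<gamma> integrable_on {0..1}"
proof -
  have *: "cintegrand R \<gamma> s = cintegrand R' \<gamma> s" if "s \<in> {0..1}" for s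
    using assms[of "\<gamma> s"] that by (simp add: cintegrand_def path_image_def)
  show "cintegrand R \<gamma> integrable_on {0..1} \<longleftrightarrow> cintegrand R' \<gamma> integrable_on {0..1}"
    by (rule integrable_cong) (use * in auto)
  have "integral {0..1} (cintegrand R \<gamma>) = integral {0..1} (cintegrand R' \<gamma>)"
    by (rule integral_cong) (use * in auto)
  then show "cintegral R \<gamma> = cintegral R' \<gamma>"
    by (simp add: cintegral_def fun_eq_iff)
qed

text \<open>A loop assembled from finitely many pieces with continuous derivative; this is what Fubini's
  theorem for iterated contour integrals needs.\<close>

definition smooth_pieces :: "(real \<Rightarrow> complex) \<Rightarrow> (real \<Rightarrow> complex) list \<Rightarrow> bool" where
  "smooth_pieces \<gamma> ps \<longleftrightarrow>
     (\<forall>p\<in>set ps. valid_path p \<and> continuous_on {0..1} (\<lambda>t. vector_derivative p (at t)) \<and> path_image p \<subseteq> path_image \<gamma>) \<and>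
     (\<forall>f. continuous_on (path_image \<gamma>) f \<longrightarrow> f contour_integrable_on \<gamma> \<and>
        contour_integral \<gamma> f = (\<Sum>p\<leftarrow>ps. contour_integral p f))"

lemma smooth_pieces_circlepath: "smooth_pieces (circlepath c r) [circlepath c r]"
  unfolding smooth_pieces_def
  by (auto simp: vector_derivative_circlepath intro!: continuous_intros contour_integrable_continuous_circlepath)

lemma smooth_pieces_rectpath:
  "smooth_pieces (rectpath p q) [linepath p (Complex (Re q) (Im p)), linepath (Complex (Re q) (Im p)) q,
     linepath q (Complex (Re p) (Im q)), linepath (Complex (Re p) (Im q)) p]"
  unfolding smooth_pieces_def
proof (intro conjI allI impI ballI)
  fix f :: "complex \<Rightarrow> complex" assume f: "continuous_on (path_image (rectpath p q)) f"
  let ?p2 = "Complex (Re q) (Im p)" and ?p4 = "Complex (Re p) (Im q)"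
  have im: "path_image (rectpath p q) = closed_segment p ?p2 \<union> closed_segment ?p2 q \<union> closed_segment q ?p4 \<union> closed_segment ?p4 p"
    by (simp add: rectpath_def Let_def path_image_join Un_assoc)
  have "f contour_integrable_on linepath p ?p2" "f contour_integrable_on linepath ?p2 q"
    "f contour_integrable_on linepath q ?p4" "f contour_integrable_on linepath ?p4 p"
    by (auto intro!: contour_integrable_continuous_linepath continuous_on_subset[OF f] simp: im)
  then show "contour_integral (rectpath p q) f =
      (\<Sum>p\<leftarrow>[linepath p ?p2, linepath ?p2 q, linepath q ?p4, linepath ?p4 p]. contour_integral p f)"
    and "f contour_integrable_on rectpath p q"
    by (simp_all add: rectpath_def Let_def)
qed (auto simp: rectpath_def Let_def path_image_join)

section \<open>Fubini's theorem and length bounds for piecewise smooth contours\<close>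

lemma continuous_on_contour_integral_param:
  assumes f: "continuous_on (A \<times> path_image p) (\<lambda>(z, w). f z w)" and "valid_path p"
    and "continuous_on {0..1} (\<lambda>t. vector_derivative p (at t))"
  shows "continuous_on A (\<lambda>z. contour_integral p (f z))"
proof -
  have p: "continuous_on {0..1} p" using \<open>valid_path p\<close> valid_path_imp_path path_def by blast
  have "continuous_on (A \<times> {0..1}) ((\<lambda>(z, w). f z w) \<circ> (\<lambda>(z, t). (z, p t)))"
  proof (rule continuous_on_compose)
    show "continuous_on (A \<times> {0..1}) (\<lambda>(z, t). (z, p t))"
      unfolding case_prod_unfold
      by (intro continuous_intros continuous_on_compose2[OF p]) auto
    show "continuous_on ((\<lambda>(z, t). (z, p t)) ` (A \<times> {0..1})) (\<lambda>(z, w). f z w)"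
      by (rule continuous_on_subset[OF f]) (auto simp: path_image_def)
  qed
  then have "continuous_on (A \<times> cbox 0 1) (\<lambda>(z, t). f z (p t) * vector_derivative p (at t))"
    unfolding case_prod_unfold o_def cbox_interval
    by (intro continuous_intros continuous_on_compose2[OF assms(3)]) auto
  then have "continuous_on A (\<lambda>z. integral (cbox 0 1) (\<lambda>t. f z (p t) * vector_derivative p (at t)))"
    by (rule integral_continuous_on_param)
  then show ?thesis by (simp add: contour_integral_integral cbox_interval)
qed

lemma contour_integrable_smooth:
  assumes "continuous_on (path_image p) f" "valid_path p" "continuous_on {0..1} (\<lambda>t. vector_derivative p (at t))"
  shows "f contour_integrable_on p"
proof -
  have p: "continuous_on {0..1} p" using \<open>valid_path p\<close> valid_path_imp_path path_def by blast
  have "continuous_on {0..1} (\<lambda>t. f (p t) * vector_derivative p (at t))"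
    by (intro continuous_intros assms continuous_on_compose2[OF assms(1) p]) (auto simp: path_image_def)
  then show ?thesis
    unfolding contour_integrable_on by (rule integrable_continuous_real)
qed

lemma contour_integral_sum_list:
  assumes "\<And>q. q \<in> set qs \<Longrightarrow> g q contour_integrable_on p"
  shows "contour_integral p (\<lambda>z. \<Sum>q\<leftarrow>qs. g q z) = (\<Sum>q\<leftarrow>qs. contour_integral p (g q))
    \<and> (\<lambda>z. \<Sum>q\<leftarrow>qs. g q z) contour_integrable_on p"
  using assms
proof (induction qs)
  case Nil
  then show ?case
    using has_contour_integral_0[of p] by (auto simp: contour_integrable_on_def)
next
  case (Cons q qs)
  then show ?case by (auto simp: contour_integral_add intro: contour_integrable_add)
qed

text \<open>Both iterated integrals expand into the same finite double sum over pairs of smooth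
  pieces, and for each pair the order of integration may be exchanged.\<close>

lemma contour_integral_swap_pieces:
  assumes \<gamma>: "smooth_pieces \<gamma> ps" and \<eta>: "smooth_pieces \<eta> qs"
    and f: "continuous_on (path_image \<gamma> \<times> path_image \<eta>) (\<lambda>(z, w). f z w)"
  shows "contour_integral \<gamma> (\<lambda>z. contour_integral \<eta> (f z)) = contour_integral \<eta> (\<lambda>w. contour_integral \<gamma> (\<lambda>z. f z w))"
proof -
  \<comment> \<open>Stated for arbitrary contours, because it is applied a second time with the
    roles of the two contours exchanged.\<close>
  have expand: "contour_integral \<gamma> (\<lambda>z. contour_integral \<eta> (f z)) =
      (\<Sum>p\<leftarrow>ps. \<Sum>q\<leftarrow>qs. contour_integral p (\<lambda>z. contour_integral q (f z)))"
    if \<gamma>: "smooth_pieces \<gamma> ps" and \<eta>: "smooth_pieces \<eta> qs"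
      and f: "continuous_on (path_image \<gamma> \<times> path_image \<eta>) (\<lambda>(z, w). f z w)" for \<gamma> \<eta> ps qs f
  proof -
    have cont: "continuous_on (path_image \<gamma>) (\<lambda>z. contour_integral q (f z))" if "q \<in> set qs" for q
      using that \<eta> unfolding smooth_pieces_def
      by (intro continuous_on_contour_integral_param continuous_on_subset[OF f]) auto
    have slice: "continuous_on (path_image \<eta>) (f z)" if "z \<in> path_image \<gamma>" for z
    proof -
      have "continuous_on (path_image \<eta>) ((\<lambda>(z, w). f z w) \<circ> Pair z)"
        by (intro continuous_on_compose continuous_intros continuous_on_subset[OF f]) (use that in auto)
      then show ?thesis by (simp add: o_def)
    qed
    have sum_cont: "continuous_on (path_image \<gamma>) (\<lambda>z. \<Sum>q\<leftarrow>qs. contour_integral q (f z))"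
      using cont by (induction qs) (auto intro!: continuous_intros)
    have "contour_integral \<gamma> (\<lambda>z. contour_integral \<eta> (f z)) = contour_integral \<gamma> (\<lambda>z. \<Sum>q\<leftarrow>qs. contour_integral q (f z))"
      using \<eta> slice by (intro contour_integral_cong) (auto simp: smooth_pieces_def)
    also have "\<dots> = (\<Sum>p\<leftarrow>ps. contour_integral p (\<lambda>z. \<Sum>q\<leftarrow>qs. contour_integral q (f z)))"
      using \<gamma> sum_cont by (simp add: smooth_pieces_def)
    also have "\<dots> = (\<Sum>p\<leftarrow>ps. \<Sum>q\<leftarrow>qs. contour_integral p (\<lambda>z. contour_integral q (f z)))"
    proof (intro arg_cong[of _ _ sum_list] map_cong refl)
      fix p assume "p \<in> set ps"
      then show "contour_integral p (\<lambda>z. \<Sum>q\<leftarrow>qs. contour_integral q (f z)) = (\<Sum>q\<leftarrow>qs. contour_integral p (\<lambda>z. contour_integral q (f z)))"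
        using \<gamma> unfolding smooth_pieces_def
        by (intro contour_integral_sum_list[THEN conjunct1] contour_integrable_smooth continuous_on_subset[OF cont]) auto
    qed
    finally show ?thesis .
  qed
  have f': "continuous_on (path_image \<eta> \<times> path_image \<gamma>) (\<lambda>(w, z). f z w)"
  proof -
    have "continuous_on (path_image \<eta> \<times> path_image \<gamma>) ((\<lambda>(z, w). f z w) \<circ> prod.swap)"
      by (intro continuous_on_compose continuous_on_swap continuous_on_subset[OF f]) auto
    then show ?thesis by (simp add: o_def case_prod_unfold)
  qed
  have "contour_integral \<gamma> (\<lambda>z. contour_integral \<eta> (f z)) =
      (\<Sum>p\<leftarrow>ps. \<Sum>q\<leftarrow>qs. contour_integral p (\<lambda>z. contour_integral q (f z)))"
    by (rule expand[OF assms])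
  also have "\<dots> = (\<Sum>p\<leftarrow>ps. \<Sum>q\<leftarrow>qs. contour_integral q (\<lambda>w. contour_integral p (\<lambda>z. f z w)))"
  proof (intro arg_cong[of _ _ sum_list] map_cong refl)
    fix p q assume "p \<in> set ps" "q \<in> set qs"
    then show "contour_integral p (\<lambda>z. contour_integral q (f z)) = contour_integral q (\<lambda>w. contour_integral p (\<lambda>z. f z w))"
      using \<gamma> \<eta> unfolding smooth_pieces_def
      by (intro contour_integral_swap continuous_on_subset[OF f]) auto
  qed
  also have "\<dots> = (\<Sum>q\<leftarrow>qs. \<Sum>p\<leftarrow>ps. contour_integral q (\<lambda>w. contour_integral p (\<lambda>z. f z w)))"
    by (induction ps) (auto simp: sum_list_addf)
  also have "\<dots> = contour_integral \<eta> (\<lambda>w. contour_integral \<gamma> (\<lambda>z. f z w))"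
    by (rule expand[OF \<eta> \<gamma> f', symmetric])
  finally show ?thesis .
qed

text \<open>The constant is the sum over the pieces of a bound for the speed. It takes the place of
  the length of the contour and depends on nothing else.\<close>

lemma smooth_pieces_bound:
  assumes "smooth_pieces \<gamma> ps"
  obtains L where "0 \<le> L"
    "\<And>f k. \<lbrakk>continuous_on (path_image \<gamma>) f; \<And>z. z \<in> path_image \<gamma> \<Longrightarrow> cmod (f z) \<le> k; 0 \<le> k\<rbrakk>
       \<Longrightarrow> cmod (contour_integral \<gamma> f) \<le> L * k"
proof -
  have "\<exists>L\<ge>0. \<forall>f k. continuous_on (path_image \<gamma>) f \<and> (\<forall>z\<in>path_image \<gamma>. cmod (f z) \<le> k) \<and> 0 \<le> k
      \<longrightarrow> cmod (\<Sum>p\<leftarrow>qs. contour_integral p f) \<le> L * k" if "set qs \<subseteq> set ps" for qs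
    using that
  proof (induction qs)
    case Nil
    show ?case by (rule exI[of _ 0]) simp
  next
    case (Cons p qs)
    then obtain L where L: "L \<ge> 0" "\<And>f k. continuous_on (path_image \<gamma>) f \<Longrightarrow> (\<forall>z\<in>path_image \<gamma>. cmod (f z) \<le> k) \<Longrightarrow> 0 \<le> k
      \<Longrightarrow> cmod (\<Sum>p\<leftarrow>qs. contour_integral p f) \<le> L * k" by auto
    have p: "valid_path p" "continuous_on {0..1} (\<lambda>t. vector_derivative p (at t))" "path_image p \<subseteq> path_image \<gamma>"
      using Cons.prems assms by (auto simp: smooth_pieces_def)
    have "bounded ((\<lambda>t. vector_derivative p (at t)) ` {0..1})"
      by (intro compact_imp_bounded compact_continuous_image p) auto
    then obtain B where B: "B > 0" "\<And>t. t \<in> {0..1} \<Longrightarrow> norm (vector_derivative p (at t)) \<le> B"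
      unfolding bounded_pos by auto
    have "cmod (\<Sum>p\<leftarrow>p # qs. contour_integral p f) \<le> (B + L) * k"
      if f: "continuous_on (path_image \<gamma>) f" "\<forall>z\<in>path_image \<gamma>. cmod (f z) \<le> k" "0 \<le> k" for f k
    proof -
      have "f contour_integrable_on p"
        using contour_integrable_smooth continuous_on_subset f(1) p by blast
      then have "((\<lambda>t. f (p t) * vector_derivative p (at t)) has_integral contour_integral p f) {0..1}"
        unfolding contour_integrable_on contour_integral_integral by (rule integrable_integral)
      then have I: "((\<lambda>t. f (p t) * vector_derivative p (at t)) has_integral contour_integral p f) (cbox 0 1)"
        by (simp add: cbox_interval)
      have "norm (f (p t) * vector_derivative p (at t)) \<le> k * B" if t: "t \<in> cbox 0 1" for t
      proof -
        have "p t \<in> path_image \<gamma>" using p(3) t by (auto simp: path_image_def cbox_interval)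
        then show ?thesis
          using f B t by (auto simp: norm_mult cbox_interval intro!: mult_mono)
      qed
      then have "norm (contour_integral p f) \<le> (k * B) * measure lborel (cbox 0 (1::real))"
        using f B by (intro has_integral_bound[OF _ I]) auto
      then have "cmod (contour_integral p f) \<le> B * k" by (simp add: mult.commute)
      then show ?thesis
        using L(2)[OF f] norm_triangle_ineq[of "contour_integral p f" "\<Sum>p\<leftarrow>qs. contour_integral p f"]
        by (simp add: algebra_simps)
    qed
    then show ?case using B(1) L(1) by (intro exI[of _ "B + L"]) auto
  qed
  from this[of ps] obtain L where "L \<ge> 0" "\<And>f k. continuous_on (path_image \<gamma>) f \<Longrightarrow> (\<forall>z\<in>path_image \<gamma>. cmod (f z) \<le> k) \<Longrightarrow> 0 \<le> k
      \<Longrightarrow> cmod (\<Sum>p\<leftarrow>ps. contour_integral p f) \<le> L * k" by auto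
  with assms show ?thesis by (intro that[of L]) (auto simp: smooth_pieces_def)
qed

section \<open>Contours\<close>

text \<open>The closed convex body travels with its boundary path: winding numbers, disjointness and
  the enclosed eigenvalues are all read off from its interior. The two shapes are those of the
  regions in the theorem.\<close>

definition contour :: "(real \<Rightarrow> complex) \<Rightarrow> complex set \<Rightarrow> bool" where
  "contour \<gamma> K \<longleftrightarrow> (\<exists>c r. 0 < r \<and> \<gamma> = circlepath c r \<and> K = cball c r) \<or>
     (\<exists>p q. Re p < Re q \<and> Im p < Im q \<and> \<gamma> = rectpath p q \<and> K = cbox p q)"

lemma contourD:
  assumes "contour \<gamma> K"
  shows "valid_path \<gamma>" "pathfinish \<gamma> = pathstart \<gamma>" "path_image \<gamma> = K - interior K" "convex K" "compact K"
    "interior K \<noteq> {}" "w \<in> interior K \<Longrightarrow> winding_number \<gamma> w = 1" "w \<notin> K \<Longrightarrow> winding_number \<gamma> w = 0"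
    "\<exists>ps. smooth_pieces \<gamma> ps"
proof -
  consider (circle) c r where "0 < r" "\<gamma> = circlepath c r" "K = cball c r" |
    (rect) p q where "Re p < Re q" "Im p < Im q" "\<gamma> = rectpath p q" "K = cbox p q"
    using assms unfolding contour_def by blast
  then have *: "valid_path \<gamma> \<and> pathfinish \<gamma> = pathstart \<gamma> \<and> path_image \<gamma> = K - interior K \<and> convex K \<and> compact K
    \<and> interior K \<noteq> {} \<and> (w \<in> interior K \<longrightarrow> winding_number \<gamma> w = 1) \<and> (\<exists>ps. smooth_pieces \<gamma> ps)"
  proof cases
    case circle
    then show ?thesis
      using smooth_pieces_circlepath[of c r]
      by (auto simp: interior_cball cball_diff_eq_sphere dist_norm norm_minus_commute intro!: winding_number_circlepath)
  next
    case rect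
    have "(1/2) *\<^sub>R (p + q) \<in> box p q" using rect by (simp add: in_box_complex_iff)
    then show ?thesis
      using rect smooth_pieces_rectpath[of p q]
      by (auto simp: interior_cbox path_image_rectpath_cbox_minus_box intro!: winding_number_rectpath)
  qed
  then show "valid_path \<gamma>" "pathfinish \<gamma> = pathstart \<gamma>" and im: "path_image \<gamma> = K - interior K" and "convex K" "compact K"
    "interior K \<noteq> {}" "w \<in> interior K \<Longrightarrow> winding_number \<gamma> w = 1" "\<exists>ps. smooth_pieces \<gamma> ps" by blast+
  show "w \<notin> K \<Longrightarrow> winding_number \<gamma> w = 0"
    by (rule winding_number_zero_outside[of _ K]) (use * in \<open>auto intro: valid_path_imp_path\<close>)
qed

lemma contour_integrable:
  fixes R :: "complex \<Rightarrow> 'a::chilbert_space \<Rightarrow> 'a"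
  assumes "contour \<gamma> K" "opcont_on (path_image \<gamma>) R"
  shows "cintegrand R \<gamma> integrable_on {0..1}"
  using assms cintegrand_integrable_circlepath cintegrand_integrable_rectpath unfolding contour_def by blast

lemma contour_scale:
  assumes "contour \<gamma> K" "0 < t"
  shows "contour (\<lambda>s. c + t *\<^sub>R (\<gamma> s - c)) ((\<lambda>z. c + t *\<^sub>R (z - c)) ` K)"
proof -
  consider (circle) c' r where "0 < r" "\<gamma> = circlepath c' r" "K = cball c' r" |
    (rect) p q where "Re p < Re q" "Im p < Im q" "\<gamma> = rectpath p q" "K = cbox p q"
    using assms(1) unfolding contour_def by blast
  then show ?thesis
  proof cases
    case circle
    have "(\<lambda>s. c + t *\<^sub>R (\<gamma> s - c)) = circlepath (c + t *\<^sub>R (c' - c)) (t * r)"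
      unfolding circle circlepath by (auto simp: scaleR_conv_of_real algebra_simps)
    moreover have "(\<lambda>z. c + t *\<^sub>R (z - c)) ` K = cball (c + t *\<^sub>R (c' - c)) (t * r)"
    proof (intro set_eqI iffI)
      fix w assume "w \<in> (\<lambda>z. c + t *\<^sub>R (z - c)) ` K"
      then obtain z where z: "z \<in> K" "w = c + t *\<^sub>R (z - c)" by blast
      have "(c + t *\<^sub>R (c' - c)) - w = t *\<^sub>R (c' - z)" using z by (simp add: algebra_simps)
      then show "w \<in> cball (c + t *\<^sub>R (c' - c)) (t * r)"
        using z \<open>0 < t\<close> by (simp add: circle dist_norm)
    next
      fix w assume w: "w \<in> cball (c + t *\<^sub>R (c' - c)) (t * r)"
      define z where "z = c + (1 / t) *\<^sub>R (w - c)"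
      have "w = c + t *\<^sub>R (z - c)" using \<open>0 < t\<close> by (simp add: z_def)
      moreover have "t *\<^sub>R (c' - z) = (c + t *\<^sub>R (c' - c)) - w"
        using \<open>0 < t\<close> by (simp add: z_def algebra_simps)
      then have "t * norm (c' - z) \<le> t * r"
        using w \<open>0 < t\<close> by (metis abs_of_pos dist_norm mem_cball norm_scaleR)
      then have "z \<in> K" using \<open>0 < t\<close> by (simp add: circle dist_norm)
      ultimately show "w \<in> (\<lambda>z. c + t *\<^sub>R (z - c)) ` K" by blast
    qed
    moreover have "0 < t * r" using \<open>0 < t\<close> circle by simp
    ultimately show ?thesis unfolding contour_def by blast
  next
    case rect
    let ?p = "c + t *\<^sub>R (p - c)" and ?q = "c + t *\<^sub>R (q - c)"
    have "(\<lambda>s. c + t *\<^sub>R (\<gamma> s - c)) = rectpath ?p ?q"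
      unfolding rect rectpath_def Let_def
      by (auto simp: joinpaths_def linepath_def fun_eq_iff complex_eq_iff algebra_simps)
    moreover have "(\<lambda>z. c + t *\<^sub>R (z - c)) ` K = cbox ?p ?q"
    proof (intro set_eqI iffI)
      fix w assume "w \<in> (\<lambda>z. c + t *\<^sub>R (z - c)) ` K"
      then show "w \<in> cbox ?p ?q" using \<open>0 < t\<close> by (auto simp: rect in_cbox_complex_iff)
    next
      fix w assume w: "w \<in> cbox ?p ?q"
      define z where "z = c + (1 / t) *\<^sub>R (w - c)"
      have "w = c + t *\<^sub>R (z - c)" using \<open>0 < t\<close> by (simp add: z_def)
      moreover have "z \<in> K"
        using w \<open>0 < t\<close> unfolding \<open>w = c + t *\<^sub>R (z - c)\<close> by (simp add: rect in_cbox_complex_iff)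
      ultimately show "w \<in> (\<lambda>z. c + t *\<^sub>R (z - c)) ` K" by blast
    qed
    moreover have "Re ?p < Re ?q" "Im ?p < Im ?q" using rect \<open>0 < t\<close> by auto
    ultimately show ?thesis unfolding contour_def by blast
  qed
qed

text \<open>A homothety with an interior point as centre and a ratio slightly below 1 moves a convex
  body into its own interior. When the displacement is small enough, the straight-line homotopy
  stays inside \<open>U\<close>.\<close>

lemma contour_shrink:
  assumes \<gamma>: "contour \<gamma> K" and U: "path_image \<gamma> \<subseteq> U" "open U"
  obtains \<eta> L where "contour \<eta> L" "L \<subseteq> interior K" "path_image \<eta> \<subseteq> U" "homotopic_loops U \<gamma> \<eta>"
proof -
  obtain c where c: "c \<in> interior K" using contourD(6)[OF \<gamma>] by blast
  have "compact (path_image \<gamma>)" using contourD(1)[OF \<gamma>] by (intro compact_path_image valid_path_imp_path)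
  then obtain e where e: "e > 0" "(\<Union>z\<in>path_image \<gamma>. ball z e) \<subseteq> U"
    using compact_subset_open_imp_ball_epsilon_subset U by metis
  have "bounded K" using contourD(5)[OF \<gamma>] by (rule compact_imp_bounded)
  then obtain B where B: "B > 0" "\<And>z. z \<in> K \<Longrightarrow> dist z c \<le> B"
    by (metis bounded_any_center dist_commute gt_ex less_eq_real_def order.strict_trans1 not_le order_less_trans)
  \<comment> \<open>A point of the contour is displaced by \<open>d\<close> times its distance to
    \<open>c\<close>, hence by at most \<open>d * B\<close>, which has to stay below
    \<open>e\<close>; the bound 1/2 keeps the ratio \<open>1 - d\<close> positive.\<close>
  define d where "d = min (1/2) (e / (2 * B))"
  have d: "0 < d" "d \<le> 1/2" "d * B < e"
  proof -
    show "0 < d" "d \<le> 1/2" using e B by (auto simp: d_def)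
    have "d * B \<le> e / (2 * B) * B" using B by (intro mult_right_mono) (auto simp: d_def)
    also have "\<dots> < e" using e B by simp
    finally show "d * B < e" .
  qed
  define \<eta> where "\<eta> = (\<lambda>s. c + (1 - d) *\<^sub>R (\<gamma> s - c))"
  define L where "L = (\<lambda>z. c + (1 - d) *\<^sub>R (z - c)) ` K"
  have \<eta>: "contour \<eta> L" unfolding \<eta>_def L_def by (rule contour_scale[OF \<gamma>]) (use d in auto)
  have "L \<subseteq> interior K"
  proof
    fix w assume "w \<in> L"
    then obtain z where "z \<in> K" "w = c + (1 - d) *\<^sub>R (z - c)" by (auto simp: L_def)
    moreover have "z - d *\<^sub>R (z - c) \<in> interior K"
      by (rule mem_interior_convex_shrink) (use contourD(4)[OF \<gamma>] c \<open>z \<in> K\<close> d in auto)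
    moreover have "c + (1 - d) *\<^sub>R (z - c) = z - d *\<^sub>R (z - c)" by (simp add: algebra_simps)
    ultimately show "w \<in> interior K" by simp
  qed
  moreover have near: "\<eta> s \<in> ball (\<gamma> s) e" "\<gamma> s \<in> path_image \<gamma>" if "s \<in> {0..1}" for s
  proof -
    show "\<gamma> s \<in> path_image \<gamma>" using that by (auto simp: path_image_def)
    then have "\<gamma> s \<in> K" using contourD(3)[OF \<gamma>] by auto
    have "\<gamma> s - \<eta> s = d *\<^sub>R (\<gamma> s - c)" by (simp add: \<eta>_def algebra_simps)
    then have "dist (\<gamma> s) (\<eta> s) = d * dist (\<gamma> s) c" using d by (simp add: dist_norm)
    also have "\<dots> \<le> d * B" using B(2) \<open>\<gamma> s \<in> K\<close> d by (intro mult_left_mono) auto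
    finally show "\<eta> s \<in> ball (\<gamma> s) e" using d by simp
  qed
  then have "path_image \<eta> \<subseteq> U" using e by (fastforce simp: path_image_def)
  moreover have "homotopic_loops U \<gamma> \<eta>"
  proof (rule homotopic_loops_linear)
    show "closed_segment (\<gamma> t) (\<eta> t) \<subseteq> U" if "t \<in> {0..1}" for t
    proof -
      have "closed_segment (\<gamma> t) (\<eta> t) \<subseteq> ball (\<gamma> t) e"
        by (rule closed_segment_subset) (use near[OF that] e in auto)
      then show ?thesis using e(2) near(2)[OF that] by blast
    qed
  qed (use contourD(1,2)[OF \<gamma>] contourD(1,2)[OF \<eta>] in \<open>auto intro: valid_path_imp_path\<close>)
  ultimately show ?thesis using that \<eta> by blast
qed

section \<open>Pseudo-resolvents and their Riesz projections\<close>

text \<open>The first resolvent identity in the sign convention of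
  \<open>(z - T)\<^sup>-\<^sup>1\<close>. No operator needs to stand behind the family, so the
  intermediate families between the unperturbed and the perturbed problem are covered as
  well.\<close>

locale pseudo_resolvent =
  fixes U :: "complex set" and R :: "complex \<Rightarrow> 'a::chilbert_space \<Rightarrow> 'a"
  assumes open_U: "open U"
    and bounded_clinear: "z \<in> U \<Longrightarrow> bounded_clinear (R z)"
    and identity: "z \<in> U \<Longrightarrow> w \<in> U \<Longrightarrow> R z x - R w x = (w - z) *\<^sub>C R z (R w x)"
begin

text \<open>A local bound on the family comes from the identity itself: once
  \<open>cmod (z - w)\<close> times the norm \<open>K\<close> of \<open>R w\<close> is at most 1/2,
  the term with \<open>R z\<close> can be absorbed and the norm of \<open>R z\<close> is at most
  \<open>2 * K\<close>. Inserting this bound into the identity gives the estimate.\<close>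

lemma Lipschitz_near:
  assumes "w \<in> U"
  obtains C d where "0 \<le> C" "d > 0" "\<And>z x. z \<in> U \<Longrightarrow> cmod (z - w) < d \<Longrightarrow> norm (R z x - R w x) \<le> cmod (z - w) * C * norm x"
proof -
  define K where "K = onorm (R w)"
  have K: "0 \<le> K" "norm (R w x) \<le> K * norm x" for x
    using bounded_clinearD[OF bounded_clinear[OF assms]] onorm_pos_le unfolding K_def by blast+
  have "norm (R z x - R w x) \<le> cmod (z - w) * (K * (2 * K)) * norm x"
    if z: "z \<in> U" "cmod (z - w) < 1 / (2 * (K + 1))" for z x
  proof -
    have diff: "R z x - R w x = (w - z) *\<^sub>C R w (R z x)"
      using identity[OF assms z(1), of x] by (metis minus_diff_eq scaleC_minus_left)
    have "norm (R z x) \<le> norm (R w x) + cmod (z - w) * norm (R w (R z x))"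
    proof -
      have "R z x = R w x + (w - z) *\<^sub>C R w (R z x)" using diff by (simp add: algebra_simps)
      then show ?thesis
        using norm_triangle_ineq[of "R w x" "(w - z) *\<^sub>C R w (R z x)"] by (simp add: norm_minus_commute[of z w])
    qed
    also have "\<dots> \<le> K * norm x + cmod (z - w) * (K * norm (R z x))"
      by (intro add_mono mult_left_mono K) auto
    also have "\<dots> \<le> K * norm x + (1/2) * norm (R z x)"
    proof -
      have "cmod (z - w) * K \<le> 1 / (2 * (K + 1)) * K" using z K by (intro mult_right_mono) auto
      also have "\<dots> \<le> 1/2" using K by (simp add: field_simps)
      finally have "cmod (z - w) * K * norm (R z x) \<le> 1/2 * norm (R z x)" by (rule mult_right_mono) simp
      then show ?thesis by (simp add: mult.assoc)
    qed
    finally have "norm (R z x) \<le> 2 * K * norm x" by simp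
    then have "norm (R w (R z x)) \<le> K * (2 * K * norm x)"
      using K mult_left_mono order_trans by blast
    then show ?thesis
      by (simp add: diff norm_minus_commute mult_left_mono mult.assoc)
  qed
  moreover have "0 < 1 / (2 * (K + 1))" "0 \<le> K * (2 * K)" using K(1) by simp_all
  ultimately show ?thesis using that by blast
qed

lemma opcont: "opcont_on U R"
  unfolding opcont_on_def
proof (intro conjI ballI bounded_clinear)
  have blin: "blinfun_apply (Blinfun (R z)) = R z" if "z \<in> U" for z
    using bounded_clinear[OF that] by (simp add: bounded_clinear_def bounded_linear_Blinfun_apply)
  show "continuous_on U (\<lambda>z. Blinfun (R z))"
    unfolding continuous_on_def
  proof
    fix w assume "w \<in> U"
    from Lipschitz_near[OF this] obtain C d where C: "0 \<le> C" "d > 0" "\<And>z x. z \<in> U \<Longrightarrow> cmod (z - w) < d \<Longrightarrow> norm (R z x - R w x) \<le> cmod (z - w) * C * norm x"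
      by metis
    have "\<forall>\<^sub>F z in at w within U. norm (Blinfun (R z) - Blinfun (R w)) \<le> cmod (z - w) * C"
      unfolding eventually_at
    proof (intro exI[of _ d] conjI ballI impI \<open>d > 0\<close>)
      fix z assume "z \<in> U" "z \<noteq> w \<and> dist z w < d"
      then show "norm (Blinfun (R z) - Blinfun (R w)) \<le> cmod (z - w) * C"
        using C \<open>w \<in> U\<close> by (intro norm_blinfun_bound) (auto simp: blinfun.bilinear_simps blin dist_norm)
    qed
    moreover have "((\<lambda>z. cmod (z - w) * C) \<longlongrightarrow> 0) (at w within U)"
      by (auto intro!: tendsto_eq_intros)
    ultimately have "((\<lambda>z. Blinfun (R z) - Blinfun (R w)) \<longlongrightarrow> 0) (at w within U)"
      by (rule Lim_null_comparison)
    then show "((\<lambda>z. Blinfun (R z)) \<longlongrightarrow> Blinfun (R w)) (at w within U)"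
      by (rule Lim_null[THEN iffD2])
  qed
qed

lemma commute:
  assumes "z \<in> U" "w \<in> U" shows "R z (R w x) = R w (R z x)"
proof (cases "z = w")
  case False
  have "(w - z) *\<^sub>C R z (R w x) = (w - z) *\<^sub>C R w (R z x)"
    using identity[OF assms, of x] identity[OF assms(2,1), of x] by (metis minus_diff_eq scaleC_minus_left)
  then show ?thesis using False by (simp add: scaleC_cancel)
qed simp

lemma has_field_derivative_resolvent:
  assumes "w \<in> U"
  shows "((\<lambda>z. cinner (R z x) y) has_field_derivative - cinner (R w (R w x)) y) (at w)"
proof -
  have "continuous_on U (\<lambda>z. cinner (R z (R w x)) y)"
    by (intro continuous_on_cinner continuous_on_const opcont_on_apply opcont)
  then have "((\<lambda>z. cinner (R z (R w x)) y) \<longlongrightarrow> cinner (R w (R w x)) y) (at w)"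
    using assms open_U by (simp add: continuous_on_eq_continuous_at continuous_at)
  then have "((\<lambda>z. - cinner (R z (R w x)) y) \<longlongrightarrow> - cinner (R w (R w x)) y) (at w)"
    by (rule tendsto_minus)
  moreover have "\<forall>\<^sub>F z in at w. - cinner (R z (R w x)) y = (cinner (R z x) y - cinner (R w x) y) / (z - w)"
    using eventually_at_in_open'[OF open_U assms] eventually_neq_at_within[of w w UNIV]
  proof eventually_elim
    case (elim z)
    have "cinner (R z x) y - cinner (R w x) y = (w - z) * cinner (R z (R w x)) y"
      using identity[OF elim(1) assms, of x] by (metis cinner_diff_left cinner_scaleC_left)
    then show ?case using elim(2) by (simp add: field_simps)
  qed
  ultimately show ?thesis
    unfolding has_field_derivative_iff by (rule Lim_transform_eventually)
qed

lemma holomorphic: "(\<lambda>z. cinner (R z x) y) holomorphic_on U"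
  using has_field_derivative_resolvent open_U holomorphic_on_open by blast

section \<open>Contour integrals of a pseudo-resolvent: deformation, products, idempotence\<close>

context
  fixes \<gamma> K
  assumes \<gamma>: "contour \<gamma> K" "path_image \<gamma> \<subseteq> U"
begin

lemma integrable: "cintegrand R \<gamma> integrable_on {0..1}"
  by (rule contour_integrable[OF \<gamma>(1) opcont_on_subset[OF opcont \<gamma>(2)]])

lemma cinner_cintegral':
  "contour_integral \<gamma> (\<lambda>z. cinner (R z x) y) = (2 * complex_of_real pi * \<i>) * cinner (cintegral R \<gamma> x) y"
  by (subst cinner_cintegral[OF integrable]) (use \<gamma>(2) bounded_clinear in auto)

end

lemma cintegral_deform:
  assumes "contour \<gamma> K" "path_image \<gamma> \<subseteq> U" "contour \<eta> L" "path_image \<eta> \<subseteq> U" "homotopic_loops U \<gamma> \<eta>"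
  shows "cintegral R \<gamma> x = cintegral R \<eta> x"
proof (rule cinner_ext)
  fix y
  have "contour_integral \<gamma> (\<lambda>z. cinner (R z x) y) = contour_integral \<eta> (\<lambda>z. cinner (R z x) y)"
    by (rule Cauchy_theorem_homotopic_loops[OF assms(5) open_U holomorphic contourD(1)[OF assms(1)] contourD(1)[OF assms(3)]])
  then show "cinner (cintegral R \<gamma> x) y = cinner (cintegral R \<eta> x) y"
    by (simp add: cinner_cintegral'[OF assms(1,2)] cinner_cintegral'[OF assms(3,4)])
qed

text \<open>By the resolvent identity, \<open>R w (R z x)\<close> is
  \<open>(R w x - R z x) / (z - w)\<close>. In each of the two resulting iterated integrals, one
  integration meets only the scalar kernel and produces a winding number. The kernel is continuous
  because the paths do not meet.\<close>

lemma cintegral_product: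
  assumes \<gamma>: "contour \<gamma> K" "path_image \<gamma> \<subseteq> U" and \<eta>: "contour \<eta> L" "path_image \<eta> \<subseteq> U"
    and disj: "path_image \<gamma> \<inter> path_image \<eta> = {}"
    and m: "\<And>z. z \<in> path_image \<gamma> \<Longrightarrow> winding_number \<eta> z = m"
    and n: "\<And>w. w \<in> path_image \<eta> \<Longrightarrow> winding_number \<gamma> w = n"
  shows "cintegral R \<eta> (cintegral R \<gamma> x) = m *\<^sub>C cintegral R \<gamma> x + n *\<^sub>C cintegral R \<eta> x"
proof (rule cinner_ext)
  fix y
  define c where "c = 2 * complex_of_real pi * \<i>"
  have c: "c \<noteq> 0" by (simp add: c_def)
  define f where "f = (\<lambda>z. cinner (R z x) y)"
  have f: "continuous_on U f" unfolding f_def by (rule holomorphic_on_imp_continuous_on[OF holomorphic])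
  obtain ps qs where ps: "smooth_pieces \<gamma> ps" and qs: "smooth_pieces \<eta> qs"
    using contourD(9)[OF \<gamma>(1)] contourD(9)[OF \<eta>(1)] by blast
  have int: "g contour_integrable_on \<gamma>" if "continuous_on (path_image \<gamma>) g" for g
    using ps that by (simp add: smooth_pieces_def)
  have int': "g contour_integrable_on \<eta>" if "continuous_on (path_image \<eta>) g" for g
    using qs that by (simp add: smooth_pieces_def)
  have wn: "contour_integral \<gamma> (\<lambda>z. 1 / (z - w)) = c * n" if "w \<in> path_image \<eta>" for w
  proof -
    have "w \<notin> path_image \<gamma>" using that disj by blast
    then show ?thesis
      using winding_number_valid_path[OF contourD(1)[OF \<gamma>(1)], of w] n[OF that] c by (simp add: c_def)
  qed
  have wm: "contour_integral \<eta> (\<lambda>w. 1 / (w - z)) = c * m" if "z \<in> path_image \<gamma>" for z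
  proof -
    have "z \<notin> path_image \<eta>" using that disj by blast
    then show ?thesis
      using winding_number_valid_path[OF contourD(1)[OF \<eta>(1)], of z] m[OF that] c by (simp add: c_def)
  qed
  have f\<gamma>: "continuous_on (path_image \<gamma>) f" and f\<eta>: "continuous_on (path_image \<eta>) f"
    using f \<gamma>(2) \<eta>(2) continuous_on_subset by blast+
  have kernel: "continuous_on (path_image \<gamma> \<times> path_image \<eta>) (\<lambda>(z, w). f z / (z - w))"
    unfolding case_prod_unfold
    by (intro continuous_intros continuous_on_compose2[OF f\<gamma>]) (use disj in auto)
  \<comment> \<open>The integration over \<gamma> at a fixed point \<open>w\<close> of \<eta>: the
    part with \<open>f w\<close> already yields the winding number, the other part has to wait for
    the exchange of integrals.\<close>
  have inner: "c * cinner (R w (cintegral R \<gamma> x)) y = f w * (c * n) - contour_integral \<gamma> (\<lambda>z. f z / (z - w))"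
    if w: "w \<in> path_image \<eta>" for w
  proof -
    have wU: "w \<in> U" using w \<eta>(2) by blast
    have "((\<lambda>z. cinner (R w (R z x)) y) has_contour_integral c * cinner (R w (cintegral R \<gamma> x)) y) \<gamma>"
      unfolding c_def
      by (rule has_contour_integral_cintegral[OF integrable[OF \<gamma>]]) (use \<gamma> bounded_clinear wU in auto)
    then have "c * cinner (R w (cintegral R \<gamma> x)) y = contour_integral \<gamma> (\<lambda>z. cinner (R w (R z x)) y)"
      by (simp add: contour_integral_unique)
    also have "\<dots> = contour_integral \<gamma> (\<lambda>z. f w * (1 / (z - w)) - f z / (z - w))"
    proof (rule contour_integral_cong[OF refl])
      fix z assume z: "z \<in> path_image \<gamma>"
      have "f w - f z = (z - w) * cinner (R w (R z x)) y"
        unfolding f_def using identity[OF wU, of z x] z \<gamma>(2) by (metis cinner_diff_left cinner_scaleC_left subsetD)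
      moreover have "z \<noteq> w" using z w disj by blast
      ultimately show "cinner (R w (R z x)) y = f w * (1 / (z - w)) - f z / (z - w)"
        by (simp add: diff_divide_distrib[symmetric])
    qed
    also have "\<dots> = f w * contour_integral \<gamma> (\<lambda>z. 1 / (z - w)) - contour_integral \<gamma> (\<lambda>z. f z / (z - w))"
    proof -
      have ker: "continuous_on (path_image \<gamma>) (\<lambda>z. 1 / (z - w))" "continuous_on (path_image \<gamma>) (\<lambda>z. f z / (z - w))"
        by (intro continuous_intros f\<gamma>; use w disj in auto)+
      from ker(1) have "continuous_on (path_image \<gamma>) (\<lambda>z. f w * (1 / (z - w)))" by (rule continuous_on_mult_left)
      then show ?thesis
        using contour_integral_diff[OF int int, of "\<lambda>z. f w * (1 / (z - w))" "\<lambda>z. f z / (z - w)"]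
          contour_integral_lmul[OF int, of "\<lambda>z. 1 / (z - w)" "f w"] ker by simp
    qed
    finally show ?thesis using wn[OF w] by simp
  qed
  have "c * (c * cinner (cintegral R \<eta> (cintegral R \<gamma> x)) y) = c * contour_integral \<eta> (\<lambda>w. cinner (R w (cintegral R \<gamma> x)) y)"
    by (simp add: cinner_cintegral'[OF \<eta>] c_def)
  also have "\<dots> = contour_integral \<eta> (\<lambda>w. c * cinner (R w (cintegral R \<gamma> x)) y)"
    by (rule contour_integral_lmul[symmetric], rule int')
       (intro continuous_on_cinner continuous_on_const opcont_on_apply opcont_on_subset[OF opcont] \<eta>)
  also have "\<dots> = contour_integral \<eta> (\<lambda>w. f w * (c * n) - contour_integral \<gamma> (\<lambda>z. f z / (z - w)))"
    by (rule contour_integral_cong[OF refl inner])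
  also have "\<dots> = contour_integral \<eta> f * (c * n) - contour_integral \<eta> (\<lambda>w. contour_integral \<gamma> (\<lambda>z. f z / (z - w)))"
  proof (subst contour_integral_diff)
    show "(\<lambda>w. f w * (c * n)) contour_integrable_on \<eta>" by (intro int' continuous_intros f\<eta>)
    \<comment> \<open>Continuity of the remaining integral in \<open>w\<close> is obtained by
      solving \<open>inner\<close> for it.\<close>
    have "continuous_on (path_image \<eta>) (\<lambda>w. f w * (c * n) - c * cinner (R w (cintegral R \<gamma> x)) y)"
      by (intro continuous_intros f\<eta> continuous_on_cinner opcont_on_apply opcont_on_subset[OF opcont] \<eta>)
    then have "continuous_on (path_image \<eta>) (\<lambda>w. contour_integral \<gamma> (\<lambda>z. f z / (z - w)))"
      by (rule continuous_on_eq) (simp add: inner)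
    then show "(\<lambda>w. contour_integral \<gamma> (\<lambda>z. f z / (z - w))) contour_integrable_on \<eta>" by (rule int')
  qed (simp add: contour_integral_rmul int' f\<eta>)
  \<comment> \<open>After the exchange the inner integration runs over \<open>w\<close>, while the
    kernel is \<open>1 / (z - w)\<close> and not \<open>1 / (w - z)\<close>; hence the minus sign in
    front of \<open>c * m\<close>.\<close>
  also have "contour_integral \<eta> (\<lambda>w. contour_integral \<gamma> (\<lambda>z. f z / (z - w)))
      = contour_integral \<gamma> (\<lambda>z. contour_integral \<eta> (\<lambda>w. f z / (z - w)))"
    by (rule contour_integral_swap_pieces[OF ps qs kernel, symmetric])
  also have "\<dots> = contour_integral \<gamma> (\<lambda>z. f z * - (c * m))"
  proof (rule contour_integral_cong[OF refl])
    fix z assume z: "z \<in> path_image \<gamma>"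
    have "contour_integral \<eta> (\<lambda>w. f z / (z - w)) = contour_integral \<eta> (\<lambda>w. - f z * (1 / (w - z)))"
      by (rule contour_integral_cong[OF refl]) (metis (no_types) minus_diff_eq minus_divide_divide mult_minus_left times_divide_eq_right mult.right_neutral minus_divide_right minus_divide_left)
    also have "\<dots> = - f z * contour_integral \<eta> (\<lambda>w. 1 / (w - z))"
      by (rule contour_integral_lmul, intro int' continuous_intros) (use z disj in auto)
    finally show "contour_integral \<eta> (\<lambda>w. f z / (z - w)) = f z * - (c * m)" by (simp add: wm[OF z])
  qed
  also have "\<dots> = contour_integral \<gamma> f * - (c * m)"
    by (rule contour_integral_rmul[OF int[OF f\<gamma>]])
  finally have "c * (c * cinner (cintegral R \<eta> (cintegral R \<gamma> x)) y) =
      c * (c * (m * cinner (cintegral R \<gamma> x) y + n * cinner (cintegral R \<eta> x) y))"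
    unfolding f_def cinner_cintegral'[OF \<eta>] cinner_cintegral'[OF \<gamma>] c_def[symmetric] by (simp add: algebra_simps)
  then show "cinner (cintegral R \<eta> (cintegral R \<gamma> x)) y = cinner (m *\<^sub>C cintegral R \<gamma> x + n *\<^sub>C cintegral R \<eta> x) y"
    using c by (simp add: cinner_simps)
qed

text \<open>The product formula excludes a contour paired with itself, as its kernel would be
  singular. One of the factors is therefore moved to a slightly smaller contour inside; the two
  winding numbers are then 0 and 1, and one integral survives.\<close>

lemma cintegral_idem:
  assumes \<gamma>: "contour \<gamma> K" "path_image \<gamma> \<subseteq> U"
  shows "cintegral R \<gamma> (cintegral R \<gamma> x) = cintegral R \<gamma> x"
proof -
  obtain \<eta> L where \<eta>: "contour \<eta> L" "L \<subseteq> interior K" "path_image \<eta> \<subseteq> U" "homotopic_loops U \<gamma> \<eta>"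
    using contour_shrink[OF \<gamma> open_U] by blast
  have "cintegral R \<eta> (cintegral R \<gamma> x) = 0 *\<^sub>C cintegral R \<gamma> x + 1 *\<^sub>C cintegral R \<eta> x"
  proof (rule cintegral_product[OF \<gamma> \<eta>(1,3)])
    show "path_image \<gamma> \<inter> path_image \<eta> = {}"
      using contourD(3)[OF \<gamma>(1)] contourD(3)[OF \<eta>(1)] \<eta>(2) by blast
    show "winding_number \<eta> z = 0" if "z \<in> path_image \<gamma>" for z
      using that contourD(3)[OF \<gamma>(1)] \<eta>(2) by (intro contourD(8)[OF \<eta>(1)]) blast
    show "winding_number \<gamma> w = 1" if "w \<in> path_image \<eta>" for w
      using that contourD(3)[OF \<eta>(1)] \<eta>(2) by (intro contourD(7)[OF \<gamma>(1)]) blast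
  qed
  then show ?thesis using cintegral_deform[OF \<gamma> \<eta>(1,3,4)] by simp
qed

text \<open>Once both contours are shrunk, each lies outside the other and both winding numbers in
  the product formula vanish.\<close>

lemma cintegral_disjoint:
  assumes \<gamma>: "contour \<gamma> K" "path_image \<gamma> \<subseteq> U" and \<eta>: "contour \<eta> L" "path_image \<eta> \<subseteq> U"
    and disj: "interior K \<inter> interior L = {}"
  shows "cintegral R \<eta> (cintegral R \<gamma> x) = 0"
proof -
  obtain \<gamma>' K' where \<gamma>': "contour \<gamma>' K'" "K' \<subseteq> interior K" "path_image \<gamma>' \<subseteq> U" "homotopic_loops U \<gamma> \<gamma>'"
    using contour_shrink[OF \<gamma> open_U] by blast
  obtain \<eta>' L' where \<eta>': "contour \<eta>' L'" "L' \<subseteq> interior L" "path_image \<eta>' \<subseteq> U" "homotopic_loops U \<eta> \<eta>'"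
    using contour_shrink[OF \<eta> open_U] by blast
  have sub: "path_image \<gamma>' \<subseteq> K'" "path_image \<eta>' \<subseteq> L'" "K' \<inter> L' = {}"
    using contourD(3)[OF \<gamma>'(1)] contourD(3)[OF \<eta>'(1)] disj \<gamma>'(2) \<eta>'(2) by blast+
  have "cintegral R \<eta>' (cintegral R \<gamma>' x) = 0 *\<^sub>C cintegral R \<gamma>' x + 0 *\<^sub>C cintegral R \<eta>' x"
    by (rule cintegral_product[OF \<gamma>'(1,3) \<eta>'(1,3)])
       (use sub in \<open>auto intro!: contourD(8)[OF \<eta>'(1)] contourD(8)[OF \<gamma>'(1)]\<close>)
  then show ?thesis
    by (simp add: cintegral_deform[OF \<gamma> \<gamma>'(1,3,4)] cintegral_deform[OF \<eta> \<eta>'(1,3,4)])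
qed

text \<open>Boundedness is built into the operator-valued integral. That integral lives in a real
  Banach space, so complex homogeneity is checked through the scalar integrals.\<close>

lemma bounded_clinear_cintegral:
  assumes \<gamma>: "contour \<gamma> K" "path_image \<gamma> \<subseteq> U"
  shows "bounded_clinear (cintegral R \<gamma>)"
proof -
  have "cintegral R \<gamma> (c *\<^sub>C x) = c *\<^sub>C cintegral R \<gamma> x" for c x
  proof (rule cinner_ext)
    fix y
    obtain ps where ps: "smooth_pieces \<gamma> ps" using contourD(9)[OF \<gamma>(1)] by blast
    have "contour_integral \<gamma> (\<lambda>z. cinner (R z (c *\<^sub>C x)) y) = contour_integral \<gamma> (\<lambda>z. c * cinner (R z x) y)"
      using \<gamma>(2) by (intro contour_integral_cong) (auto simp: bounded_clinearD(3)[OF bounded_clinear] cinner_scaleC_left)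
    also have "\<dots> = c * contour_integral \<gamma> (\<lambda>z. cinner (R z x) y)"
    proof (rule contour_integral_lmul)
      have "continuous_on (path_image \<gamma>) (\<lambda>z. cinner (R z x) y)"
        by (intro continuous_on_cinner continuous_on_const opcont_on_apply opcont_on_subset[OF opcont] \<gamma>)
      then show "(\<lambda>z. cinner (R z x) y) contour_integrable_on \<gamma>" using ps by (simp add: smooth_pieces_def)
    qed
    finally show "cinner (cintegral R \<gamma> (c *\<^sub>C x)) y = cinner (c *\<^sub>C cintegral R \<gamma> x) y"
      by (simp add: cinner_cintegral'[OF \<gamma>] cinner_scaleC_left)
  qed
  moreover have "bounded_linear (cintegral R \<gamma>)"
    unfolding cintegral_def by (intro bounded_linear_compose[OF bounded_linear_scaleC] blinfun.bounded_linear_right)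
  ultimately show ?thesis by (simp add: bounded_clinear_def)
qed

end

text \<open>\<open>L\<close> is chosen before the families and the vector, so it depends on the
  contour alone, whereas \<open>k\<close> may depend on \<open>x\<close>. The factor
  \<open>1 / (2 * pi)\<close> is simply bounded by 1.\<close>

lemma cintegral_Lipschitz:
  assumes \<gamma>: "contour \<gamma> K"
  shows "\<exists>L\<ge>0. \<forall>(R :: complex \<Rightarrow> 'a::chilbert_space \<Rightarrow> 'a) R' k x.
    opcont_on (path_image \<gamma>) R \<longrightarrow> opcont_on (path_image \<gamma>) R' \<longrightarrow> 0 \<le> k \<longrightarrow>
    (\<forall>z\<in>path_image \<gamma>. norm (R z x - R' z x) \<le> k) \<longrightarrow> norm (cintegral R \<gamma> x - cintegral R' \<gamma> x) \<le> L * k"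
proof -
  obtain ps where ps: "smooth_pieces \<gamma> ps" using contourD(9)[OF \<gamma>] by blast
  obtain L where L: "0 \<le> L" "\<And>f k. \<lbrakk>continuous_on (path_image \<gamma>) f; \<And>z. z \<in> path_image \<gamma> \<Longrightarrow> cmod (f z) \<le> k; 0 \<le> k\<rbrakk>
       \<Longrightarrow> cmod (contour_integral \<gamma> f) \<le> L * k"
    using smooth_pieces_bound[OF ps] by metis
  have "norm (cintegral R \<gamma> x - cintegral R' \<gamma> x) \<le> L * k"
    if R: "opcont_on (path_image \<gamma>) R" and R': "opcont_on (path_image \<gamma>) R'" and k: "0 \<le> k"
      and close: "\<And>z. z \<in> path_image \<gamma> \<Longrightarrow> norm (R z x - R' z x) \<le> k" for R R' :: "complex \<Rightarrow> 'a \<Rightarrow> 'a" and k x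
  proof (rule norm_le_by_cinner)
    show "0 \<le> L * k" using L k by simp
    fix y
    have cont: "continuous_on (path_image \<gamma>) (\<lambda>z. cinner (R z x) y)" "continuous_on (path_image \<gamma>) (\<lambda>z. cinner (R' z x) y)"
      by (intro continuous_on_cinner continuous_on_const opcont_on_apply R R')+
    have "cinner (cintegral R \<gamma> x - cintegral R' \<gamma> x) y =
        (contour_integral \<gamma> (\<lambda>z. cinner (R z x) y) - contour_integral \<gamma> (\<lambda>z. cinner (R' z x) y)) / (2 * complex_of_real pi * \<i>)"
      using cinner_cintegral[OF contour_integrable[OF \<gamma> R] opcont_onD(1)[OF R]] cinner_cintegral[OF contour_integrable[OF \<gamma> R'] opcont_onD(1)[OF R']]
      by (simp add: cinner_diff_left diff_divide_distrib)
    also have "contour_integral \<gamma> (\<lambda>z. cinner (R z x) y) - contour_integral \<gamma> (\<lambda>z. cinner (R' z x) y) =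
        contour_integral \<gamma> (\<lambda>z. cinner (R z x - R' z x) y)"
      using ps cont by (simp add: smooth_pieces_def contour_integral_diff cinner_diff_left)
    finally have "cmod (cinner (cintegral R \<gamma> x - cintegral R' \<gamma> x) y) =
        cmod (contour_integral \<gamma> (\<lambda>z. cinner (R z x - R' z x) y)) / (2 * pi)"
      by (simp add: norm_divide norm_mult)
    also have "\<dots> \<le> cmod (contour_integral \<gamma> (\<lambda>z. cinner (R z x - R' z x) y)) / 1"
      using pi_ge_two by (intro divide_left_mono) auto
    also have "\<dots> \<le> L * (k * norm y)"
    proof -
      have "cmod (cinner (R z x - R' z x) y) \<le> k * norm y" if "z \<in> path_image \<gamma>" for z
        using Cauchy_Schwarz_cinner[of "R z x - R' z x" y] mult_right_mono[OF close[OF that] norm_ge_zero[of y]] by linarith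
      moreover have "continuous_on (path_image \<gamma>) (\<lambda>z. cinner (R z x - R' z x) y)"
        using continuous_on_diff[OF cont] by (simp add: cinner_diff_left)
      ultimately show ?thesis using L(2)[of "\<lambda>z. cinner (R z x - R' z x) y" "k * norm y"] k by simp
    qed
    finally show "cmod (cinner (cintegral R \<gamma> x - cintegral R' \<gamma> x) y) \<le> L * k * norm y" by (simp add: mult.assoc)
  qed
  then show ?thesis using L(1) by blast
qed

context pseudo_resolvent
begin

section \<open>Powers of a pseudo-resolvent as derivatives\<close>

lemma continuous_on_power: "continuous_on U (\<lambda>z. (R z ^^ n) x)"
proof (induction n)
  case (Suc n)
  have "continuous_on U (\<lambda>z. blinfun_apply (Blinfun (R z)) ((R z ^^ n) x))"
    by (intro bounded_bilinear.continuous_on[OF bounded_bilinear_blinfun_apply] opcont_onD(2)[OF opcont] Suc)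
  then show ?case
    by (rule continuous_on_eq) (simp add: opcont_onD(3)[OF opcont])
qed simp

text \<open>By the identity, \<open>(R z ^^ Suc n) x\<close> is \<open>(R z ^^ n) (R w x)\<close>
  plus \<open>w - z\<close> times \<open>(R z ^^ Suc n) (R w x)\<close>. The first term is covered
  by induction with \<open>R w x\<close> for \<open>x\<close>; in the second a factor vanishes at
  \<open>w\<close>, so continuity of the power suffices to differentiate it there.\<close>

lemma has_field_derivative_power:
  assumes w: "w \<in> U"
  shows "((\<lambda>z. cinner ((R z ^^ n) x) y) has_field_derivative - of_nat n * cinner ((R w ^^ Suc n) x) y) (at w)"
proof (induction n arbitrary: x)
  case (Suc n)
  define h where "h = (\<lambda>z. cinner ((R z ^^ Suc n) (R w x)) y)"
  have "continuous_on U h"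
    unfolding h_def by (intro continuous_on_cinner continuous_on_power continuous_on_const)
  then have "(h \<longlongrightarrow> h w) (at w)"
    using w open_U by (simp add: continuous_on_eq_continuous_at continuous_at)
  then have "((\<lambda>z. - h z) \<longlongrightarrow> - h w) (at w)" by (rule tendsto_minus)
  moreover have "\<forall>\<^sub>F z in at w. - h z = ((w - z) * h z - (w - w) * h w) / (z - w)"
    using eventually_neq_at_within[of w w UNIV] by eventually_elim (simp add: field_simps)
  ultimately have h': "((\<lambda>z. (w - z) * h z) has_field_derivative - h w) (at w)"
    unfolding has_field_derivative_iff by (rule Lim_transform_eventually)
  have "((\<lambda>z. cinner ((R z ^^ n) (R w x)) y + (w - z) * h z) has_field_derivative
      - of_nat n * cinner ((R w ^^ Suc n) (R w x)) y + - h w) (at w)"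
    by (intro DERIV_add Suc.IH h')
  then have "((\<lambda>z. cinner ((R z ^^ Suc n) x) y) has_field_derivative
      - of_nat n * cinner ((R w ^^ Suc n) (R w x)) y + - h w) (at w)"
  proof (rule has_field_derivative_transform_within_open[OF _ open_U w])
    fix z assume z: "z \<in> U"
    interpret additive "R z ^^ n"
    proof
      show "(R z ^^ n) (u + v) = (R z ^^ n) u + (R z ^^ n) v" for u v
        by (induction n) (auto simp: bounded_clinearD(2)[OF bounded_clinear[OF z]])
    qed
    have scale: "(R z ^^ n) (c *\<^sub>C u) = c *\<^sub>C (R z ^^ n) u" for c u
      by (induction n) (auto simp: bounded_clinearD(3)[OF bounded_clinear[OF z]])
    have "R z x = R w x + (w - z) *\<^sub>C R z (R w x)"
      using identity[OF z w, of x] by (simp add: algebra_simps)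
    then have "(R z ^^ Suc n) x = (R z ^^ n) (R w x) + (w - z) *\<^sub>C (R z ^^ Suc n) (R w x)"
      by (simp only: funpow_Suc_right o_def add scale)
    then show "cinner ((R z ^^ n) (R w x)) y + (w - z) * h z = cinner ((R z ^^ Suc n) x) y"
      by (simp only: h_def cinner_add_left cinner_scaleC_left)
  qed
  moreover have "(R w ^^ Suc n) (R w x) = (R w ^^ Suc (Suc n)) x"
    by (simp only: funpow_Suc_right o_def)
  ultimately show ?case by (simp only: h_def of_nat_Suc) (simp add: algebra_simps)
qed simp

lemma higher_deriv_resolvent:
  assumes "w \<in> U"
  shows "(deriv ^^ n) (\<lambda>z. cinner (R z x) y) w = (- 1) ^ n * fact n * cinner ((R w ^^ Suc n) x) y"
  using assms
proof (induction n arbitrary: w)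
  case (Suc n)
  have "((\<lambda>z. (- 1) ^ n * fact n * cinner ((R z ^^ Suc n) x) y) has_field_derivative
      (- 1) ^ n * fact n * (- of_nat (Suc n) * cinner ((R w ^^ Suc (Suc n)) x) y)) (at w)"
    by (intro DERIV_cmult has_field_derivative_power Suc.prems)
  then have "((deriv ^^ n) (\<lambda>z. cinner (R z x) y) has_field_derivative
      (- 1) ^ n * fact n * (- of_nat (Suc n) * cinner ((R w ^^ Suc (Suc n)) x) y)) (at w)"
    by (rule has_field_derivative_transform_within_open[OF _ open_U Suc.prems]) (simp only: Suc.IH)
  then show ?case
    by (simp only: funpow.simps o_def DERIV_imp_deriv) (simp add: algebra_simps)
qed simp

end

text \<open>Log-convexity of \<open>n \<mapsto> \<parallel>N\<^sup>n x\<parallel>\<close> for symmetric \<open>N\<close>.\<close>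

lemma symmetric_power_lower_bound:
  fixes N :: "'a::complex_inner \<Rightarrow> 'a"
  assumes sym: "\<And>x y. cinner (N x) y = cinner x (N y)" and q: "0 < q" "q * norm x \<le> norm (N x)" and x: "x \<noteq> 0"
  shows "norm x * q ^ n \<le> norm ((N ^^ n) x)"
proof -
  define u where "u n = norm ((N ^^ n) x)" for n
  have conv: "(u (Suc n))\<^sup>2 \<le> u n * u (Suc (Suc n))" for n
  proof -
    have "cinner ((N ^^ Suc n) x) ((N ^^ Suc n) x) = cinner ((N ^^ n) x) ((N ^^ Suc (Suc n)) x)"
      using sym by simp
    then have "cmod (cinner ((N ^^ Suc n) x) ((N ^^ Suc n) x)) \<le> u n * u (Suc (Suc n))"
      unfolding u_def by (metis Cauchy_Schwarz_cinner)
    then show ?thesis unfolding cinner_self u_def by (simp add: norm_power)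
  qed
  \<comment> \<open>The ratios of consecutive terms increase, so the first one bounds all of them
    from below. Positivity is carried along because each step cancels \<open>u n\<close>.\<close>
  have "0 < u n \<and> q * u n \<le> u (Suc n)" for n
  proof (induction n)
    case 0
    show ?case using x q by (simp add: u_def)
  next
    case (Suc n)
    then have pos: "0 < u (Suc n)" using q(1) by (meson less_le_trans mult_pos_pos)
    have "(q * u (Suc n)) * u n \<le> u (Suc n) * u (Suc n)"
      using mult_left_mono[of "q * u n" "u (Suc n)" "u (Suc n)"] Suc pos by (simp add: mult_ac)
    also have "\<dots> \<le> u (Suc (Suc n)) * u n"
      using conv[of n] by (simp add: power2_eq_square mult.commute)
    finally have "q * u (Suc n) \<le> u (Suc (Suc n))" using Suc by simp
    with pos show ?case by simp
  qed
  then have step: "q * u n \<le> u (Suc n)" for n by blast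
  have "norm x * q ^ n \<le> u n"
  proof (induction n)
    case (Suc n)
    have "norm x * q ^ Suc n = q * (norm x * q ^ n)" by simp
    also have "\<dots> \<le> q * u n" using Suc q(1) by simp
    also have "\<dots> \<le> u (Suc n)" by (rule step)
    finally show ?case .
  qed (simp add: u_def)
  then show ?thesis by (simp add: u_def)
qed

text \<open>The Cauchy estimates for the Taylor coefficients \<open>\<langle>R(w)\<^sup>n\<^sup>+\<^sup>1 x, x\<rangle>\<close> are played off against the previous lemma.\<close>

lemma (in pseudo_resolvent) symmetric_resolvent_bound:
  assumes w: "w \<in> U" and sym: "\<And>x y. cinner (R w x) y = cinner x (R w y)"
    and G: "G holomorphic_on ball w \<rho>" and V: "open V" "w \<in> V" "V \<subseteq> U" "V \<subseteq> ball w \<rho>"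
    and eq: "\<And>z. z \<in> V \<Longrightarrow> G z = cinner (R z x) x"
  shows "\<rho> * norm (R w x) \<le> norm x"
proof (cases "x = 0")
  case True
  then show ?thesis using bounded_clinearD(4)[OF bounded_clinear[OF w]] by simp
next
  case False
  have "\<rho> > 0" using V(2,4) by (metis ball_eq_empty empty_iff not_le subsetD)
  have bound: "r * norm (R w x) \<le> norm x" if r: "0 < r" "r < \<rho>" for r
  proof (rule ccontr)
    assume neg: "\<not> ?thesis"
    \<comment> \<open>If the bound failed for \<open>r\<close>, then \<open>r * q\<close> would
      exceed 1 and the powers of \<open>R w\<close> would outgrow the Cauchy estimates on the disc
      of radius \<open>r\<close>.\<close>
    define q where "q = norm (R w x) / norm x"
    have q: "0 < q" "q * norm x \<le> norm (R w x)" "1 < r * q"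
    proof -
      have "norm x < r * norm (R w x)" using neg by simp
      then have "norm (R w x) > 0" by (cases "norm (R w x) = 0") auto
      then show "0 < q" using False by (simp add: q_def)
      show "q * norm x \<le> norm (R w x)" "1 < r * q" using False \<open>norm x < r * norm (R w x)\<close> by (simp_all add: q_def field_simps)
    qed
    have cont: "continuous_on (cball w r) G"
      by (rule continuous_on_subset[OF holomorphic_on_imp_continuous_on[OF G]]) (use r in auto)
    have "bounded (G ` cball w r)"
      by (intro compact_imp_bounded compact_continuous_image cont compact_cball)
    then obtain B where "\<forall>y\<in>G ` cball w r. norm y \<le> B" unfolding bounded_iff by blast
    then have B: "\<And>z. z \<in> cball w r \<Longrightarrow> norm (G z) \<le> B" by blast
    have coeff: "norm (cinner ((R w ^^ Suc n) x) x) \<le> B / r ^ n" for n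
    proof -
      have "norm ((deriv ^^ n) G w) \<le> fact n * B / r ^ n"
        by (rule Cauchy_inequality[OF holomorphic_on_subset[OF G] cont r(1)]) (use r B in \<open>auto simp: dist_norm\<close>)
      also have "(deriv ^^ n) G w = (deriv ^^ n) (\<lambda>z. cinner (R z x) x) w"
        by (rule higher_deriv_transform_within_open[OF holomorphic_on_subset[OF G V(4)] holomorphic_on_subset[OF holomorphic V(3)] V(1,2)])
           (rule eq)
      also have "\<dots> = (- 1) ^ n * fact n * cinner ((R w ^^ Suc n) x) x"
        by (rule higher_deriv_resolvent[OF w])
      finally have "fact n * norm (cinner ((R w ^^ Suc n) x) x) \<le> fact n * (B / r ^ n)"
        by (simp add: norm_mult norm_power)
      then show ?thesis by (rule mult_left_le_imp_le) (rule fact_gt_zero)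
    qed
    have sym_pow: "cinner ((R w ^^ m) u) v = cinner u ((R w ^^ m) v)" for m u v
      by (induction m arbitrary: u) (simp_all add: sym funpow_swap1)
    have "(norm x)\<^sup>2 * (r * q) ^ (2 * Suc m) \<le> B * r" for m
    proof -
      \<comment> \<open>By symmetry the squared norm of a power is an inner product with an even
        power of \<open>R w\<close>; the exponent \<open>2 * m + 2\<close> belongs to the Taylor
        coefficient of index \<open>2 * m + 1\<close>.\<close>
      have "(norm x * q ^ Suc m)\<^sup>2 \<le> (norm ((R w ^^ Suc m) x))\<^sup>2"
        by (intro power_mono symmetric_power_lower_bound sym q False) (use q in auto)
      also have "\<dots> = norm (cinner ((R w ^^ Suc m) x) ((R w ^^ Suc m) x))"
        by (simp only: cinner_self) (simp add: norm_power)
      also have "\<dots> = norm (cinner ((R w ^^ (Suc m + Suc m)) x) x)"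
        by (simp only: sym_pow[of "Suc m" "(R w ^^ Suc m) x" x, symmetric] funpow_add o_def)
      also have "\<dots> \<le> B / r ^ (2 * m + 1)"
        using coeff[of "2 * m + 1"] by (simp add: mult_2)
      finally have "(norm x * q ^ Suc m)\<^sup>2 * r ^ (2 * m + 1) \<le> B"
        using r by (simp add: pos_le_divide_eq)
      then have "(norm x * q ^ Suc m)\<^sup>2 * r ^ (2 * m + 1) * r \<le> B * r" using r by (intro mult_right_mono) auto
      moreover have "(norm x * q ^ Suc m)\<^sup>2 * r ^ (2 * m + 1) * r = (norm x)\<^sup>2 * (r * q) ^ (2 * Suc m)"
        by (simp only: power_mult_distrib power_mult[symmetric] mult_2 power_add power_Suc power_one_right power2_eq_square)
           (simp add: mult_ac power_add)
      ultimately show ?thesis by (simp only:)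
    qed
    then have B: "(norm x)\<^sup>2 * (r * q) ^ (2 * Suc m) \<le> B * r" for m .
    obtain m where "B * r / (norm x)\<^sup>2 < (r * q) ^ m" using real_arch_pow q(3) by blast
    also have "\<dots> \<le> (r * q) ^ (2 * Suc m)" using q(3) by (intro power_increasing) auto
    finally have "B * r / (norm x)\<^sup>2 < (r * q) ^ (2 * Suc m)" .
    moreover have "0 < (norm x)\<^sup>2" using False by simp
    ultimately have "B * r < (r * q) ^ (2 * Suc m) * (norm x)\<^sup>2" by (metis pos_divide_less_eq)
    with B[of m] show False by (metis mult.commute not_le)
  qed
  show ?thesis
  proof (rule ccontr)
    assume n: "\<not> ?thesis"
    then have pos: "norm (R w x) > 0" by (metis mult_zero_right norm_ge_zero zero_less_norm_iff norm_zero)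
    then have "norm x / norm (R w x) < \<rho>" using n by (simp add: field_simps)
    then obtain r where "norm x / norm (R w x) < r" "r < \<rho>" using dense by blast
    moreover have "0 < norm x / norm (R w x)" using pos False by simp
    ultimately show False using bound[of r] pos by (simp add: field_simps)
  qed
qed

section \<open>Resolvents of unbounded operators\<close>

lemma linear_operatorD:
  assumes "linear_operator T"
  shows "csubspace (Dom T)" "f \<in> Dom T \<Longrightarrow> g \<in> Dom T \<Longrightarrow> T \<cdot> (f + g) = T \<cdot> f + T \<cdot> g"
    "f \<in> Dom T \<Longrightarrow> T \<cdot> (c *\<^sub>C f) = c *\<^sub>C (T \<cdot> f)" "T \<cdot> 0 = 0"
    "f \<in> Dom T \<Longrightarrow> g \<in> Dom T \<Longrightarrow> T \<cdot> (f - g) = T \<cdot> f - T \<cdot> g"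
proof -
  show 1: "csubspace (Dom T)" "f \<in> Dom T \<Longrightarrow> g \<in> Dom T \<Longrightarrow> T \<cdot> (f + g) = T \<cdot> f + T \<cdot> g"
    "\<And>f c. f \<in> Dom T \<Longrightarrow> T \<cdot> (c *\<^sub>C f) = c *\<^sub>C (T \<cdot> f)" for f g
    using assms by (auto simp: linear_operator_def)
  show "T \<cdot> 0 = 0" using 1(3)[OF csubspaceD(1)[OF 1(1)], of 0] by simp
  show "T \<cdot> (f - g) = T \<cdot> f - T \<cdot> g" if "f \<in> Dom T" "g \<in> Dom T"
    using 1(2)[OF that(1) csubspaceD(5)[OF 1(1) that(2)]] 1(3)[OF that(2), of "-1"] by (simp add: scaleC_minus_one)
qed

lemma resolvent:
  assumes "z \<in> resolvent_set T"
  shows resolvent_in_Dom: "resolvent T z x \<in> Dom T"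
    and resolvent_right: "z *\<^sub>C resolvent T z x - T \<cdot> resolvent T z x = x"
    and resolvent_left: "f \<in> Dom T \<Longrightarrow> resolvent T z (z *\<^sub>C f - T \<cdot> f) = f"
proof -
  have bij: "bij_betw (\<lambda>f. z *\<^sub>C f - T \<cdot> f) (Dom T) UNIV" using assms by (simp add: resolvent_set_def)
  show "resolvent T z x \<in> Dom T"
    unfolding resolvent_def using bij by (intro inv_into_into) (auto simp: bij_betw_def)
  show "z *\<^sub>C resolvent T z x - T \<cdot> resolvent T z x = x"
    unfolding resolvent_def using bij by (intro f_inv_into_f[of _ "\<lambda>f. z *\<^sub>C f - T \<cdot> f"]) (auto simp: bij_betw_def)
  show "resolvent T z (z *\<^sub>C f - T \<cdot> f) = f" if "f \<in> Dom T"
    unfolding resolvent_def using bij that by (intro inv_into_f_f[of "\<lambda>f. z *\<^sub>C f - T \<cdot> f"]) (auto simp: bij_betw_def)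
qed

lemma bounded_clinear_resolvent:
  assumes T: "linear_operator T" and z: "z \<in> resolvent_set T"
  shows "bounded_clinear (resolvent T z)"
  unfolding bounded_clinear_def
proof (intro conjI allI)
  show "bounded_linear (resolvent T z)" using z by (simp add: resolvent_set_def)
  fix c x
  let ?f = "resolvent T z x"
  have f: "?f \<in> Dom T" "c *\<^sub>C ?f \<in> Dom T"
    using resolvent_in_Dom[OF z] csubspaceD(3)[OF linear_operatorD(1)[OF T]] by blast+
  have "z *\<^sub>C (c *\<^sub>C ?f) - T \<cdot> (c *\<^sub>C ?f) = c *\<^sub>C (z *\<^sub>C ?f - T \<cdot> ?f)"
    by (simp add: linear_operatorD(3)[OF T f(1)] scaleC_diff_right scaleC_scaleC mult.commute)
  then show "resolvent T z (c *\<^sub>C x) = c *\<^sub>C ?f"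
    using resolvent_left[OF z f(2)] resolvent_right[OF z, of x] by simp
qed

lemma pseudo_resolvent_resolvent:
  assumes T: "linear_operator T" and U: "open U" "U \<subseteq> resolvent_set T"
  shows "pseudo_resolvent U (resolvent T)"
proof
  show "open U" by fact
  show "bounded_clinear (resolvent T z)" if "z \<in> U" for z using that U bounded_clinear_resolvent[OF T] by blast
  fix z w x assume "z \<in> U" "w \<in> U"
  then have z: "z \<in> resolvent_set T" and w: "w \<in> resolvent_set T" using U by auto
  note bc = bounded_clinear_resolvent[OF T z]
  let ?f = "resolvent T w x"
  have "z *\<^sub>C ?f - T \<cdot> ?f = x + (z - w) *\<^sub>C ?f"
    using resolvent_right[OF w, of x] by (simp add: scaleC_diff_left algebra_simps)
  then have "?f = resolvent T z (x + (z - w) *\<^sub>C ?f)"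
    using resolvent_left[OF z resolvent_in_Dom[OF w], of x] by simp
  also have "\<dots> = resolvent T z x + (z - w) *\<^sub>C resolvent T z ?f"
    by (simp add: bounded_clinearD(2,3)[OF bc])
  finally have "resolvent T z x - ?f = - ((z - w) *\<^sub>C resolvent T z ?f)" by (simp add: algebra_simps)
  then show "resolvent T z x - ?f = (w - z) *\<^sub>C resolvent T z ?f"
    by (simp add: scaleC_minus_left[symmetric])
qed

section \<open>Self-adjoint operators with discrete spectrum\<close>

lemma self_adjointD:
  assumes "self_adjoint A"
  shows "linear_operator A" "f \<in> Dom A \<Longrightarrow> g \<in> Dom A \<Longrightarrow> cinner (A \<cdot> f) g = cinner f (A \<cdot> g)"
    "(\<And>f. f \<in> Dom A \<Longrightarrow> cinner (A \<cdot> f) g = cinner f h) \<Longrightarrow> g \<in> Dom A \<and> A \<cdot> g = h"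
proof -
  have adj: "adjoint_graph A = graph A" and "linear_operator A" using assms by (auto simp: self_adjoint_def)
  then show "linear_operator A" by simp
  show "cinner (A \<cdot> f) g = cinner f (A \<cdot> g)" if "f \<in> Dom A" "g \<in> Dom A"
  proof -
    have "(g, A \<cdot> g) \<in> adjoint_graph A" unfolding adj graph_def using that by blast
    then show ?thesis using that by (simp add: adjoint_graph_def)
  qed
  show "g \<in> Dom A \<and> A \<cdot> g = h" if "\<And>f. f \<in> Dom A \<Longrightarrow> cinner (A \<cdot> f) g = cinner f h"
  proof -
    have "(g, h) \<in> graph A" unfolding adj[symmetric] adjoint_graph_def using that by blast
    then show ?thesis by (auto simp: graph_def)
  qed
qed

lemma self_adjoint_closed:
  assumes A: "self_adjoint A" and F: "\<And>n. F n \<in> Dom A" "F \<longlonglongrightarrow> f" "(\<lambda>n. A \<cdot> F n) \<longlonglongrightarrow> g"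
  shows "f \<in> Dom A \<and> A \<cdot> f = g"
proof (rule self_adjointD(3)[OF A])
  fix h assume h: "h \<in> Dom A"
  have "(\<lambda>n. cinner (A \<cdot> h) (F n)) \<longlonglongrightarrow> cinner (A \<cdot> h) f" by (intro tendsto_cinner F tendsto_const)
  moreover have "(\<lambda>n. cinner h (A \<cdot> F n)) \<longlonglongrightarrow> cinner h g" by (intro tendsto_cinner F tendsto_const)
  moreover have "cinner (A \<cdot> h) (F n) = cinner h (A \<cdot> F n)" for n by (rule self_adjointD(2)[OF A h F(1)])
  ultimately show "cinner (A \<cdot> h) f = cinner h g" using LIMSEQ_unique by simp
qed

lemma eigenspace_closed_csubspace:
  assumes A: "self_adjoint A"
  shows "csubspace (eigenspace A z)" "closed (eigenspace A z)"
proof -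
  note lin = linear_operatorD[OF self_adjointD(1)[OF A]]
  show "csubspace (eigenspace A z)"
    by (rule csubspaceI)
       (auto simp: eigenspace_def lin(2-4) csubspaceD[OF lin(1)] scaleC_add_right scaleC_scaleC mult.commute)
  show "closed (eigenspace A z)"
    unfolding closed_sequential_limits
  proof (intro allI impI)
    fix F f assume *: "(\<forall>n. F n \<in> eigenspace A z) \<and> F \<longlonglongrightarrow> f"
    then have "(\<lambda>n. A \<cdot> F n) \<longlonglongrightarrow> z *\<^sub>C f"
      using tendsto_scaleC[OF tendsto_const, of F f sequentially z] by (simp add: eigenspace_def)
    then show "f \<in> eigenspace A z"
      using self_adjoint_closed[OF A, of F f] * by (auto simp: eigenspace_def)
  qed
qed

lemma eigenspaces_orthogonal:
  assumes A: "self_adjoint A" and e: "e \<in> eigenspace A (complex_of_real s)" and f: "f \<in> eigenspace A (complex_of_real t)" and "s \<noteq> t"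
  shows "cinner e f = 0"
proof -
  have "complex_of_real s * cinner e f = complex_of_real t * cinner e f"
    using self_adjointD(2)[OF A, of e f] e f by (simp add: eigenspace_def cinner_simps)
  then show ?thesis using \<open>s \<noteq> t\<close> by simp
qed

lemma symmetric_resolvent:
  assumes A: "self_adjoint A" and l: "complex_of_real l \<in> resolvent_set A"
  shows "cinner (resolvent A l x) y = cinner x (resolvent A l y)"
proof -
  let ?f = "resolvent A l x" and ?g = "resolvent A l y"
  have "cinner ?f y = cinner ?f (complex_of_real l *\<^sub>C ?g - A \<cdot> ?g)" by (simp add: resolvent_right[OF l])
  also have "\<dots> = cinner (complex_of_real l *\<^sub>C ?f - A \<cdot> ?f) ?g"
    by (simp add: cinner_simps self_adjointD(2)[OF A resolvent_in_Dom[OF l] resolvent_in_Dom[OF l]])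
  also have "\<dots> = cinner x ?g" by (simp add: resolvent_right[OF l])
  finally show ?thesis .
qed

text \<open>The inner product of \<open>(Re z) f - A f\<close> with \<open>f\<close> is real, so the
  cross term with the imaginary multiple of \<open>f\<close> has no real part.\<close>

lemma self_adjoint_norm_shift:
  assumes A: "self_adjoint A" and f: "f \<in> Dom A"
  shows "(norm (z *\<^sub>C f - A \<cdot> f))\<^sup>2 = (norm (complex_of_real (Re z) *\<^sub>C f - A \<cdot> f))\<^sup>2 + (Im z)\<^sup>2 * (norm f)\<^sup>2"
proof -
  let ?g = "complex_of_real (Re z) *\<^sub>C f - A \<cdot> f"
  have "cinner ?g f = cnj (cinner ?g f)"
    by (subst cinner_commute[of ?g f]) (simp add: cinner_simps self_adjointD(2)[OF A f f])
  then have im: "Im (cinner ?g f) = 0" by (metis complex_cnj complex.sel(2) equation_minus_iff neg_equal_zero complex_is_Real_iff Reals_cnj_iff)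
  have "z *\<^sub>C f = complex_of_real (Re z) *\<^sub>C f + (\<i> * complex_of_real (Im z)) *\<^sub>C f"
    by (metis complex_eq scaleC_add_left)
  then have "z *\<^sub>C f - A \<cdot> f = ?g + (\<i> * complex_of_real (Im z)) *\<^sub>C f" by simp
  moreover have "Re (cinner ?g ((\<i> * complex_of_real (Im z)) *\<^sub>C f)) = 0"
    unfolding cinner_scaleC_right using im by simp
  ultimately show ?thesis
    by (simp only: norm_add_square norm_scaleC) (simp add: norm_mult power_mult_distrib)
qed

text \<open>For real points, \<open>symmetric_resolvent_bound\<close> bounds the resolvent by the
  inverse distance to \<open>s\<close>; for complex ones the imaginary part is added by
  Pythagoras.\<close>

lemma self_adjoint_isolated_bound:
  fixes A :: "'a::chilbert_space operator"
  assumes A: "self_adjoint A" and d: "0 < d" "ball (complex_of_real s) (2 * d) \<inter> spectrum A \<subseteq> {complex_of_real s}"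
    and z: "cmod (z - complex_of_real s) < d" and f: "f \<in> Dom A"
  shows "cmod (z - complex_of_real s) * norm f \<le> norm (z *\<^sub>C f - A \<cdot> f)"
proof -
  have real: "\<bar>l - s\<bar> * norm f \<le> norm (complex_of_real l *\<^sub>C f - A \<cdot> f)" if l: "\<bar>l - s\<bar> < d" for l
  proof (cases "l = s")
    case False
    \<comment> \<open>The largest open disc about \<open>l\<close> that avoids \<open>s\<close>. Its
      points have distance less than \<open>2 * d\<close> from \<open>s\<close>, whence the factor 2
      in the hypothesis.\<close>
    define U where "U = ball (complex_of_real l) \<bar>l - s\<bar>"
    have "U \<subseteq> resolvent_set A"
    proof
      fix w assume w: "w \<in> U"
      have "dist (complex_of_real s) w \<le> dist (complex_of_real s) (complex_of_real l) + dist (complex_of_real l) w"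
        by (rule dist_triangle)
      also have "dist (complex_of_real s) (complex_of_real l) = \<bar>l - s\<bar>"
        by (simp add: dist_norm norm_minus_commute flip: of_real_diff)
      finally have "w \<in> ball (complex_of_real s) (2 * d)" using w l by (simp add: U_def)
      moreover have "w \<noteq> complex_of_real s" using w by (auto simp: U_def dist_norm simp flip: of_real_diff)
      ultimately show "w \<in> resolvent_set A" using d(2) by (auto simp: spectrum_def)
    qed
    then interpret pseudo_resolvent U "resolvent A"
      using self_adjointD(1)[OF A] by (intro pseudo_resolvent_resolvent) (auto simp: U_def)
    have lU: "complex_of_real l \<in> U" using False by (simp add: U_def)
    then have lr: "complex_of_real l \<in> resolvent_set A" using \<open>U \<subseteq> resolvent_set A\<close> by blast
    let ?x = "complex_of_real l *\<^sub>C f - A \<cdot> f"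
    have "\<bar>l - s\<bar> * norm (resolvent A l ?x) \<le> norm ?x"
      by (rule symmetric_resolvent_bound[OF lU symmetric_resolvent[OF A lr], of "\<lambda>z. cinner (resolvent A z ?x) ?x" _ U])
         (use holomorphic lU open_U in \<open>auto simp: U_def\<close>)
    then show ?thesis by (simp add: resolvent_left[OF lr f])
  qed simp
  have Re: "\<bar>Re z - s\<bar> < d" using abs_Re_le_cmod[of "z - complex_of_real s"] z by simp
  have "(cmod (z - complex_of_real s) * norm f)\<^sup>2 = (\<bar>Re z - s\<bar> * norm f)\<^sup>2 + (Im z)\<^sup>2 * (norm f)\<^sup>2"
    by (simp add: power_mult_distrib cmod_power2 distrib_right)
  also have "\<dots> \<le> (norm (z *\<^sub>C f - A \<cdot> f))\<^sup>2"
    unfolding self_adjoint_norm_shift[OF A f, of z] using real[OF Re] by (intro add_right_mono power_mono) auto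
  finally show ?thesis by (rule power2_le_imp_le) simp
qed

text \<open>A spectral point with trivial eigenspace is covered too: the condition on
  \<open>x\<close> is then vacuous there, and the singularity is removable by the same
  argument.\<close>

theorem self_adjoint_discrete_complete:
  fixes A :: "'a::chilbert_space operator"
  assumes A: "self_adjoint A" and real: "spectrum A \<subseteq> range complex_of_real" and nolim: "\<And>z. \<not> z islimpt spectrum A"
    and zero: "0 \<notin> spectrum A" and x: "\<And>s e. complex_of_real s \<in> spectrum A \<Longrightarrow> e \<in> eigenspace A (complex_of_real s) \<Longrightarrow> cinner x e = 0"
  shows "x = 0"
proof -
  define U where "U = - spectrum A"
  have "closed (spectrum A)" using nolim by (simp add: closed_limpt)
  then have "open U" by (auto simp: U_def)
  have Ures: "U = resolvent_set A" by (simp add: U_def spectrum_def)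
  interpret pseudo_resolvent U "resolvent A"
    using self_adjointD(1)[OF A] \<open>open U\<close> by (intro pseudo_resolvent_resolvent) (auto simp: Ures)
  define F where "F = (\<lambda>z. cinner (resolvent A z x) x)"
  have F: "F holomorphic_on U" unfolding F_def by (rule holomorphic)
  have extend: "\<exists>d g. 0 < d \<and> ball s d \<inter> spectrum A \<subseteq> {s} \<and> g holomorphic_on ball s d \<and> (\<forall>z\<in>ball s d - {s}. g z = F z)"
    if s: "s \<in> spectrum A" for s
  proof -
    obtain \<sigma> where \<sigma>: "s = complex_of_real \<sigma>" using s real by blast
    obtain e where e: "e > 0" "\<And>z. z \<in> spectrum A \<Longrightarrow> z \<noteq> s \<Longrightarrow> e \<le> dist z s"
      using nolim[of s] unfolding islimpt_approachable by (meson not_le)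
    define d where "d = e / 2"
    have d: "0 < d" "ball s (2 * d) \<inter> spectrum A \<subseteq> {s}" using e by (force simp: d_def dist_commute)+
    have res: "z \<in> resolvent_set A" if "z \<in> ball s d - {s}" for z
      using that d unfolding Ures[symmetric] U_def by (auto simp: subset_iff)
    have bound: "cmod (z - s) * norm (resolvent A z v) \<le> norm v" if z: "z \<in> ball s d - {s}" for z v
      using self_adjoint_isolated_bound[OF A d(1) d(2)[unfolded \<sigma>], of z "resolvent A z v"] z
        resolvent_in_Dom[OF res[OF z]] resolvent_right[OF res[OF z]] by (simp add: \<sigma> dist_norm norm_minus_commute)
    define Rg where "Rg = (\<lambda>f. s *\<^sub>C f - A \<cdot> f) ` Dom A"
    note lin = linear_operatorD[OF self_adjointD(1)[OF A]]
    have Rg: "csubspace Rg"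
    proof (rule csubspaceI)
      show "0 \<in> Rg" unfolding Rg_def using lin(4) csubspaceD(1)[OF lin(1)] by force
      show "u + v \<in> Rg" if "u \<in> Rg" "v \<in> Rg" for u v
      proof -
        obtain f g where "f \<in> Dom A" "u = s *\<^sub>C f - A \<cdot> f" "g \<in> Dom A" "v = s *\<^sub>C g - A \<cdot> g"
          using \<open>u \<in> Rg\<close> \<open>v \<in> Rg\<close> unfolding Rg_def by blast
        then have "f + g \<in> Dom A" "u + v = s *\<^sub>C (f + g) - A \<cdot> (f + g)"
          using lin(2)[of f g] csubspaceD(2)[OF lin(1)] by (auto simp: scaleC_add_right)
        then show ?thesis by (auto simp: Rg_def)
      qed
      show "c *\<^sub>C u \<in> Rg" if "u \<in> Rg" for c u
      proof -
        obtain f where "f \<in> Dom A" "u = s *\<^sub>C f - A \<cdot> f" using \<open>u \<in> Rg\<close> unfolding Rg_def by blast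
        then have mem: "c *\<^sub>C f \<in> Dom A" and eq: "c *\<^sub>C u = s *\<^sub>C (c *\<^sub>C f) - A \<cdot> (c *\<^sub>C f)"
          using lin(3)[of f c] csubspaceD(3)[OF lin(1)] by (auto simp: scaleC_diff_right scaleC_scaleC mult.commute)
        show ?thesis unfolding Rg_def by (rule image_eqI[where x="c *\<^sub>C f"]) (rule eq, rule mem)
      qed
    qed
    \<comment> \<open>The orthogonal complement of the range of \<open>s - A\<close> is the
      eigenspace at \<open>s\<close>, to which \<open>x\<close> is orthogonal.\<close>
    have "x \<in> closure Rg"
    proof -
      obtain p where p: "p \<in> closure Rg" "\<And>m. m \<in> closure Rg \<Longrightarrow> cinner (x - p) m = 0"
        using orthogonal_projection_exists[OF csubspace_closure[OF Rg] closed_closure] by blast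
      have "x - p \<in> eigenspace A s"
      proof -
        have "x - p \<in> Dom A \<and> A \<cdot> (x - p) = s *\<^sub>C (x - p)"
        proof (rule self_adjointD(3)[OF A])
          fix f assume "f \<in> Dom A"
          then have "s *\<^sub>C f - A \<cdot> f \<in> Rg" unfolding Rg_def by (rule imageI)
          then have "s *\<^sub>C f - A \<cdot> f \<in> closure Rg" by (rule subsetD[OF closure_subset])
          then have "cinner (x - p) (s *\<^sub>C f - A \<cdot> f) = 0" by (rule p(2))
          then have "cinner (s *\<^sub>C f - A \<cdot> f) (x - p) = 0" using cinner_commute[of "s *\<^sub>C f - A \<cdot> f" "x - p"] by simp
          then have "cinner (s *\<^sub>C f) (x - p) - cinner (A \<cdot> f) (x - p) = 0" by (simp only: cinner_diff_left)
          then show "cinner (A \<cdot> f) (x - p) = cinner f (s *\<^sub>C (x - p))"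
            by (simp add: cinner_scaleC_left cinner_scaleC_right \<sigma>)
        qed
        then show ?thesis by (simp add: eigenspace_def)
      qed
      then have "cinner x (x - p) = 0" using x[of \<sigma>] s by (simp add: \<sigma>)
      moreover have "cinner p (x - p) = 0" using p(2)[OF p(1)] cinner_commute[of p "x - p"] by simp
      ultimately have "cinner (x - p) (x - p) = 0" by (simp add: cinner_diff_left)
      then have "x - p = 0" using cinner_eq_zero_iff by blast
      then show ?thesis using p(1) by simp
    qed
    \<comment> \<open>This is the condition in Riemann's theorem on removable singularities.
      Approximate \<open>x\<close> by \<open>s f - A f\<close>: the resolvent at \<open>z\<close>
      maps this vector to \<open>f - (z - s) R(z) f\<close>, which stays bounded near
      \<open>s\<close>, while \<open>bound\<close> controls the remainder.\<close>
    have "((\<lambda>z. (z - s) * F z) \<longlongrightarrow> 0) (at s)"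
    proof (rule tendstoI)
      fix \<epsilon> :: real assume "\<epsilon> > 0"
      \<comment> \<open>Approximation and remainder contribute at most \<delta> each, and the
        Cauchy-Schwarz inequality multiplies their sum by \<open>norm x\<close>; adding 1 keeps the
        denominator positive.\<close>
      define \<delta> where "\<delta> = \<epsilon> / (2 * (norm x + 1))"
      have "\<delta> > 0" using \<open>\<epsilon> > 0\<close> by (simp add: \<delta>_def add_nonneg_pos)
      then obtain y where "y \<in> Rg" "dist y x < \<delta>" using \<open>x \<in> closure Rg\<close> closure_approachable by blast
      then obtain f where f: "f \<in> Dom A" "norm (x - (s *\<^sub>C f - A \<cdot> f)) < \<delta>"
        by (auto simp: Rg_def dist_norm norm_minus_commute)
      have "\<forall>\<^sub>F z in at s. z \<in> ball s d - {s}"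
        using eventually_at_in_open[of "ball s d" s] d by simp
      moreover have "\<forall>\<^sub>F z in at s. dist z s < \<delta> / (2 * (norm f + 1))"
      proof -
        have "0 < \<delta> / (2 * (norm f + 1))"
          using \<open>\<delta> > 0\<close> by (intro divide_pos_pos mult_pos_pos add_nonneg_pos) auto
        then show ?thesis unfolding eventually_at by blast
      qed
      ultimately show "\<forall>\<^sub>F z in at s. dist ((z - s) * F z) 0 < \<epsilon>"
      proof eventually_elim
        case (elim z)
        note z = elim(1)
        have bc: "bounded_clinear (resolvent A z)" using bounded_clinear_resolvent[OF self_adjointD(1)[OF A] res[OF z]] .
        let ?y = "s *\<^sub>C f - A \<cdot> f"
        have "?y = (z *\<^sub>C f - A \<cdot> f) - (z - s) *\<^sub>C f" by (simp add: scaleC_diff_left)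
        then have "resolvent A z ?y = f - (z - s) *\<^sub>C resolvent A z f"
          by (simp only: bounded_clinearD(3)[OF bc] bounded_clinearD(5)[OF bc, of "z *\<^sub>C f - A \<cdot> f"] resolvent_left[OF res[OF z] f(1)])
        then have "cmod (z - s) * norm (resolvent A z ?y) \<le> cmod (z - s) * (norm f + cmod (z - s) * norm (resolvent A z f))"
          using norm_triangle_ineq4[of f "(z - s) *\<^sub>C resolvent A z f"] by (intro mult_left_mono) auto
        also have "\<dots> \<le> cmod (z - s) * (norm f + norm f)" using bound[OF z, of f] by (intro mult_left_mono add_left_mono) auto
        also have "\<dots> \<le> cmod (z - s) * (2 * (norm f + 1))" by (intro mult_left_mono) auto
        also have "\<dots> < \<delta>"
        proof -
          have "0 < 2 * (norm f + 1)" by (simp add: add_nonneg_pos)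
          then show ?thesis using elim(2) by (simp only: dist_norm pos_less_divide_eq)
        qed
        finally have 1: "cmod (z - s) * norm (resolvent A z ?y) < \<delta>" .
        have 2: "cmod (z - s) * norm (resolvent A z (x - ?y)) < \<delta>" using bound[OF z, of "x - ?y"] f(2) by linarith
        have "norm (resolvent A z x) \<le> norm (resolvent A z ?y) + norm (resolvent A z (x - ?y))"
          using norm_triangle_ineq[of "resolvent A z ?y" "resolvent A z (x - ?y)"] by (simp add: bounded_clinearD(5)[OF bc])
        then have "cmod (z - s) * norm (resolvent A z x) \<le> cmod (z - s) * (norm (resolvent A z ?y) + norm (resolvent A z (x - ?y)))"
          by (intro mult_left_mono) auto
        with 1 2 have *: "cmod (z - s) * norm (resolvent A z x) \<le> 2 * \<delta>" by (simp add: distrib_left)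
        have "cmod ((z - s) * F z) \<le> cmod (z - s) * (norm (resolvent A z x) * norm x)"
          unfolding F_def norm_mult by (intro mult_left_mono Cauchy_Schwarz_cinner) auto
        also have "\<dots> \<le> 2 * \<delta> * norm x" using mult_right_mono[OF *, of "norm x"] by (simp add: mult.assoc)
        also have "\<dots> < 2 * \<delta> * (norm x + 1)" using \<open>\<delta> > 0\<close> by simp
        also have "\<dots> = \<epsilon>"
        proof -
          have "norm x + 1 \<noteq> 0" by (metis add_nonneg_pos norm_ge_zero order_less_irrefl zero_less_one)
          moreover have "2 * (\<epsilon> / (2 * K)) * K = \<epsilon>" if "K \<noteq> 0" for K :: real using that by simp
          ultimately show ?thesis unfolding \<delta>_def by blast
        qed
        finally show ?case by simp
      qed
    qed
    moreover have "F holomorphic_on ball s d - {s}"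
    proof (rule holomorphic_on_subset[OF F])
      show "ball s d - {s} \<subseteq> U" using res unfolding Ures by blast
    qed
    ultimately have "\<exists>g. g holomorphic_on ball s d \<and> (\<forall>z\<in>ball s d - {s}. g z = F z)"
      using d(1) by (subst holomorphic_on_extend_lim) auto
    moreover have "ball s d \<inter> spectrum A \<subseteq> {s}" using d by (auto simp: subset_iff)
    ultimately show ?thesis using d(1) by blast
  qed
  define G where "G = (\<lambda>z. if z \<in> spectrum A then Lim (at z) F else F z)"
  have "G holomorphic_on UNIV"
    unfolding holomorphic_on_open[OF open_UNIV]
  proof
    fix z :: complex
    show "\<exists>D. (G has_field_derivative D) (at z)"
    proof (cases "z \<in> spectrum A")
      case False
      then have zU: "z \<in> U" by (simp add: U_def)
      obtain D where "(F has_field_derivative D) (at z)" using F zU \<open>open U\<close> holomorphic_on_open by blast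
      then have "(G has_field_derivative D) (at z)"
        by (rule has_field_derivative_transform_within_open[OF _ \<open>open U\<close> zU]) (simp add: G_def U_def)
      then show ?thesis by blast
    next
      case True
      obtain d g where d: "0 < d" "ball z d \<inter> spectrum A \<subseteq> {z}" "g holomorphic_on ball z d" "\<forall>w\<in>ball z d - {z}. g w = F w"
        using extend[OF True] by blast
      have "isCont g z" using d holomorphic_on_imp_continuous_on continuous_on_interior by (metis centre_in_ball interior_open open_ball)
      then have "(g \<longlongrightarrow> g z) (at z)" by (simp add: isCont_def)
      moreover have "\<forall>\<^sub>F w in at z. g w = F w"
        using eventually_at_in_open[of "ball z d" z] d(1) d(4) by (auto elim: eventually_mono)
      ultimately have "(F \<longlongrightarrow> g z) (at z)" by (rule Lim_transform_eventually)
      then have Gz: "G z = g z" using True by (simp add: G_def tendsto_Lim)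
      obtain D where "(g has_field_derivative D) (at z)" using d holomorphic_on_open by (metis centre_in_ball open_ball)
      then have "(G has_field_derivative D) (at z)"
      proof (rule has_field_derivative_transform_within_open[where S="ball z d"])
        fix w assume "w \<in> ball z d"
        then show "g w = G w" using Gz d(2,4) by (cases "w = z") (auto simp: G_def)
      qed (use d in auto)
      then show ?thesis by blast
    qed
  qed
  have U0: "0 \<in> U" using zero by (simp add: U_def)
  have res0: "complex_of_real 0 \<in> resolvent_set A" using U0 Ures by simp
  have "\<rho> * norm (resolvent A 0 x) \<le> norm x" if "\<rho> > 0" for \<rho>
    by (rule symmetric_resolvent_bound[OF U0 symmetric_resolvent[OF A res0, simplified], of G _ "U \<inter> ball 0 \<rho>"])
       (use U0 that \<open>open U\<close> \<open>G holomorphic_on UNIV\<close> in \<open>auto simp: G_def F_def U_def intro: holomorphic_on_subset\<close>)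
  \<comment> \<open>Since \<open>G\<close> is entire, the radius is at our disposal; this one would
    give \<open>norm x + 1 \<le> norm x\<close> if \<open>resolvent A 0 x\<close> were not
    zero.\<close>
  from this[of "(norm x + 1) / norm (resolvent A 0 x)"] have "norm (resolvent A 0 x) = 0"
    by (cases "norm (resolvent A 0 x) = 0") (auto simp: divide_pos_pos add_nonneg_pos)
  then have "resolvent A 0 x = 0" by simp
  then show "x = 0" using resolvent_right[OF res0[simplified], of x] linear_operatorD(4)[OF self_adjointD(1)[OF A]] by simp
qed

section \<open>Orthogonal resolutions of the identity and diagonal operators\<close>

lemma Cauchy_Schwarz_suminf:
  fixes a c :: "nat \<Rightarrow> real"
  assumes a: "\<And>k. 0 \<le> a k" "summable (\<lambda>k. (a k)\<^sup>2)" and c: "\<And>k. 0 \<le> c k" "summable (\<lambda>k. (c k)\<^sup>2)"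
  shows "summable (\<lambda>k. a k * c k)" "(\<Sum>k. a k * c k)\<^sup>2 \<le> (\<Sum>k. (a k)\<^sup>2) * (\<Sum>k. (c k)\<^sup>2)"
proof -
  let ?A = "\<Sum>k. (a k)\<^sup>2" and ?C = "\<Sum>k. (c k)\<^sup>2"
  have part: "(\<Sum>k<n. a k * c k)\<^sup>2 \<le> ?A * ?C" for n
  proof -
    have "(\<Sum>k<n. a k * c k)\<^sup>2 \<le> (\<Sum>k<n. (a k)\<^sup>2) * (\<Sum>k<n. (c k)\<^sup>2)"
      by (rule Cauchy_Schwarz_ineq_sum)
    also have "\<dots> \<le> ?A * ?C"
      by (intro mult_mono sum_le_suminf a c sum_nonneg suminf_nonneg) auto
    finally show ?thesis .
  qed
  have nonneg: "0 \<le> ?A * ?C" by (intro mult_nonneg_nonneg suminf_nonneg a c) auto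
  have part': "(\<Sum>k<n. a k * c k) \<le> sqrt (?A * ?C)" for n
    by (rule real_le_rsqrt[OF part])
  show sm: "summable (\<lambda>k. a k * c k)"
    by (rule summableI_nonneg_bounded[OF _ part']) (use a c in auto)
  have "(\<Sum>k. a k * c k) \<le> sqrt (?A * ?C)"
    by (rule suminf_le_const[OF sm part'])
  moreover have "0 \<le> (\<Sum>k. a k * c k)" using a c by (intro suminf_nonneg sm) auto
  ultimately have "(\<Sum>k. a k * c k)\<^sup>2 \<le> (sqrt (?A * ?C))\<^sup>2" by (rule power_mono)
  then show "(\<Sum>k. a k * c k)\<^sup>2 \<le> ?A * ?C" using nonneg by simp
qed

text \<open>Completeness is kept apart in \<open>orthogonal_resolution\<close>, since for the
  eigenprojections of \<open>A\<close> it is established only later, with the help of the facts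
  proved here.\<close>

locale orthogonal_projections =
  fixes P :: "nat \<Rightarrow> 'a::chilbert_space \<Rightarrow> 'a"
  assumes bounded_clinear_P: "bounded_clinear (P k)"
    and sym_P: "cinner (P k x) y = cinner x (P k y)"
    and idem_P: "P k (P k x) = P k x"
    and orth_P: "j \<noteq> k \<Longrightarrow> P j (P k x) = 0"
begin

lemmas lin_P = bounded_clinearD[OF bounded_clinear_P]

lemma cinner_P: "cinner (P k x) y = cinner (P k x) (P k y)"
  using sym_P[of k "P k x" y] by (simp add: idem_P)

lemma norm_sum_square:
  assumes "finite I" and y: "\<And>k. P k (y k) = y k"
  shows "(norm (\<Sum>k\<in>I. y k))\<^sup>2 = (\<Sum>k\<in>I. (norm (y k))\<^sup>2)"
  using \<open>finite I\<close>
proof (induction I rule: finite_induct)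
  case (insert k I)
  have "cinner (y k) (\<Sum>i\<in>I. y i) = (\<Sum>i\<in>I. cinner (P k (y k)) (P i (y i)))"
    by (simp add: cinner_sum_right y)
  also have "\<dots> = 0"
  proof (rule sum.neutral, rule ballI)
    fix i assume "i \<in> I"
    then have "k \<noteq> i" using insert by auto
    then show "cinner (P k (y k)) (P i (y i)) = 0" by (subst sym_P) (simp add: orth_P)
  qed
  finally show ?case using insert by (simp add: norm_add_square)
qed simp

text \<open>By Pythagoras, blocks of the series have the same squared norms as blocks of the scalar
  series.\<close>

lemma orthogonal_summable:
  assumes y: "\<And>k. P k (y k) = y k" and sm: "summable (\<lambda>k. (norm (y k))\<^sup>2)"
  shows "summable y" "P j (suminf y) = y j"
proof -
  show s: "summable y"
    unfolding summable_Cauchy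
  proof (intro allI impI)
    fix e :: real assume "e > 0"
    then have "e\<^sup>2 > 0" by simp
    then obtain N where N: "\<And>m n. m \<ge> N \<Longrightarrow> norm (\<Sum>k=m..<n. (norm (y k))\<^sup>2) < e\<^sup>2"
      using sm unfolding summable_Cauchy by meson
    have "norm (sum y {m..<n}) < e" if "m \<ge> N" for m n
    proof -
      have "(norm (sum y {m..<n}))\<^sup>2 < e\<^sup>2"
        using N[OF that, of n] by (simp add: norm_sum_square[OF _ y] sum_nonneg)
      then show ?thesis using \<open>e > 0\<close> by (simp add: power2_less_imp_less)
    qed
    then show "\<exists>N. \<forall>m\<ge>N. \<forall>n. norm (sum y {m..<n}) < e" by blast
  qed
  have "(\<lambda>k. P j (y k)) sums P j (suminf y)"
    by (rule bounded_linear.sums[OF lin_P(1) summable_sums[OF s]])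
  moreover have "P j (y k) = (if k = j then y j else 0)" for k
    using orth_P[of j k "y k"] y by auto
  ultimately have "(\<lambda>k. if k = j then y k else 0) sums P j (suminf y)" by (simp cong: if_cong)
  then show "P j (suminf y) = y j" using sums_single[of j y] sums_unique2 by blast
qed

lemma Bessel: "summable (\<lambda>k. (norm (P k x))\<^sup>2)"
proof (rule summableI_nonneg_bounded)
  fix n
  define S where "S = (\<Sum>k<n. P k x)"
  have sq: "(norm S)\<^sup>2 = (\<Sum>k<n. (norm (P k x))\<^sup>2)" unfolding S_def by (rule norm_sum_square) (simp_all add: idem_P)
  have "cinner S x = (\<Sum>k<n. cinner (P k x) (P k x))"
    unfolding S_def cinner_sum_left by (rule sum.cong[OF refl], rule cinner_P)
  also have "\<dots> = complex_of_real ((norm S)\<^sup>2)" by (simp add: cinner_self sq)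
  finally have "(norm S)\<^sup>2 \<le> norm S * norm x"
    using Cauchy_Schwarz_cinner[of S x] by (simp add: norm_power)
  then have "norm S \<le> norm x" by (cases "norm S = 0") (auto simp: power2_eq_square)
  then show "(\<Sum>k<n. (norm (P k x))\<^sup>2) \<le> (norm x)\<^sup>2" unfolding sq[symmetric] by (rule power_mono) simp
qed simp

end

locale orthogonal_resolution = orthogonal_projections +
  assumes sums_P: "(\<lambda>k. P k x) sums x"
begin

lemma cinner_sums: "(\<lambda>k. cinner (P k x) (P k y)) sums cinner x y"
proof -
  have "(\<lambda>k. cinner (P k x) y) sums cinner x y"
    by (rule bounded_linear.sums[OF bounded_linear_cinner_left sums_P])
  then show ?thesis by (simp only: cinner_P[symmetric])
qed

lemma norm_sums: "(\<lambda>k. (norm (P k x))\<^sup>2) sums (norm x)\<^sup>2"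
  using bounded_linear.sums[OF bounded_linear_Re cinner_sums[of x x]] by (simp add: cinner_self)

lemmas summable_norm_P = Bessel

lemma P_ext: "(\<And>k. P k x = P k y) \<Longrightarrow> x = y"
  using sums_P[of x] sums_P[of y] sums_unique2 by auto

lemma assemble:
  assumes y: "\<And>k. P k (y k) = y k" and sm: "summable (\<lambda>k. (norm (y k))\<^sup>2)"
  shows "P j (suminf y) = y j" "(norm (suminf y))\<^sup>2 = (\<Sum>k. (norm (y k))\<^sup>2)"
proof -
  show P: "P j (suminf y) = y j" for j by (rule orthogonal_summable(2)[OF assms])
  show "(norm (suminf y))\<^sup>2 = (\<Sum>k. (norm (y k))\<^sup>2)"
    using sums_unique[OF norm_sums[of "suminf y"]] by (simp add: P)
qed

text \<open>The functional calculus of the resolution, meant for bounded sequences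
  \<open>d\<close>.\<close>

definition diag :: "(nat \<Rightarrow> complex) \<Rightarrow> 'a \<Rightarrow> 'a" where
  "diag d x = (\<Sum>k. d k *\<^sub>C P k x)"

lemma diag:
  assumes d: "\<And>k. cmod (d k) \<le> c"
  shows P_diag: "P j (diag d x) = d j *\<^sub>C P j x"
    and norm_diag_le: "norm (diag d x) \<le> c * norm x"
    and bounded_clinear_diag: "bounded_clinear (diag d)"
proof -
  have c0: "0 \<le> c" using d[of 0] norm_ge_zero order_trans by blast
  have y: "P k (d k *\<^sub>C P k x) = d k *\<^sub>C P k x" for k x by (simp add: lin_P idem_P)
  have le: "(norm (d k *\<^sub>C P k x))\<^sup>2 \<le> c\<^sup>2 * (norm (P k x))\<^sup>2" for k x
    using d[of k] by (simp add: power_mult_distrib mult_right_mono power_mono)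
  have sm: "summable (\<lambda>k. c\<^sup>2 * (norm (P k x))\<^sup>2)" for x by (intro summable_mult summable_norm_P)
  have sm': "summable (\<lambda>k. (norm (d k *\<^sub>C P k x))\<^sup>2)" for x
    by (rule summable_comparison_test'[OF sm[of x], of 0]) (use le in simp)
  show P: "P j (diag d x) = d j *\<^sub>C P j x" for j x
    unfolding diag_def by (rule assemble(1)[OF y sm'])
  have "(norm (diag d x))\<^sup>2 \<le> (\<Sum>k. c\<^sup>2 * (norm (P k x))\<^sup>2)" for x
    unfolding diag_def assemble(2)[OF y sm'] by (rule suminf_le[OF le sm' sm])
  also have "(\<Sum>k. c\<^sup>2 * (norm (P k x))\<^sup>2) = (c * norm x)\<^sup>2" for x
    using suminf_mult[OF summable_norm_P, of "c\<^sup>2" x] sums_unique[OF norm_sums[of x]] by (simp add: power_mult_distrib)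
  finally show norm: "norm (diag d x) \<le> c * norm x" for x
    by (rule power2_le_imp_le) (simp add: c0)
  show "bounded_clinear (diag d)"
  proof (rule bounded_clinearI[OF _ _ norm])
    show "diag d (x + y) = diag d x + diag d y" for x y
      by (rule P_ext) (simp add: P lin_P scaleC_add_right)
    show "diag d (a *\<^sub>C x) = a *\<^sub>C diag d x" for a x
      by (rule P_ext) (simp add: P lin_P scaleC_scaleC mult.commute)
  qed
qed

lemma cinner_diag:
  assumes d: "\<And>k. cmod (d k) \<le> c"
  shows "cinner (diag d x) y = cinner x (diag (\<lambda>k. cnj (d k)) y)"
proof -
  have "(\<lambda>k. cinner (P k (diag d x)) (P k y)) = (\<lambda>k. cinner (P k x) (P k (diag (\<lambda>k. cnj (d k)) y)))"
    using P_diag[of d c] P_diag[of "\<lambda>k. cnj (d k)" c] d by (simp add: cinner_simps)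
  then show ?thesis using cinner_sums[of "diag d x" y] cinner_sums[of x "diag (\<lambda>k. cnj (d k)) y"] sums_unique2 by metis
qed

lemma diag_diag:
  assumes "\<And>k. cmod (d k) \<le> c" "\<And>k. cmod (e k) \<le> c'" "\<And>k. cmod (d k * e k) \<le> c''"
  shows "diag d (diag e x) = diag (\<lambda>k. d k * e k) x"
  by (rule P_ext) (simp add: P_diag[of d c, OF assms(1)] P_diag[of e c', OF assms(2)] P_diag[of "\<lambda>k. d k * e k" c'', OF assms(3)] scaleC_scaleC)

lemma diag_one: "diag (\<lambda>_. 1) x = x"
  by (rule P_ext) (simp add: P_diag[of _ 1])

end

lemma (in orthogonal_projections) orthogonal_resolutionI:
  assumes complete: "\<And>x. (\<And>k. P k x = 0) \<Longrightarrow> x = 0"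
  shows "orthogonal_resolution P"
proof
  fix x
  note sm = orthogonal_summable[of "\<lambda>k. P k x", OF idem_P Bessel]
  have "x - (\<Sum>k. P k x) = 0" by (rule complete) (simp add: lin_P sm(2))
  then show "(\<lambda>k. P k x) sums x" using summable_sums[OF sm(1)] by simp
qed

lemma orthogonal_projections_orth_proj:
  fixes E :: "nat \<Rightarrow> 'a::chilbert_space set"
  assumes E: "\<And>k. csubspace (E k)" "\<And>k. closed (E k)"
    and orth: "\<And>j k x y. j \<noteq> k \<Longrightarrow> x \<in> E j \<Longrightarrow> y \<in> E k \<Longrightarrow> cinner x y = 0"
  shows "orthogonal_projections (\<lambda>k. orth_proj (E k))"
proof
  note mem = orth_proj_in[OF E] and perp = orth_proj_orth[OF E] and eq = orth_proj_eq[OF E]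
  have inner: "cinner (orth_proj (E k) x) y = cinner (orth_proj (E k) x) (orth_proj (E k) y)" for k x y
  proof -
    have "cinner (y - orth_proj (E k) y) (orth_proj (E k) x) = 0" by (rule perp[OF mem])
    then show ?thesis
      using cinner_commute[of "orth_proj (E k) x" "y - orth_proj (E k) y"] by (simp add: cinner_diff_right)
  qed
  show sym: "cinner (orth_proj (E k) x) y = cinner x (orth_proj (E k) y)" for k x y
  proof -
    have "cinner (x - orth_proj (E k) x) (orth_proj (E k) y) = 0" by (rule perp[OF mem])
    then show ?thesis using inner[of k x y] by (simp add: cinner_diff_left)
  qed
  show "orth_proj (E k) (orth_proj (E k) x) = orth_proj (E k) x" for k x
    by (rule eq[OF mem]) simp
  show "orth_proj (E j) (orth_proj (E k) x) = 0" if "j \<noteq> k" for j k x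
    by (rule eq[OF csubspaceD(1)[OF E(1)]]) (use orth[OF that] mem cinner_commute in \<open>metis complex_cnj_zero diff_zero\<close>)
  show "bounded_clinear (orth_proj (E k))" for k
  proof (rule bounded_clinearI)
    show "orth_proj (E k) (x + y) = orth_proj (E k) x + orth_proj (E k) y" for x y
    proof (rule eq)
      fix e assume "e \<in> E k"
      then show "cinner (x + y - (orth_proj (E k) x + orth_proj (E k) y)) e = 0"
        using perp[OF \<open>e \<in> E k\<close>, of x] perp[OF \<open>e \<in> E k\<close>, of y] by (simp add: cinner_simps)
    qed (intro csubspaceD[OF E(1)] mem)
    show "orth_proj (E k) (c *\<^sub>C x) = c *\<^sub>C orth_proj (E k) x" for c x
    proof (rule eq)
      fix e assume "e \<in> E k"
      then show "cinner (c *\<^sub>C x - c *\<^sub>C orth_proj (E k) x) e = 0"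
        using perp[OF \<open>e \<in> E k\<close>, of x] by (simp add: cinner_simps)
    qed (intro csubspaceD[OF E(1)] mem)
    show "norm (orth_proj (E k) x) \<le> 1 * norm x" for x
    proof -
      let ?p = "orth_proj (E k) x"
      have "complex_of_real ((norm ?p)\<^sup>2) = cinner ?p x" using inner[of k x x] by (simp add: cinner_self)
      then have "(norm ?p)\<^sup>2 \<le> norm ?p * norm x"
        using Cauchy_Schwarz_cinner[of ?p x] by (metis norm_of_real abs_of_nonneg zero_le_power2)
      then show ?thesis by (cases "norm ?p = 0") (auto simp: power2_eq_square)
    qed
  qed
qed

section \<open>The factorised resolvents\<close>

text \<open>With \<open>C = A\<^sup>-\<^sup>1\<^sup>/\<^sup>2\<close>, \<open>J = A\<^sup>-\<^sup>1\<close> and \<open>\<langle>Vx, y\<rangle> = v(Cx, Cy)\<close>, the form \<open>a + \<tau> v - z\<close> becomes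
  \<open>I + \<tau> V - z J\<close>, so that the resolvent of the associated operator is \<open>- C (I + \<tau> V - z J)\<^sup>-\<^sup>1 C\<close>.\<close>

locale form_perturbation = orthogonal_resolution P for P :: "nat \<Rightarrow> 'a::chilbert_space \<Rightarrow> 'a" +
  fixes m w :: "nat \<Rightarrow> real" and V :: "'a \<Rightarrow> 'a"
  assumes m_bound: "\<exists>e>0. \<forall>k. e \<le> m k" and m_top: "filterlim m at_top sequentially"
    and w_nonneg: "0 \<le> w k" and w_summable: "summable (\<lambda>k. (w k)\<^sup>2 / m k)"
    and bounded_clinear_V: "bounded_clinear V"
    and V_bound: "cmod (cinner (V x) y) \<le> (\<Sum>k. w k / sqrt (m k) * norm (P k x)) * (\<Sum>k. w k / sqrt (m k) * norm (P k y))"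
begin

lemma m_pos: "0 < m k"
  using m_bound less_le_trans by blast

definition spec :: "complex set" where "spec = range (\<lambda>k. complex_of_real (m k))"

definition s :: "complex \<Rightarrow> real" where "s z = (\<Sum>k. (w k)\<^sup>2 / cmod (complex_of_real (m k) - z))"

text \<open>The region on which \<open>M \<tau> z\<close> is shown to be invertible for all \<tau>
  between 0 and 1. It is the same for all \<tau>, so contours need not be adapted along the
  deformation.\<close>

definition U :: "complex set" where "U = {z. z \<notin> spec \<and> s z < 1}"

definition C :: "'a \<Rightarrow> 'a" where "C = diag (\<lambda>k. complex_of_real (1 / sqrt (m k)))"

definition J :: "'a \<Rightarrow> 'a" where "J = diag (\<lambda>k. complex_of_real (1 / m k))"

definition M :: "real \<Rightarrow> complex \<Rightarrow> 'a \<Rightarrow> 'a" where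
  "M \<tau> z x = x + complex_of_real \<tau> *\<^sub>C V x - z *\<^sub>C J x"

definition R :: "real \<Rightarrow> complex \<Rightarrow> 'a \<Rightarrow> 'a" where
  "R \<tau> z x = - C (inv (M \<tau> z) (C x))"

lemma inverse_m_bounded:
  obtains c where "\<And>k. cmod (complex_of_real (1 / m k)) \<le> c" "\<And>k. cmod (complex_of_real (1 / sqrt (m k))) \<le> c"
proof -
  obtain e where e: "e > 0" "\<And>k. e \<le> m k" using m_bound by blast
  have "cmod (complex_of_real (1 / m k)) \<le> max (1 / e) (1 / sqrt e)"
    "cmod (complex_of_real (1 / sqrt (m k))) \<le> max (1 / e) (1 / sqrt e)" for k
  proof -
    show "cmod (complex_of_real (1 / m k)) \<le> max (1 / e) (1 / sqrt e)"
      using e(1) e(2)[of k] by (intro max.coboundedI1) (simp add: frac_le norm_divide)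
    have "0 < sqrt e" "sqrt e \<le> sqrt (m k)" using e(1) e(2)[of k] by auto
    then have "1 / sqrt (m k) \<le> 1 / sqrt e" by (intro frac_le) auto
    then show "cmod (complex_of_real (1 / sqrt (m k))) \<le> max (1 / e) (1 / sqrt e)"
      using m_pos[of k] by (intro max.coboundedI2) (simp add: norm_divide)
  qed
  then show ?thesis using that by blast
qed

lemma
  shows bounded_clinear_C: "bounded_clinear C" and bounded_clinear_J: "bounded_clinear J"
    and P_C: "P k (C x) = complex_of_real (1 / sqrt (m k)) *\<^sub>C P k x"
    and P_J: "P k (J x) = complex_of_real (1 / m k) *\<^sub>C P k x"
    and C_C: "C (C x) = J x" and sym_C: "cinner (C x) y = cinner x (C y)"
proof -
  obtain c where c: "\<And>k. cmod (complex_of_real (1 / m k)) \<le> c" "\<And>k. cmod (complex_of_real (1 / sqrt (m k))) \<le> c"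
    using inverse_m_bounded by blast
  show "bounded_clinear C" "bounded_clinear J"
    unfolding C_def J_def by (rule bounded_clinear_diag c)+
  show "P k (C x) = complex_of_real (1 / sqrt (m k)) *\<^sub>C P k x" "P k (J x) = complex_of_real (1 / m k) *\<^sub>C P k x" for k
    unfolding C_def J_def by (rule P_diag[OF c(2)], rule P_diag[OF c(1)])
  have sq: "complex_of_real (1 / sqrt (m k)) * complex_of_real (1 / sqrt (m k)) = complex_of_real (1 / m k)" for k
    using m_pos[of k] by (simp flip: of_real_mult)
  then have "diag (\<lambda>k. complex_of_real (1 / sqrt (m k))) (diag (\<lambda>k. complex_of_real (1 / sqrt (m k))) x)
     = diag (\<lambda>k. complex_of_real (1 / sqrt (m k)) * complex_of_real (1 / sqrt (m k))) x"
    by (intro diag_diag[of _ c _ c c] c) (simp only: c)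
  then show "C (C x) = J x" unfolding C_def J_def by (simp only: sq)
  show "cinner (C x) y = cinner x (C y)"
    unfolding C_def using cinner_diag[of "\<lambda>k. complex_of_real (1 / sqrt (m k))" c x y, OF c(2)] by simp
qed

text \<open>All but finitely many \<open>m k\<close> have distance at least 1 from \<open>z\<close>,
  so the infimum is a minimum of finitely many positive numbers.\<close>

lemma spec_distance:
  assumes "z \<notin> spec"
  obtains d where "0 < d" "\<And>k. d \<le> cmod (complex_of_real (m k) - z)"
proof -
  obtain N where N: "\<And>k. k \<ge> N \<Longrightarrow> cmod z + 1 \<le> m k"
    using m_top unfolding filterlim_at_top eventually_sequentially by meson
  define D where "D = insert 1 ((\<lambda>k. cmod (complex_of_real (m k) - z)) ` {..<N})"
  have D: "finite D" "D \<noteq> {}" by (auto simp: D_def)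
  have "Min D \<in> D" using D by (rule Min_in)
  moreover have "\<forall>d\<in>D. 0 < d" using assms by (auto simp: D_def spec_def)
  ultimately have "0 < Min D" by blast
  moreover have "Min D \<le> cmod (complex_of_real (m k) - z)" for k
  proof (cases "k < N")
    case True
    then show ?thesis using D by (intro Min_le) (auto simp: D_def)
  next
    case False
    have "Min D \<le> 1" using D by (intro Min_le) (auto simp: D_def)
    also have "1 \<le> m k - cmod z" using N[of k] False by simp
    also have "\<dots> \<le> cmod (complex_of_real (m k) - z)"
      using norm_triangle_ineq2[of "complex_of_real (m k)" z] m_pos[of k] by simp
    finally show ?thesis .
  qed
  ultimately show ?thesis using that by blast
qed

text \<open>Since \<open>m k\<close> is at most \<open>x + cmod z\<close> with
  \<open>x = cmod (m k - z)\<close>, the ratio \<open>x / m k\<close> is at least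
  \<open>x / (x + cmod z)\<close>, which increases with \<open>x\<close>. These ratios are the
  moduli of the eigenvalues of \<open>I - z J\<close>.\<close>

lemma ratio_bound:
  assumes "0 < d" "\<And>k. d \<le> cmod (complex_of_real (m k) - z)"
  shows "d / (d + cmod z) \<le> cmod (1 - z / complex_of_real (m k))"
proof -
  let ?x = "cmod (complex_of_real (m k) - z)"
  have "m k \<le> ?x + cmod z"
    using norm_triangle_ineq[of "complex_of_real (m k) - z" z] m_pos[of k] by simp
  then have "d * m k \<le> ?x * d + d * cmod z" using assms(1) by (simp add: distrib_left mult_left_mono mult.commute[of ?x] flip: distrib_left)
  also have "d * cmod z \<le> ?x * cmod z" using assms(2) by (intro mult_right_mono) auto
  finally have "d * m k \<le> ?x * (d + cmod z)" by (simp add: distrib_left)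
  moreover have "0 < d + cmod z" using assms(1) by (simp add: add_pos_nonneg)
  moreover have "cmod (1 - z / complex_of_real (m k)) = ?x / m k"
  proof -
    have "1 - z / complex_of_real (m k) = (complex_of_real (m k) - z) / complex_of_real (m k)"
      using m_pos[of k] by (simp add: diff_divide_distrib)
    then show ?thesis using m_pos[of k] by (simp add: norm_divide)
  qed
  ultimately show ?thesis using m_pos[of k] by (simp add: pos_divide_le_eq pos_le_divide_eq)
qed

lemma s_summable:
  assumes "z \<notin> spec"
  shows "summable (\<lambda>k. (w k)\<^sup>2 / cmod (complex_of_real (m k) - z))"
proof -
  obtain d where d: "0 < d" "\<And>k. d \<le> cmod (complex_of_real (m k) - z)" using spec_distance[OF assms] by blast
  define c where "c = (d + cmod z) / d"
  have "(w k)\<^sup>2 / cmod (complex_of_real (m k) - z) \<le> c * ((w k)\<^sup>2 / m k)" for k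
  proof -
    let ?x = "cmod (complex_of_real (m k) - z)"
    have x: "0 < ?x" using d less_le_trans by blast
    have "d / (d + cmod z) \<le> ?x / m k"
    proof -
      have "1 - z / complex_of_real (m k) = (complex_of_real (m k) - z) / complex_of_real (m k)"
        using m_pos[of k] by (simp add: diff_divide_distrib)
      then show ?thesis using ratio_bound[OF d, of k] m_pos[of k] by (simp add: norm_divide)
    qed
    then have "m k \<le> c * ?x"
      using d(1) m_pos[of k] by (simp add: c_def pos_divide_le_eq pos_le_divide_eq add_pos_nonneg mult.commute)
    then have "1 / ?x \<le> c / m k" using x m_pos[of k] by (simp add: pos_divide_le_eq pos_le_divide_eq mult.commute)
    then have "(w k)\<^sup>2 * (1 / ?x) \<le> (w k)\<^sup>2 * (c / m k)" by (rule mult_left_mono) simp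
    then show ?thesis by (simp add: mult.commute)
  qed
  then show ?thesis
    by (intro summable_comparison_test'[OF summable_mult[OF w_summable, of c], of 0]) simp
qed

text \<open>Moving \<open>z\<close> by less than \<open>d * q\<close> shrinks each distance
  \<open>cmod (m k - z)\<close> by a factor \<open>1 - q\<close> at worst, so \<open>s\<close> grows
  by a factor \<open>1 / (1 - q)\<close> at most. The choice of \<open>q\<close> as half of
  \<open>1 - s z\<close> keeps the result below 1.\<close>

lemma open_U: "open U"
  unfolding open_contains_ball
proof
  fix z assume "z \<in> U"
  then have z: "z \<notin> spec" "s z < 1" by (auto simp: U_def)
  obtain d where d: "0 < d" "\<And>k. d \<le> cmod (complex_of_real (m k) - z)" using spec_distance[OF z(1)] by blast
  have s0: "0 \<le> s z" unfolding s_def by (intro suminf_nonneg s_summable z) auto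
  define q where "q = (1 - s z) / 2"
  have q: "0 < q" "q \<le> 1/2" "s z < 1 - q" using z s0 by (auto simp: q_def field_simps)
  have "ball z (d * q) \<subseteq> U"
  proof
    fix y assume y: "y \<in> ball z (d * q)"
    have lower: "(1 - q) * cmod (complex_of_real (m k) - z) \<le> cmod (complex_of_real (m k) - y)" for k
    proof -
      have "cmod (complex_of_real (m k) - z) \<le> cmod (complex_of_real (m k) - y) + cmod (z - y)"
        using norm_triangle_ineq[of "complex_of_real (m k) - y" "y - z"] by (simp add: norm_minus_commute)
      moreover have "cmod (z - y) \<le> cmod (complex_of_real (m k) - z) * q"
      proof -
        have "cmod (z - y) < d * q" using y by (simp add: dist_norm)
        also have "\<dots> \<le> cmod (complex_of_real (m k) - z) * q" using d(2)[of k] q by (intro mult_right_mono) auto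
        finally show ?thesis by simp
      qed
      ultimately show ?thesis by (simp add: algebra_simps)
    qed
    have pos: "0 < (1 - q) * cmod (complex_of_real (m k) - z)" for k
      using q d(1) d(2)[of k] by (intro mult_pos_pos) auto
    have y': "y \<notin> spec"
    proof
      assume "y \<in> spec"
      then obtain k where "y = complex_of_real (m k)" by (auto simp: spec_def)
      then show False using lower[of k] pos[of k] by simp
    qed
    have "s y \<le> (\<Sum>k. (1 / (1 - q)) * ((w k)\<^sup>2 / cmod (complex_of_real (m k) - z)))"
      unfolding s_def
    proof (rule suminf_le[OF _ s_summable[OF y'] summable_mult[OF s_summable[OF z(1)]]])
      fix k
      have "(w k)\<^sup>2 / cmod (complex_of_real (m k) - y) \<le> (w k)\<^sup>2 / ((1 - q) * cmod (complex_of_real (m k) - z))"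
        by (intro divide_left_mono lower mult_pos_pos pos less_le_trans[OF pos lower]) simp
      then show "(w k)\<^sup>2 / cmod (complex_of_real (m k) - y) \<le> (1 / (1 - q)) * ((w k)\<^sup>2 / cmod (complex_of_real (m k) - z))" by simp
    qed
    also have "\<dots> = (1 / (1 - q)) * s z" unfolding s_def by (rule suminf_mult[OF s_summable[OF z(1)]])
    also have "\<dots> < 1" using q by (simp add: divide_less_eq)
    finally show "y \<in> U" using y' by (simp add: U_def)
  qed
  moreover have "0 < d * q" using d q by simp
  ultimately show "\<exists>e>0. ball z e \<subseteq> U" by blast
qed

lemma bounded_clinear_M: "bounded_clinear (M \<tau> z)"
  unfolding M_def
  by (intro bounded_clinear_diff bounded_clinear_add bounded_clinear_ident bounded_clinear_scaleC bounded_clinear_V bounded_clinear_J)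

text \<open>The weight \<open>w k / sqrt (m k)\<close> is the product of
  \<open>w k / sqrt (cmod (m k - z))\<close> and the square root of
  \<open>cmod (1 - z / m k)\<close>. The Cauchy-Schwarz inequality then separates \<open>s z\<close>
  from the quadratic form of the modulus of \<open>I - z J\<close>.\<close>

lemma weighted_sum_bound:
  assumes z: "z \<notin> spec"
  shows "(\<Sum>k. w k / sqrt (m k) * norm (P k x))\<^sup>2 \<le> s z * (\<Sum>k. cmod (1 - z / complex_of_real (m k)) * (norm (P k x))\<^sup>2)"
    and "summable (\<lambda>k. cmod (1 - z / complex_of_real (m k)) * (norm (P k x))\<^sup>2)"
proof -
  obtain e where e: "e > 0" "\<And>k. e \<le> m k" using m_bound by blast
  have le: "cmod (1 - z / complex_of_real (m k)) \<le> 1 + cmod z / e" for k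
  proof -
    have "cmod (1 - z / complex_of_real (m k)) \<le> 1 + cmod z / m k"
      using norm_triangle_ineq4[of 1 "z / complex_of_real (m k)"] m_pos[of k] by (simp add: norm_divide)
    also have "cmod z / m k \<le> cmod z / e" using e e(2)[of k] m_pos[of k] by (intro divide_left_mono) auto
    finally show ?thesis by simp
  qed
  show sm: "summable (\<lambda>k. cmod (1 - z / complex_of_real (m k)) * (norm (P k x))\<^sup>2)"
    by (rule summable_comparison_test'[OF summable_mult[OF summable_norm_P[of x], of "1 + cmod z / e"], of 0])
       (use le in \<open>simp add: mult_right_mono\<close>)
  define a where "a k = w k / sqrt (cmod (complex_of_real (m k) - z))" for k
  define c where "c k = sqrt (cmod (1 - z / complex_of_real (m k))) * norm (P k x)" for k
  have a2: "(a k)\<^sup>2 = (w k)\<^sup>2 / cmod (complex_of_real (m k) - z)" for k by (simp add: a_def power_divide)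
  have c2: "(c k)\<^sup>2 = cmod (1 - z / complex_of_real (m k)) * (norm (P k x))\<^sup>2" for k by (simp add: c_def power_mult_distrib)
  have ac: "a k * c k = w k / sqrt (m k) * norm (P k x)" for k
  proof -
    have ne: "complex_of_real (m k) - z \<noteq> 0" using z by (auto simp: spec_def)
    have "1 - z / complex_of_real (m k) = (complex_of_real (m k) - z) / complex_of_real (m k)"
      using m_pos[of k] by (simp add: diff_divide_distrib)
    then have "cmod (1 - z / complex_of_real (m k)) = cmod (complex_of_real (m k) - z) / m k"
      using m_pos[of k] by (simp add: norm_divide)
    then show ?thesis using ne by (simp add: a_def c_def real_sqrt_divide)
  qed
  have "(\<Sum>k. a k * c k)\<^sup>2 \<le> (\<Sum>k. (a k)\<^sup>2) * (\<Sum>k. (c k)\<^sup>2)"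
    by (rule Cauchy_Schwarz_suminf) (use w_nonneg sm s_summable[OF z] in \<open>auto simp: a2 c2\<close>, auto simp: a_def c_def w_nonneg)
  then show "(\<Sum>k. w k / sqrt (m k) * norm (P k x))\<^sup>2 \<le> s z * (\<Sum>k. cmod (1 - z / complex_of_real (m k)) * (norm (P k x))\<^sup>2)"
    by (simp only: ac a2 c2 s_def)
qed

text \<open>Lax--Milgram after rotating the diagonal part \<open>I - z J\<close> to its modulus.\<close>

lemma M_invertible:
  assumes z: "z \<notin> spec" "s z < 1" and \<tau>: "0 \<le> \<tau>" "\<tau> \<le> 1" and d: "0 < d" "\<And>k. d \<le> cmod (complex_of_real (m k) - z)"
  shows "bij (M \<tau> z)" and "(1 - s z) * (d / (d + cmod z)) * norm x \<le> norm (M \<tau> z x)"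
proof -
  define \<delta> where "\<delta> k = 1 - z / complex_of_real (m k)" for k
  \<comment> \<open>The phases of the eigenvalues of \<open>I - z J\<close>. The unitary
    \<open>W\<close> built from them has adjoint \<open>W'\<close>, and \<open>W'\<close> turns this
    diagonal operator into its modulus, whose quadratic form is \<open>q\<close> below.\<close>
  define u where "u k = sgn (\<delta> k)" for k
  have \<delta>0: "\<delta> k \<noteq> 0" for k
  proof -
    have "complex_of_real (m k) \<noteq> z" using z by (auto simp: spec_def)
    then show ?thesis using m_pos[of k] by (simp add: \<delta>_def field_simps)
  qed
  have u1: "cmod (u k) = 1" for k using \<delta>0 by (simp add: u_def norm_sgn)
  have u: "cmod (u k) \<le> 1" "cmod (cnj (u k)) \<le> 1" "cmod (u k * cnj (u k)) \<le> 1" for k by (simp_all add: u1 norm_mult)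
  define W where "W = diag u"
  define W' where "W' = diag (\<lambda>k. cnj (u k))"
  have PW: "P k (W x) = u k *\<^sub>C P k x" for k x unfolding W_def by (rule P_diag[OF u(1)])
  have W': "cinner (W' x) y = cinner x (W y)" for x y
    unfolding W_def W'_def using cinner_diag[of "\<lambda>k. cnj (u k)" 1 x y] u by simp
  have WW': "W (W' x) = x" for x
    unfolding W_def W'_def
    by (subst diag_diag[of _ 1 _ 1 1]) (auto simp: u u1 diag_one complex_norm_square[symmetric])
  have bcW': "bounded_clinear W'" unfolding W'_def by (rule bounded_clinear_diag[OF u(2)])
  have normW': "norm (W' x) \<le> norm x" for x unfolding W'_def using norm_diag_le[of "\<lambda>k. cnj (u k)" 1 x] u by simp
  have s0: "0 \<le> s z" unfolding s_def by (intro suminf_nonneg s_summable z) auto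
  define e where "e = d / (d + cmod z)"
  have e: "0 < e" using d by (simp add: e_def add_pos_nonneg)
  define c where "c = (1 - s z) * e"
  have c: "0 < c" using z e by (simp add: c_def)
  have coercive: "c * (norm x)\<^sup>2 \<le> cmod (cinner (W' (M \<tau> z x)) x)" for x
  proof -
    define q where "q = (\<Sum>k. cmod (\<delta> k) * (norm (P k x))\<^sup>2)"
    have smq: "summable (\<lambda>k. cmod (\<delta> k) * (norm (P k x))\<^sup>2)"
      unfolding \<delta>_def by (rule weighted_sum_bound(2)[OF z(1)])
    have PD: "P k (x - z *\<^sub>C J x) = \<delta> k *\<^sub>C P k x" for k
      by (simp add: lin_P P_J \<delta>_def scaleC_diff_left scaleC_scaleC divide_inverse)
    have "(\<lambda>k. cinner (P k (x - z *\<^sub>C J x)) (P k (W x))) sums cinner (x - z *\<^sub>C J x) (W x)" by (rule cinner_sums)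
    moreover have "cinner (P k (x - z *\<^sub>C J x)) (P k (W x)) = complex_of_real (cmod (\<delta> k) * (norm (P k x))\<^sup>2)" for k
    proof -
      have "\<delta> k * cnj (u k) = complex_of_real (cmod (\<delta> k))"
      proof -
        have "\<delta> k = complex_of_real (cmod (\<delta> k)) * u k" by (simp add: u_def sgn_div_norm scaleR_conv_of_real \<delta>0)
        then have "\<delta> k * cnj (u k) = complex_of_real (cmod (\<delta> k)) * (u k * cnj (u k))" by (metis mult.assoc)
        then show ?thesis by (simp add: complex_norm_square[symmetric] u1)
      qed
      then show ?thesis unfolding PD PW cinner_scaleC_left cinner_scaleC_right cinner_self
        by (simp only: mult.assoc[symmetric] of_real_mult mult.commute[of "cnj (u k)"])
    qed
    moreover have "(\<lambda>k. complex_of_real (cmod (\<delta> k) * (norm (P k x))\<^sup>2)) sums complex_of_real q"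
      unfolding q_def by (intro sums_of_real summable_sums smq)
    ultimately have Dq: "cinner (x - z *\<^sub>C J x) (W x) = complex_of_real q" using sums_unique2 by simp
    \<comment> \<open>\<open>W\<close> preserves the norm of every component \<open>P k x\<close>,
      so both factors of the bound coincide and their product is at most \<open>s z * q\<close>. The
      part \<open>(1 - s z) * q\<close> of the form thus survives the perturbation.\<close>
    have "cmod (cinner (V x) (W x)) \<le> (\<Sum>k. w k / sqrt (m k) * norm (P k x)) * (\<Sum>k. w k / sqrt (m k) * norm (P k (W x)))"
      by (rule V_bound)
    also have "\<dots> = (\<Sum>k. w k / sqrt (m k) * norm (P k x))\<^sup>2" by (simp add: PW u1 power2_eq_square)
    also have "\<dots> \<le> s z * q" unfolding q_def \<delta>_def by (rule weighted_sum_bound(1)[OF z(1)])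
    finally have Vq: "cmod (cinner (V x) (W x)) \<le> s z * q" .
    have q0: "0 \<le> q" unfolding q_def by (intro suminf_nonneg smq) auto
    have "cinner (W' (M \<tau> z x)) x = complex_of_real q + complex_of_real \<tau> * cinner (V x) (W x)"
      unfolding W' M_def Dq[symmetric] by (simp add: cinner_simps)
    moreover have "cmod (complex_of_real \<tau> * cinner (V x) (W x)) \<le> s z * q"
      using Vq \<tau> mult_mono[of \<tau> 1 "cmod (cinner (V x) (W x))" "s z * q"] by (simp add: norm_mult)
    ultimately have "q - s z * q \<le> cmod (cinner (W' (M \<tau> z x)) x)"
      using norm_diff_ineq[of "complex_of_real q" "complex_of_real \<tau> * cinner (V x) (W x)"] q0 by simp
    moreover have "e * (norm x)\<^sup>2 \<le> q"
    proof -
      have "e * (norm x)\<^sup>2 = (\<Sum>k. e * (norm (P k x))\<^sup>2)"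
        using suminf_mult[OF summable_norm_P, of e x] sums_unique[OF norm_sums[of x]] by simp
      also have "\<dots> \<le> q"
        unfolding q_def
        by (rule suminf_le[OF _ summable_mult[OF summable_norm_P] smq])
           (unfold \<delta>_def e_def, intro mult_right_mono ratio_bound d zero_le_power2)
      finally show ?thesis .
    qed
    then have "(1 - s z) * (e * (norm x)\<^sup>2) \<le> (1 - s z) * q" using z(2) by (intro mult_left_mono) auto
    ultimately show ?thesis by (simp add: c_def algebra_simps)
  qed
  have bcN: "bounded_clinear (\<lambda>x. W' (M \<tau> z x))" by (rule bounded_clinear_compose[OF bcW' bounded_clinear_M])
  note LM = Lax_Milgram[OF bcN c coercive]
  show lower: "(1 - s z) * (d / (d + cmod z)) * norm x \<le> norm (M \<tau> z x)" for x
    using LM(2)[of x] normW'[of "M \<tau> z x"] unfolding c_def e_def by linarith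
  have "inj (M \<tau> z)"
    using bij_is_inj[OF LM(1)] by (metis (no_types, lifting) inj_def)
  \<comment> \<open>The rotated operator is onto, and \<open>W\<close> undoes the rotation.\<close>
  moreover have "surj (M \<tau> z)"
  proof (rule surjI[of _ "\<lambda>y. inv (\<lambda>x. W' (M \<tau> z x)) (W' y)"])
    fix y
    have "W' (M \<tau> z (inv (\<lambda>x. W' (M \<tau> z x)) (W' y))) = W' y"
      using surj_f_inv_f[OF bij_is_surj[OF LM(1)], of "W' y"] .
    then show "M \<tau> z (inv (\<lambda>x. W' (M \<tau> z x)) (W' y)) = y" using WW' by metis
  qed
  ultimately show "bij (M \<tau> z)" by (simp add: bij_def)
qed

end

context form_perturbation
begin

section \<open>The families \<open>R \<tau>\<close>, their contour integrals and ranks\<close>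

lemma U_memD:
  assumes "z \<in> U" shows "z \<notin> spec" "s z < 1"
  using assms by (auto simp: U_def)

lemma M_inv:
  assumes z: "z \<in> U" and \<tau>: "0 \<le> \<tau>" "\<tau> \<le> 1"
  shows "bounded_clinear (inv (M \<tau> z))" "M \<tau> z (inv (M \<tau> z) x) = x" "inv (M \<tau> z) (M \<tau> z x) = x"
proof -
  obtain d where d: "0 < d" "\<And>k. d \<le> cmod (complex_of_real (m k) - z)" using spec_distance[OF U_memD(1)[OF z]] by blast
  note Mi = M_invertible[OF U_memD[OF z] \<tau> d]
  have "0 < (1 - s z) * (d / (d + cmod z))" using d U_memD(2)[OF z] by (simp add: add_pos_nonneg)
  then show "bounded_clinear (inv (M \<tau> z))" by (rule bounded_clinear_inv[OF bounded_clinear_M Mi(1) _ Mi(2)])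
  show "M \<tau> z (inv (M \<tau> z) x) = x" "inv (M \<tau> z) (M \<tau> z x) = x"
    using Mi(1) by (simp_all add: bij_is_surj surj_f_inv_f bij_is_inj inv_f_f)
qed

text \<open>\<open>M \<tau> z\<close> and \<open>M \<tau> w'\<close> differ by a multiple of
  \<open>J\<close>, and \<open>J\<close> splits as \<open>C\<close> after \<open>C\<close>: one
  factor completes the left resolvent, the other one the right.\<close>

lemma pseudo_resolvent_R:
  assumes \<tau>: "0 \<le> \<tau>" "\<tau> \<le> 1"
  shows "pseudo_resolvent U (R \<tau>)"
proof
  show "open U" by (rule open_U)
  show "bounded_clinear (R \<tau> z)" if "z \<in> U" for z
    unfolding R_def by (intro bounded_clinear_minus bounded_clinear_compose[OF bounded_clinear_C] bounded_clinear_compose[OF M_inv(1)[OF that \<tau>]] bounded_clinear_C)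
  fix z w' x assume z: "z \<in> U" and w': "w' \<in> U"
  note lin = bounded_clinearD[OF bounded_clinear_C] and lini = bounded_clinearD[OF M_inv(1)[OF z \<tau>]]
  define y where "y = inv (M \<tau> w') (C x)"
  have "M \<tau> z y = M \<tau> w' y + (w' - z) *\<^sub>C J y" by (simp add: M_def scaleC_diff_left)
  also have "M \<tau> w' y = C x" unfolding y_def by (rule M_inv(2)[OF w' \<tau>])
  finally have "y = inv (M \<tau> z) (C x + (w' - z) *\<^sub>C J y)" using M_inv(3)[OF z \<tau>, of y] by simp
  then have y: "y = inv (M \<tau> z) (C x) + (w' - z) *\<^sub>C inv (M \<tau> z) (J y)" by (simp only: lini(2,3))
  have "R \<tau> w' x = - C y" by (simp add: R_def y_def)
  also have "\<dots> = - C (inv (M \<tau> z) (C x) + (w' - z) *\<^sub>C inv (M \<tau> z) (J y))" using y by simp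
  also have "\<dots> = R \<tau> z x - (w' - z) *\<^sub>C C (inv (M \<tau> z) (J y))" by (simp add: R_def lin(2,3))
  finally have "R \<tau> z x - R \<tau> w' x = (w' - z) *\<^sub>C C (inv (M \<tau> z) (J y))" by simp
  also have "C (inv (M \<tau> z) (J y)) = R \<tau> z (R \<tau> w' x)"
    unfolding R_def y_def[symmetric] by (simp add: C_C lin(6) lini(6))
  finally show "R \<tau> z x - R \<tau> w' x = (w' - z) *\<^sub>C R \<tau> z (R \<tau> w' x)" .
qed

lemma closed_spec: "closed spec"
proof -
  have "open (- spec)"
    unfolding open_contains_ball
  proof
    fix z assume "z \<in> - spec"
    then obtain d where d: "0 < d" "\<And>k. d \<le> cmod (complex_of_real (m k) - z)" using spec_distance by blast
    have "ball z d \<subseteq> - spec"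
    proof
      fix y assume y: "y \<in> ball z d"
      show "y \<in> - spec"
      proof
        assume "y \<in> spec"
        then obtain k where "y = complex_of_real (m k)" by (auto simp: spec_def)
        then show False using y d(2)[of k] by (simp add: dist_norm norm_minus_commute)
      qed
    qed
    then show "\<exists>e>0. ball z e \<subseteq> - spec" using d(1) by blast
  qed
  then show ?thesis by (simp add: closed_def)
qed

context
  fixes \<gamma> K
  assumes \<gamma>: "contour \<gamma> K" "path_image \<gamma> \<inter> spec = {}" and half: "\<And>z. z \<in> path_image \<gamma> \<Longrightarrow> s z \<le> 1 / 2"
begin

lemma path_U: "path_image \<gamma> \<subseteq> U"
  using \<gamma>(2) half by (force simp: U_def)

text \<open>Compactness of the contour makes its distance \<open>d\<close> to the eigenvalues and
  its bound \<open>B\<close> uniform, and \<open>half\<close> keeps \<open>1 - s z\<close> at or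
  above 1/2.\<close>

lemma M_lower_uniform:
  obtains c where "0 < c" "\<And>\<tau> z x. 0 \<le> \<tau> \<Longrightarrow> \<tau> \<le> 1 \<Longrightarrow> z \<in> path_image \<gamma> \<Longrightarrow> c * norm x \<le> norm (M \<tau> z x)"
proof -
  have cp: "compact (path_image \<gamma>)" using contourD(1)[OF \<gamma>(1)] by (intro compact_path_image valid_path_imp_path)
  obtain d where d: "d > 0" "\<And>z y. z \<in> path_image \<gamma> \<Longrightarrow> y \<in> spec \<Longrightarrow> d \<le> dist z y"
    using separate_compact_closed[OF cp closed_spec \<gamma>(2)] by blast
  obtain B where B: "B > 0" "\<And>z. z \<in> path_image \<gamma> \<Longrightarrow> norm z \<le> B"
    using compact_imp_bounded[OF cp] unfolding bounded_pos by blast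
  define c where "c = (1 / 2) * (d / (d + B))"
  have "0 < c" using d B by (simp add: c_def)
  moreover have "c * norm x \<le> norm (M \<tau> z x)" if "0 \<le> \<tau>" "\<tau> \<le> 1" "z \<in> path_image \<gamma>" for \<tau> z x
  proof -
    have z: "z \<notin> spec" "s z < 1" using path_U that U_memD by auto
    have d': "d \<le> cmod (complex_of_real (m k) - z)" for k
      using d(2)[OF that(3), of "complex_of_real (m k)"] by (simp add: spec_def dist_norm norm_minus_commute)
    have pos: "0 < d + B" "0 < d + cmod z" using d(1) B(1) by (simp_all add: add_pos_nonneg)
    have "d / (d + B) \<le> d / (d + cmod z)"
      by (intro divide_left_mono mult_pos_pos pos) (use B(2)[OF that(3)] d(1) in auto)
    moreover have "0 \<le> d / (d + B)" "1 / 2 \<le> 1 - s z" using pos d(1) half[OF that(3)] by auto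
    ultimately have "c \<le> (1 - s z) * (d / (d + cmod z))"
      unfolding c_def by (intro mult_mono) auto
    then have "c * norm x \<le> (1 - s z) * (d / (d + cmod z)) * norm x" by (rule mult_right_mono) simp
    also have "\<dots> \<le> norm (M \<tau> z x)" by (rule M_invertible(2)[OF z that(1,2) d(1) d'])
    finally show ?thesis .
  qed
  ultimately show ?thesis using that by blast
qed

lemma opcont_R:
  assumes "0 \<le> \<tau>" "\<tau> \<le> 1" shows "opcont_on (path_image \<gamma>) (R \<tau>)"
  by (rule opcont_on_subset[OF pseudo_resolvent.opcont[OF pseudo_resolvent_R[OF assms]] path_U])

text \<open>The inverses of \<open>M\<close> at \<tau> and \<tau>' differ by the product of both
  inverses with \<open>(\<tau>' - \<tau>) V\<close> in between. \<open>Q\<close> collects the norms: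
  two factors \<open>C\<close>, one \<open>V\<close>, and two inverses bounded by
  \<open>1 / c\<close>.\<close>

lemma cintegral_R_Lipschitz:
  obtains L where "0 \<le> L"
    "\<And>\<tau> \<tau>' x. \<lbrakk>0 \<le> \<tau>; \<tau> \<le> 1; 0 \<le> \<tau>'; \<tau>' \<le> 1\<rbrakk> \<Longrightarrow> norm (cintegral (R \<tau>) \<gamma> x - cintegral (R \<tau>') \<gamma> x) \<le> (L * \<bar>\<tau> - \<tau>'\<bar>) * norm x"
proof -
  obtain c where c: "0 < c" "\<And>\<tau> z x. 0 \<le> \<tau> \<Longrightarrow> \<tau> \<le> 1 \<Longrightarrow> z \<in> path_image \<gamma> \<Longrightarrow> c * norm x \<le> norm (M \<tau> z x)"
    using M_lower_uniform by blast
  obtain L where L0: "0 \<le> L" and L: "\<forall>(R :: complex \<Rightarrow> 'a \<Rightarrow> 'a) R' k x.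
    opcont_on (path_image \<gamma>) R \<longrightarrow> opcont_on (path_image \<gamma>) R' \<longrightarrow> 0 \<le> k \<longrightarrow>
    (\<forall>z\<in>path_image \<gamma>. norm (R z x - R' z x) \<le> k) \<longrightarrow> norm (cintegral R \<gamma> x - cintegral R' \<gamma> x) \<le> L * k"
    using cintegral_Lipschitz[OF \<gamma>(1)] by blast
  define v where "v = onorm V"
  define k where "k = onorm C"
  note Vl = bounded_clinearD[OF bounded_clinear_V] and Cl = bounded_clinearD[OF bounded_clinear_C]
  have v: "0 \<le> v" "norm (V x) \<le> v * norm x" for x using onorm_pos_le[OF Vl(1)] Vl(7) by (auto simp: v_def)
  have k: "0 \<le> k" "norm (C x) \<le> k * norm x" for x using onorm_pos_le[OF Cl(1)] Cl(7) by (auto simp: k_def)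
  define Q where "Q = k * (v * (k / c) / c)"
  have Q: "0 \<le> Q" using v k c by (simp add: Q_def)
  have "norm (R \<tau> z x - R \<tau>' z x) \<le> Q * \<bar>\<tau> - \<tau>'\<bar> * norm x"
    if \<tau>: "0 \<le> \<tau>" "\<tau> \<le> 1" and \<tau>': "0 \<le> \<tau>'" "\<tau>' \<le> 1" and z: "z \<in> path_image \<gamma>" for \<tau> \<tau>' z x
  proof -
    have zU: "z \<in> U" using path_U z by blast
    note Ml = bounded_clinearD[OF bounded_clinear_M, of \<tau> z]
    define y where "y = inv (M \<tau> z) (C x)"
    define y' where "y' = inv (M \<tau>' z) (C x)"
    have "c * norm y' \<le> norm (C x)" using c(2)[OF \<tau>' z, of y'] M_inv(2)[OF zU \<tau>'] by (simp add: y'_def)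
    then have y': "norm y' \<le> k / c * norm x" using k(2)[of x] c(1) by (simp add: field_simps)
    have "M \<tau> z (y - y') = M \<tau>' z y' - M \<tau> z y'"
      unfolding Ml(5) by (simp add: y_def y'_def M_inv(2)[OF zU \<tau>] M_inv(2)[OF zU \<tau>'])
    also have "\<dots> = complex_of_real (\<tau>' - \<tau>) *\<^sub>C V y'" by (simp add: M_def scaleC_diff_left)
    finally have "c * norm (y - y') \<le> \<bar>\<tau> - \<tau>'\<bar> * norm (V y')"
      using c(2)[OF \<tau> z, of "y - y'"] by (simp only: norm_scaleC norm_of_real abs_minus_commute)
    also have "\<dots> \<le> \<bar>\<tau> - \<tau>'\<bar> * (v * (k / c * norm x))"
      by (intro mult_left_mono order_trans[OF v(2)] y' v) auto
    finally have "norm (y - y') \<le> v * (k / c) / c * \<bar>\<tau> - \<tau>'\<bar> * norm x" using c(1) by (simp add: field_simps)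
    then have "k * norm (y - y') \<le> k * (v * (k / c) / c * \<bar>\<tau> - \<tau>'\<bar> * norm x)" using k by (intro mult_left_mono)
    moreover have "R \<tau> z x - R \<tau>' z x = - C (y - y')" by (simp add: R_def y_def y'_def Cl(5))
    ultimately show ?thesis using k(2)[of "y - y'"] by (simp add: Q_def mult.assoc)
  qed
  then have "norm (cintegral (R \<tau>) \<gamma> x - cintegral (R \<tau>') \<gamma> x) \<le> L * (Q * \<bar>\<tau> - \<tau>'\<bar> * norm x)"
    if \<tau>: "0 \<le> \<tau>" "\<tau> \<le> 1" and \<tau>': "0 \<le> \<tau>'" "\<tau>' \<le> 1" for \<tau> \<tau>' x
    using that Q opcont_R[OF \<tau>] opcont_R[OF \<tau>'] by (intro L[rule_format]) auto
  then show ?thesis using that[of "L * Q"] L0 Q by (simp add: mult.assoc)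
qed

text \<open>The Lipschitz constant \<open>L\<close> serves the whole interval, so after division
  into \<open>n > L\<close> equal steps neighbouring projections have distance less than 1.\<close>

lemma rank_cintegral_R_0_1: "rank_op (cintegral (R 0) \<gamma>) = rank_op (cintegral (R 1) \<gamma>)"
proof -
  obtain L where L: "0 \<le> L" "\<And>\<tau> \<tau>' x. \<lbrakk>0 \<le> \<tau>; \<tau> \<le> 1; 0 \<le> \<tau>'; \<tau>' \<le> 1\<rbrakk> \<Longrightarrow> norm (cintegral (R \<tau>) \<gamma> x - cintegral (R \<tau>') \<gamma> x) \<le> (L * \<bar>\<tau> - \<tau>'\<bar>) * norm x"
    using cintegral_R_Lipschitz by blast
  obtain n where n: "L < real n" using reals_Archimedean2 by blast
  then have n0: "0 < real n" using L(1) by linarith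
  have "rank_op (cintegral (R 0) \<gamma>) = rank_op (cintegral (R (real i / real n)) \<gamma>)" if "i \<le> n" for i
    using that
  proof (induction i)
    case (Suc i)
    have i: "0 \<le> real i / real n" "real i / real n \<le> 1" "0 \<le> real (Suc i) / real n" "real (Suc i) / real n \<le> 1"
      using Suc.prems n0 by (auto simp: divide_le_eq)
    interpret a: pseudo_resolvent U "R (real i / real n)" by (rule pseudo_resolvent_R[OF i(1,2)])
    interpret b: pseudo_resolvent U "R (real (Suc i) / real n)" by (rule pseudo_resolvent_R[OF i(3,4)])
    have "rank_op (cintegral (R (real i / real n)) \<gamma>) = rank_op (cintegral (R (real (Suc i) / real n)) \<gamma>)"
    proof (rule rank_op_eq_of_close_projections)
      show "bounded_clinear (cintegral (R (real i / real n)) \<gamma>)" "bounded_clinear (cintegral (R (real (Suc i) / real n)) \<gamma>)"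
        by (rule a.bounded_clinear_cintegral[OF \<gamma>(1) path_U] b.bounded_clinear_cintegral[OF \<gamma>(1) path_U])+
      show "L * \<bar>real i / real n - real (Suc i) / real n\<bar> < 1"
      proof -
        have "\<bar>real i / real n - real (Suc i) / real n\<bar> = 1 / real n" using n0 by (simp add: diff_divide_distrib[symmetric])
        then show ?thesis using n n0 by (simp add: divide_less_eq)
      qed
    qed (rule a.cintegral_idem[OF \<gamma>(1) path_U] b.cintegral_idem[OF \<gamma>(1) path_U] L(2)[OF i])+
    then show ?case using Suc by simp
  qed simp
  from this[of n] show ?thesis using n0 by simp
qed

text \<open>On the range of \<open>P k\<close> the factors \<open>C\<close>, inverse of
  \<open>M\<close>, \<open>C\<close> are the scalars \<open>1 / sqrt (m k)\<close>,
  \<open>m k / (m k - z)\<close> and \<open>1 / sqrt (m k)\<close>.\<close>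

lemma R_0_P:
  assumes "z \<in> U" shows "R 0 z (P k x) = (1 / (z - complex_of_real (m k))) *\<^sub>C P k x"
proof -
  have ne: "z \<noteq> complex_of_real (m k)" using U_memD(1)[OF assms] by (auto simp: spec_def)
  have CP: "C (P k x) = complex_of_real (1 / sqrt (m k)) *\<^sub>C P k x"
  proof (rule P_ext)
    fix j show "P j (C (P k x)) = P j (complex_of_real (1 / sqrt (m k)) *\<^sub>C P k x)"
      by (cases "j = k") (simp_all add: P_C lin_P idem_P orth_P)
  qed
  have JP: "J (P k x) = complex_of_real (1 / m k) *\<^sub>C P k x"
  proof (rule P_ext)
    fix j show "P j (J (P k x)) = P j (complex_of_real (1 / m k) *\<^sub>C P k x)"
      by (cases "j = k") (simp_all add: P_J lin_P idem_P orth_P)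
  qed
  note lini = bounded_clinearD[OF M_inv(1)[OF assms, of 0], simplified]
  have "M 0 z (P k x) = (1 - z * complex_of_real (1 / m k)) *\<^sub>C P k x"
    by (simp add: M_def JP scaleC_scaleC scaleC_diff_left)
  then have "inv (M 0 z) ((1 - z * complex_of_real (1 / m k)) *\<^sub>C P k x) = P k x"
    using M_inv(3)[OF assms, of 0 "P k x"] by simp
  then have eq: "(1 - z * complex_of_real (1 / m k)) *\<^sub>C inv (M 0 z) (P k x) = P k x" by (simp only: lini(3))
  have fac: "1 - z * complex_of_real (1 / m k) = (complex_of_real (m k) - z) / complex_of_real (m k)"
    using m_pos[of k] by (simp add: diff_divide_distrib)
  have "inv (M 0 z) (P k x) = (complex_of_real (m k) / (complex_of_real (m k) - z)) *\<^sub>C P k x"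
  proof -
    have "(complex_of_real (m k) / (complex_of_real (m k) - z)) *\<^sub>C ((1 - z * complex_of_real (1 / m k)) *\<^sub>C inv (M 0 z) (P k x)) = inv (M 0 z) (P k x)"
      unfolding scaleC_scaleC fac using ne m_pos[of k] by simp
    then show ?thesis by (simp only: eq)
  qed
  then have "R 0 z (P k x) = - ((complex_of_real (1 / sqrt (m k)) * (complex_of_real (m k) / (complex_of_real (m k) - z)) * complex_of_real (1 / sqrt (m k))) *\<^sub>C P k x)"
    unfolding R_def by (simp only: CP lini(3) bounded_clinearD(3)[OF bounded_clinear_C] scaleC_scaleC)
  also have "complex_of_real (1 / sqrt (m k)) * (complex_of_real (m k) / (complex_of_real (m k) - z)) * complex_of_real (1 / sqrt (m k)) = 1 / (complex_of_real (m k) - z)"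
  proof -
    have "complex_of_real (1 / sqrt (m k)) * complex_of_real (1 / sqrt (m k)) * complex_of_real (m k) = complex_of_real 1"
      unfolding of_real_mult[symmetric] using m_pos[of k] by simp
    then show ?thesis by (simp add: mult_ac)
  qed
  also have "- ((1 / (complex_of_real (m k) - z)) *\<^sub>C P k x) = (1 / (z - complex_of_real (m k))) *\<^sub>C P k x"
    using ne by (simp add: scaleC_minus_left[symmetric] minus_divide_right del: minus_divide_left)
  finally show ?thesis .
qed

text \<open>On the range of a single \<open>P k\<close> the contour integral is a winding number
  about \<open>m k\<close>; boundedness of the integral extends this along the series for
  \<open>x\<close>.\<close>

lemma cintegral_R_0: "cintegral (R 0) \<gamma> x = (\<Sum>k | complex_of_real (m k) \<in> interior K. P k x)"
proof -
  interpret a: pseudo_resolvent U "R 0" by (rule pseudo_resolvent_R) auto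
  define I where "I = {k. complex_of_real (m k) \<in> interior K}"
  have "bounded (interior K)" using contourD(5)[OF \<gamma>(1)] compact_imp_bounded bounded_interior by blast
  then obtain B where B: "\<And>z. z \<in> interior K \<Longrightarrow> norm z \<le> B" unfolding bounded_iff by blast
  obtain N where N: "\<And>k. k \<ge> N \<Longrightarrow> B + 1 \<le> m k" using m_top unfolding filterlim_at_top eventually_sequentially by meson
  \<comment> \<open>Finiteness matters: a sum over an infinite index set would be 0 by
    convention.\<close>
  have "I \<subseteq> {..<N}"
  proof
    fix k assume "k \<in> I"
    then have "m k \<le> B" using B[of "complex_of_real (m k)"] m_pos[of k] by (simp add: I_def)
    then show "k \<in> {..<N}" using N[of k] by (cases "k < N") auto
  qed
  then have fin: "finite I" by (rule finite_subset) simp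
  have on_P: "cintegral (R 0) \<gamma> (P k x) = (if k \<in> I then P k x else 0)" for k
  proof (rule cinner_ext)
    fix y
    have mk: "complex_of_real (m k) \<notin> path_image \<gamma>" using \<gamma>(2) by (auto simp: spec_def)
    have w: "winding_number \<gamma> (complex_of_real (m k)) = (if k \<in> I then 1 else 0)"
      using contourD(3,7,8)[OF \<gamma>(1)] mk by (auto simp: I_def)
    obtain ps where ps: "smooth_pieces \<gamma> ps" using contourD(9)[OF \<gamma>(1)] by blast
    have "contour_integral \<gamma> (\<lambda>z. cinner (R 0 z (P k x)) y) = contour_integral \<gamma> (\<lambda>z. cinner (P k x) y * (1 / (z - complex_of_real (m k))))"
      by (rule contour_integral_cong[OF refl]) (use path_U in \<open>auto simp: R_0_P subset_iff cinner_scaleC_left\<close>)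
    also have "\<dots> = cinner (P k x) y * contour_integral \<gamma> (\<lambda>z. 1 / (z - complex_of_real (m k)))"
    proof (rule contour_integral_lmul)
      have "continuous_on (path_image \<gamma>) (\<lambda>z. 1 / (z - complex_of_real (m k)))"
        by (intro continuous_intros) (use mk in auto)
      then show "(\<lambda>z. 1 / (z - complex_of_real (m k))) contour_integrable_on \<gamma>" using ps by (simp add: smooth_pieces_def)
    qed
    finally have "(2 * complex_of_real pi * \<i>) * cinner (cintegral (R 0) \<gamma> (P k x)) y =
        (2 * complex_of_real pi * \<i>) * (cinner (P k x) y * winding_number \<gamma> (complex_of_real (m k)))"
      using winding_number_valid_path[OF contourD(1)[OF \<gamma>(1)] mk] by (simp add: a.cinner_cintegral'[OF \<gamma>(1) path_U])
    then show "cinner (cintegral (R 0) \<gamma> (P k x)) y = cinner (if k \<in> I then P k x else 0) y"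
      unfolding w by simp
  qed
  have "(\<lambda>k. cintegral (R 0) \<gamma> (P k x)) sums cintegral (R 0) \<gamma> x"
    by (rule bounded_linear.sums[OF bounded_clinearD(1)[OF a.bounded_clinear_cintegral[OF \<gamma>(1) path_U]] sums_P])
  then have "(\<lambda>k. if k \<in> I then P k x else 0) sums cintegral (R 0) \<gamma> x" by (simp only: on_P)
  moreover have "(\<lambda>k. if k \<in> I then P k x else 0) sums (\<Sum>k\<in>I. P k x)"
    by (rule sums_If_finite_set[OF fin])
  ultimately show ?thesis unfolding I_def by (rule sums_unique2)
qed

theorem rank_cintegral_R:
  "rank_op (cintegral (R 1) \<gamma>) = rank_op (\<lambda>x. \<Sum>k | complex_of_real (m k) \<in> interior K. P k x)"
proof -
  have "cintegral (R 0) \<gamma> = (\<lambda>x. \<Sum>k | complex_of_real (m k) \<in> interior K. P k x)"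
    by (rule ext) (rule cintegral_R_0)
  then show ?thesis using rank_cintegral_R_0_1 by simp
qed

end

end

section \<open>Sectorial forms\<close>

lemma sesquilinear_onD:
  assumes "sesquilinear_on D t"
  shows "csubspace D" "\<lbrakk>f \<in> D; g \<in> D; h \<in> D\<rbrakk> \<Longrightarrow> t (f + g) h = t f h + t g h"
    "\<lbrakk>f \<in> D; g \<in> D; h \<in> D\<rbrakk> \<Longrightarrow> t h (f + g) = t h f + t h g"
    "\<lbrakk>f \<in> D; g \<in> D\<rbrakk> \<Longrightarrow> t (c *\<^sub>C f) g = c * t f g" "\<lbrakk>f \<in> D; g \<in> D\<rbrakk> \<Longrightarrow> t f (c *\<^sub>C g) = cnj c * t f g"
  using assms unfolding sesquilinear_on_def by blast+

lemma sesquilinear_on_diff: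
  assumes t: "sesquilinear_on D t" and "f \<in> D" "g \<in> D" "h \<in> D"
  shows "t (f - g) h = t f h - t g h" "t h (f - g) = t h f - t h g"
proof -
  note S = sesquilinear_onD[OF t]
  have "(- 1) *\<^sub>C g \<in> D" using csubspaceD(3)[OF S(1) \<open>g \<in> D\<close>] .
  moreover have "f - g = f + (- 1) *\<^sub>C g" by (simp add: scaleC_minus_one)
  ultimately show "t (f - g) h = t f h - t g h" "t h (f - g) = t h f - t h g"
    using assms S(2)[of f "(- 1) *\<^sub>C g" h] S(3)[of f "(- 1) *\<^sub>C g" h] S(4)[of g h "- 1"] S(5)[of h g "- 1"] by simp_all
qed

lemma sesquilinear_on_sum:
  assumes t: "sesquilinear_on D t" and F: "\<And>i. i \<in> I \<Longrightarrow> F i \<in> D" and "h \<in> D" and "finite I"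
  shows "t (sum F I) h = (\<Sum>i\<in>I. t (F i) h)" "t h (sum F I) = (\<Sum>i\<in>I. t h (F i))"
proof -
  note S = sesquilinear_onD[OF t]
  have "t (sum F I) h = (\<Sum>i\<in>I. t (F i) h) \<and> t h (sum F I) = (\<Sum>i\<in>I. t h (F i))"
    using \<open>finite I\<close> F
  proof (induction I rule: finite_induct)
    case empty
    have "t 0 h = 0" "t h 0 = 0" using sesquilinear_on_diff[OF t \<open>h \<in> D\<close> \<open>h \<in> D\<close> \<open>h \<in> D\<close>] by simp_all
    then show ?case by simp
  next
    case (insert i I)
    moreover have "sum F I \<in> D" using insert by (intro csubspace_sum[OF S(1)]) auto
    ultimately show ?case using S(2)[of "F i" "sum F I" h] S(3)[of "F i" "sum F I" h] \<open>h \<in> D\<close> by simp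
  qed
  then show "t (sum F I) h = (\<Sum>i\<in>I. t (F i) h)" "t h (sum F I) = (\<Sum>i\<in>I. t h (F i))" by auto
qed

lemma sector_bound:
  assumes "z \<in> sector \<gamma> \<theta>" "0 \<le> \<theta>" "\<theta> < pi / 2"
  shows "cmod (z - complex_of_real \<gamma>) * cos \<theta> \<le> Re z - \<gamma>"
proof -
  let ?\<zeta> = "z - complex_of_real \<gamma>"
  have "cos \<theta> \<le> cos \<bar>Arg ?\<zeta>\<bar>"
    using assms by (intro cos_monotone_0_pi_le) (auto simp: sector_def)
  then have "cmod ?\<zeta> * cos \<theta> \<le> cmod ?\<zeta> * cos (Arg ?\<zeta>)" by (intro mult_left_mono) auto
  also have "\<dots> = Re (rcis (cmod ?\<zeta>) (Arg ?\<zeta>))" by simp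
  also have "\<dots> = Re z - \<gamma>" by (simp only: rcis_cmod_Arg) simp
  finally show ?thesis .
qed

lemma sectorial_form_bound:
  fixes t :: "'a::complex_inner \<Rightarrow> 'a \<Rightarrow> complex"
  assumes "sectorial_form D t"
  shows "\<exists>\<gamma> c. 0 \<le> c \<and> (\<forall>f\<in>D. cmod (t f f - complex_of_real (\<gamma> * (norm f)\<^sup>2)) \<le> c * (Re (t f f) - \<gamma> * (norm f)\<^sup>2)
    \<and> \<gamma> * (norm f)\<^sup>2 \<le> Re (t f f))"
proof -
  from assms obtain \<gamma> \<theta> where t: "sesquilinear_on D t" and \<theta>: "0 \<le> \<theta>" "\<theta> < pi / 2"
    and sec: "\<And>f. f \<in> D \<Longrightarrow> norm f = 1 \<Longrightarrow> t f f \<in> sector \<gamma> \<theta>"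
    by (auto simp: sectorial_form_def)
  note S = sesquilinear_onD[OF t]
  have cos: "0 < cos \<theta>" using \<theta> by (intro cos_gt_zero_pi) auto
  have main: "cmod (t f f - complex_of_real (\<gamma> * (norm f)\<^sup>2)) * cos \<theta> \<le> Re (t f f) - \<gamma> * (norm f)\<^sup>2" if f: "f \<in> D" for f
  proof (cases "f = 0")
    case True
    have "t f f = 0" using sesquilinear_on_diff(1)[OF t f f f] True by simp
    then show ?thesis using True by simp
  next
    case False
    define n where "n = norm f"
    have n: "0 < n" using False by (simp add: n_def)
    define g where "g = complex_of_real (1 / n) *\<^sub>C f"
    have g: "g \<in> D" "norm g = 1" using csubspaceD(3)[OF S(1) f] n by (simp_all add: g_def norm_divide n_def)
    have "f = complex_of_real n *\<^sub>C g" using n by (simp add: g_def scaleC_scaleC)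
    then have tf: "t f f = complex_of_real (n\<^sup>2) * t g g"
      using S(4)[OF g(1), of "complex_of_real n *\<^sub>C g" "complex_of_real n"] S(5)[OF g(1) g(1), of "complex_of_real n"] csubspaceD(3)[OF S(1) g(1)]
      by (simp add: power2_eq_square)
    have eq1: "t f f - complex_of_real (\<gamma> * n\<^sup>2) = complex_of_real (n\<^sup>2) * (t g g - complex_of_real \<gamma>)"
      unfolding tf by (simp add: algebra_simps)
    have eq2: "Re (t f f) - \<gamma> * n\<^sup>2 = n\<^sup>2 * (Re (t g g) - \<gamma>)"
      unfolding tf by (simp add: algebra_simps del: of_real_power)
    have "n\<^sup>2 * (cmod (t g g - complex_of_real \<gamma>) * cos \<theta>) \<le> n\<^sup>2 * (Re (t g g) - \<gamma>)"
      using sector_bound[OF sec[OF g] \<theta>] by (intro mult_left_mono) auto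
    then show ?thesis unfolding n_def[symmetric] eq1 eq2 norm_mult by (simp add: norm_power mult.assoc)
  qed
  show ?thesis
  \<comment> \<open>A sector of half-angle \<theta> is the region where the modulus is at most
    \<open>1 / cos \<theta>\<close> times the real part, both taken relative to the vertex.\<close>
  proof (rule exI[of _ \<gamma>], rule exI[of _ "1 / cos \<theta>"], intro conjI ballI)
    fix f assume "f \<in> D"
    then show "cmod (t f f - complex_of_real (\<gamma> * (norm f)\<^sup>2)) \<le> 1 / cos \<theta> * (Re (t f f) - \<gamma> * (norm f)\<^sup>2)"
      using main[of f] cos by (simp add: pos_le_divide_eq)
    have "0 \<le> cmod (t f f - complex_of_real (\<gamma> * (norm f)\<^sup>2)) * cos \<theta>" using cos by simp
    then show "\<gamma> * (norm f)\<^sup>2 \<le> Re (t f f)" using main[OF \<open>f \<in> D\<close>] by linarith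
  qed (use cos in simp)
qed

text \<open>Polarisation controls \<open>q\<close> by its diagonal; applied to \<open>r f\<close>
  and \<open>g / r\<close> with \<open>r * r = l\<close>, it leaves a free weight \<open>l\<close>.
  This weighted bound stands in for a Cauchy-Schwarz inequality, as \<open>q\<close> need not be
  symmetric.\<close>

lemma polarization_bound:
  fixes q :: "'a::complex_inner \<Rightarrow> 'a \<Rightarrow> complex"
  assumes q: "sesquilinear_on D q" and c: "0 \<le> c" and bound: "\<And>f. f \<in> D \<Longrightarrow> cmod (q f f) \<le> c * Re (q f f)"
    and f: "f \<in> D" and g: "g \<in> D" and l: "0 < l"
  shows "cmod (q f g) \<le> c * (l * Re (q f f) + Re (q g g) / l)"
proof -
  note S = sesquilinear_onD[OF q]
  note sub = csubspaceD[OF S(1)]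
  have pol: "cmod (q u v) \<le> c * (Re (q u u) + Re (q v v))" if u: "u \<in> D" and v: "v \<in> D" for u v
  proof -
    have expand: "q (u + a *\<^sub>C v) (u + a *\<^sub>C v) = q u u + cnj a * q u v + a * q v u + (a * cnj a) * q v v" for a
    proof -
      have av: "a *\<^sub>C v \<in> D" "u + a *\<^sub>C v \<in> D" using sub u v by auto
      show ?thesis
        using S(2)[OF u av(1) av(2)] S(3)[OF u av(1) u] S(3)[OF u av(1) av(1)] S(4)[OF v u, of a] S(4)[OF v av(1), of a] S(5)[OF u v, of a] S(5)[OF v v, of a]
        by (simp add: algebra_simps)
    qed
    have mem: "u + a *\<^sub>C v \<in> D" for a using sub u v by auto
    have "4 * q u v = q (u + 1 *\<^sub>C v) (u + 1 *\<^sub>C v) - q (u + (- 1) *\<^sub>C v) (u + (- 1) *\<^sub>C v)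
      + \<i> * q (u + \<i> *\<^sub>C v) (u + \<i> *\<^sub>C v) - \<i> * q (u + (- \<i>) *\<^sub>C v) (u + (- \<i>) *\<^sub>C v)"
      unfolding expand by (simp add: algebra_simps)
    then have "4 * cmod (q u v) = cmod (q (u + 1 *\<^sub>C v) (u + 1 *\<^sub>C v) - q (u + (- 1) *\<^sub>C v) (u + (- 1) *\<^sub>C v)
      + \<i> * q (u + \<i> *\<^sub>C v) (u + \<i> *\<^sub>C v) - \<i> * q (u + (- \<i>) *\<^sub>C v) (u + (- \<i>) *\<^sub>C v))"
      by (metis norm_mult norm_numeral)
    also have "\<dots> \<le> cmod (q (u + 1 *\<^sub>C v) (u + 1 *\<^sub>C v)) + cmod (q (u + (- 1) *\<^sub>C v) (u + (- 1) *\<^sub>C v))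
      + cmod (q (u + \<i> *\<^sub>C v) (u + \<i> *\<^sub>C v)) + cmod (q (u + (- \<i>) *\<^sub>C v) (u + (- \<i>) *\<^sub>C v))"
      by (intro order_trans[OF norm_triangle_ineq4] order_trans[OF norm_triangle_ineq] add_mono) (auto simp: norm_mult)
    also have "\<dots> \<le> c * Re (q (u + 1 *\<^sub>C v) (u + 1 *\<^sub>C v)) + c * Re (q (u + (- 1) *\<^sub>C v) (u + (- 1) *\<^sub>C v))
      + c * Re (q (u + \<i> *\<^sub>C v) (u + \<i> *\<^sub>C v)) + c * Re (q (u + (- \<i>) *\<^sub>C v) (u + (- \<i>) *\<^sub>C v))"
      by (intro add_mono bound mem)
    also have "\<dots> = 4 * (c * (Re (q u u) + Re (q v v)))"
      unfolding expand by (simp add: algebra_simps)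
    finally show ?thesis by simp
  qed
  define r where "r = sqrt l"
  have r: "0 < r" "r * r = l" using l by (simp_all add: r_def)
  let ?u = "complex_of_real r *\<^sub>C f" and ?v = "complex_of_real (1 / r) *\<^sub>C g"
  have uv: "?u \<in> D" "?v \<in> D" using sub f g by auto
  have "q ?u ?v = q f g" using S(4)[OF f uv(2)] S(5)[OF f g] r by simp
  moreover have "q ?u ?u = complex_of_real l * q f f" using S(4)[OF f uv(1)] S(5)[OF f f] r(2)
    by (simp flip: mult.assoc of_real_mult)
  moreover have "q ?v ?v = complex_of_real (1 / l) * q g g"
  proof -
    have "complex_of_real (1 / r) * complex_of_real (1 / r) = complex_of_real (1 / l)"
      unfolding of_real_mult[symmetric] r(2)[symmetric] by simp
    then show ?thesis
      using S(4)[OF g uv(2), of "complex_of_real (1 / r)"] S(5)[OF g g, of "complex_of_real (1 / r)"]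
      by (simp only: complex_cnj_complex_of_real mult.assoc[symmetric])
  qed
  ultimately show ?thesis using pol[OF uv] by simp
qed

text \<open>After subtraction of the vertex, the real part \<open>h\<close> of the diagonal is
  nonnegative and dominates the form. Along \<open>u\<close> it tends to 0 and along
  \<open>g\<close> it stays bounded, so a large weight in \<open>polarization_bound\<close> makes
  the contribution of \<open>g\<close> small, after which a large index takes care of
  \<open>u\<close>.\<close>

lemma sectorial_form_tendsto_zero:
  fixes t :: "'a::complex_inner \<Rightarrow> 'a \<Rightarrow> complex"
  assumes sec: "sectorial_form D t" and u: "\<And>n. u n \<in> D" "u \<longlonglongrightarrow> 0" "(\<lambda>n. t (u n) (u n)) \<longlonglongrightarrow> 0"
    and g: "\<And>n. g n \<in> D" "g \<longlonglongrightarrow> g'" "(\<lambda>n. t (g n) (g n)) \<longlonglongrightarrow> b"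
  shows "(\<lambda>n. t (u n) (g n)) \<longlonglongrightarrow> 0" "(\<lambda>n. t (g n) (u n)) \<longlonglongrightarrow> 0"
proof -
  have t: "sesquilinear_on D t" using sec by (simp add: sectorial_form_def)
  note S = sesquilinear_onD[OF t]
  obtain \<gamma> c where c: "0 \<le> c" "\<And>f. f \<in> D \<Longrightarrow> cmod (t f f - complex_of_real (\<gamma> * (norm f)\<^sup>2)) \<le> c * (Re (t f f) - \<gamma> * (norm f)\<^sup>2)"
    "\<And>f. f \<in> D \<Longrightarrow> \<gamma> * (norm f)\<^sup>2 \<le> Re (t f f)" using sectorial_form_bound[OF sec] by blast
  define q where "q f g = t f g - complex_of_real \<gamma> * cinner f g" for f g
  have q: "sesquilinear_on D q"
    unfolding sesquilinear_on_def
  proof (intro conjI ballI allI)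
    show "csubspace D" by (rule S(1))
    fix f g h assume D: "f \<in> D" "g \<in> D" "h \<in> D"
    show "q (f + g) h = q f h + q g h" by (simp only: q_def S(2)[OF D] cinner_add_left) (simp add: distrib_left)
    show "q h (f + g) = q h f + q h g" by (simp only: q_def S(3)[OF D] cinner_add_right) (simp add: distrib_left)
  next
    fix c f g assume D: "f \<in> D" "g \<in> D"
    show "q (c *\<^sub>C f) g = c * q f g" by (simp only: q_def S(4)[OF D] cinner_scaleC_left) (simp add: right_diff_distrib mult.left_commute)
    show "q f (c *\<^sub>C g) = cnj c * q f g" by (simp only: q_def S(5)[OF D] cinner_scaleC_right) (simp add: right_diff_distrib mult.left_commute)
  qed
  have qb: "cmod (q f f) \<le> c * Re (q f f)" if "f \<in> D" for f
    using c(2)[OF that] by (simp add: q_def cinner_self)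
  define h where "h f = Re (q f f)" for f
  have h0: "0 \<le> h f" if "f \<in> D" for f using c(3)[OF that] by (simp add: h_def q_def cinner_self)
  have hlim: "(\<lambda>n. h (f n)) \<longlonglongrightarrow> Re (l - complex_of_real \<gamma> * cinner f' f')"
    if "f \<longlonglongrightarrow> f'" "(\<lambda>n. t (f n) (f n)) \<longlonglongrightarrow> l" for f f' l
    unfolding h_def q_def by (intro tendsto_Re tendsto_diff tendsto_mult tendsto_const tendsto_cinner that)
  have hu: "(\<lambda>n. h (u n)) \<longlonglongrightarrow> 0" using hlim[OF u(2,3)] by simp
  have "Bseq (\<lambda>n. h (g n))" using hlim[OF g(2,3)] by (intro convergent_imp_Bseq convergentI)
  then obtain B where B: "B > 0" "\<And>n. norm (h (g n)) \<le> B" unfolding Bseq_def by blast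
  have lim: "X \<longlonglongrightarrow> 0" if X: "\<And>n l. 0 < l \<Longrightarrow> cmod (X n) \<le> c * (l * h (u n) + B / l)" for X :: "nat \<Rightarrow> complex"
  proof (rule LIMSEQ_I)
    fix e :: real assume e: "0 < e"
    \<comment> \<open>Chosen to give \<open>c * (B / l) < e / 2\<close>; the 1 added to
      \<open>c\<close> covers the case \<open>c = 0\<close>.\<close>
    define l where "l = 2 * (c + 1) * B / e"
    have l: "0 < l" using c(1) B(1) e by (simp add: l_def)
    have cBl: "c * (B / l) < e / 2"
    proof -
      have "B / l = e / 2 * (1 / (c + 1))" using B(1) e c(1) by (simp add: l_def)
      then have "c * (B / l) = e / 2 * (c / (c + 1))" by simp
      also have "\<dots> < e / 2 * 1" using c(1) e by (intro mult_strict_left_mono) auto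
      finally show ?thesis by simp
    qed
    have "(\<lambda>n. c * (l * h (u n))) \<longlonglongrightarrow> c * (l * 0)" by (intro tendsto_intros hu)
    then have "(\<lambda>n. c * (l * h (u n))) \<longlonglongrightarrow> 0" by simp
    then have "\<forall>\<^sub>F n in sequentially. c * (l * h (u n)) < e / 2" using e by (intro order_tendstoD) auto
    then obtain N where N: "\<And>n. n \<ge> N \<Longrightarrow> c * (l * h (u n)) < e / 2" unfolding eventually_sequentially by blast
    have "norm (X n - 0) < e" if "n \<ge> N" for n
    proof -
      have "cmod (X n) \<le> c * (l * h (u n)) + c * (B / l)" using X[OF l, of n] by (simp only: distrib_left)
      then have "cmod (X n) < e" using N[OF that] cBl by linarith
      then show ?thesis by simp
    qed
    then show "\<exists>N. \<forall>n\<ge>N. norm (X n - 0) < e" by blast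
  qed
  have Bn: "h (g n) \<le> B" for n using B(2)[of n] by simp
  have ug: "(\<lambda>n. cinner (u n) (g n)) \<longlonglongrightarrow> 0" "(\<lambda>n. cinner (g n) (u n)) \<longlonglongrightarrow> 0"
    using tendsto_cinner[OF u(2) g(2)] tendsto_cinner[OF g(2) u(2)] by simp_all
  have "(\<lambda>n. q (u n) (g n)) \<longlonglongrightarrow> 0"
  proof (rule lim)
    fix n and l :: real assume l: "0 < l"
    have "cmod (q (u n) (g n)) \<le> c * (l * h (u n) + h (g n) / l)"
      unfolding h_def by (rule polarization_bound[OF q c(1) qb u(1) g(1) l])
    also have "\<dots> \<le> c * (l * h (u n) + B / l)"
      using l Bn[of n] c(1) by (intro mult_left_mono add_left_mono divide_right_mono) auto
    finally show "cmod (q (u n) (g n)) \<le> c * (l * h (u n) + B / l)" .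
  qed
  then have "(\<lambda>n. q (u n) (g n) + complex_of_real \<gamma> * cinner (u n) (g n)) \<longlonglongrightarrow> 0 + complex_of_real \<gamma> * 0"
    by (intro tendsto_intros ug)
  then show "(\<lambda>n. t (u n) (g n)) \<longlonglongrightarrow> 0" by (simp add: q_def)
  have "(\<lambda>n. q (g n) (u n)) \<longlonglongrightarrow> 0"
  proof (rule lim)
    fix n and l :: real assume l: "0 < l"
    \<comment> \<open>With the arguments exchanged the reciprocal weight is used, so that
      \<open>l\<close> again multiplies the term with \<open>u\<close>.\<close>
    have "cmod (q (g n) (u n)) \<le> c * ((1 / l) * h (g n) + h (u n) / (1 / l))"
      unfolding h_def by (rule polarization_bound[OF q c(1) qb g(1) u(1)]) (simp_all add: l)
    also have "\<dots> = c * (l * h (u n) + h (g n) / l)" by (simp add: mult.commute)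
    also have "\<dots> \<le> c * (l * h (u n) + B / l)"
      using l Bn[of n] c(1) by (intro mult_left_mono add_left_mono divide_right_mono) auto
    finally show "cmod (q (g n) (u n)) \<le> c * (l * h (u n) + B / l)" .
  qed
  then have "(\<lambda>n. q (g n) (u n) + complex_of_real \<gamma> * cinner (g n) (u n)) \<longlonglongrightarrow> 0 + complex_of_real \<gamma> * 0"
    by (intro tendsto_intros ug)
  then show "(\<lambda>n. t (g n) (u n)) \<longlonglongrightarrow> 0" by (simp add: q_def)
qed

text \<open>The difference from \<open>t f g\<close> expands into three mixed terms, each of which
  contains a sequence tending to 0 both in norm and with respect to the form.\<close>

lemma sectorial_form_tendsto:
  fixes t :: "'a::complex_inner \<Rightarrow> 'a \<Rightarrow> complex"
  assumes sec: "sectorial_form D t" and f: "\<And>n. F n \<in> D" "f \<in> D" "F \<longlonglongrightarrow> f" "(\<lambda>n. t (F n - f) (F n - f)) \<longlonglongrightarrow> 0"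
    and g: "\<And>n. G n \<in> D" "g \<in> D" "G \<longlonglongrightarrow> g" "(\<lambda>n. t (G n - g) (G n - g)) \<longlonglongrightarrow> 0"
  shows "(\<lambda>n. t (F n) (G n)) \<longlonglongrightarrow> t f g"
proof -
  have t: "sesquilinear_on D t" using sec by (simp add: sectorial_form_def)
  note sub = csubspaceD[OF sesquilinear_onD(1)[OF t]]
  have Ff: "F n - f \<in> D" "G n - g \<in> D" for n using sub f(1,2) g(1,2) by auto
  have "(\<lambda>n. F n - f) \<longlonglongrightarrow> 0" "(\<lambda>n. G n - g) \<longlonglongrightarrow> 0" using f(3) g(3) by (auto simp: LIM_zero_iff)
  note Fu = sectorial_form_tendsto_zero[OF sec Ff(1) this(1) f(4)] and Gu = sectorial_form_tendsto_zero[OF sec Ff(2) this(2) g(4)]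
  have "(\<lambda>n. t (F n - f) (G n - g)) \<longlonglongrightarrow> 0" by (rule Fu(1)[OF Ff(2) \<open>(\<lambda>n. G n - g) \<longlonglongrightarrow> 0\<close> g(4)])
  moreover have "(\<lambda>n. t (F n - f) g) \<longlonglongrightarrow> 0" by (rule Fu(1)[OF g(2) tendsto_const tendsto_const])
  moreover have "(\<lambda>n. t f (G n - g)) \<longlonglongrightarrow> 0" by (rule Gu(2)[OF f(2) tendsto_const tendsto_const])
  ultimately have "(\<lambda>n. t (F n - f) (G n - g) + t (F n - f) g + t f (G n - g) + t f g) \<longlonglongrightarrow> 0 + 0 + 0 + t f g"
    by (intro tendsto_add tendsto_const)
  moreover have "t (F n - f) (G n - g) + t (F n - f) g + t f (G n - g) + t f g = t (F n) (G n)" for n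
    using sesquilinear_on_diff[OF t] f(1,2) g(1,2) Ff by simp
  ultimately show ?thesis by simp
qed

text \<open>A weak solution of \<open>Tf = k\<close> is a strong one, because \<open>T - \<lambda>\<close> is onto for some \<open>\<lambda>\<close> to the left of
  the numerical range of the form.\<close>

lemma associated_operator_weak:
  fixes T :: "'a::complex_inner operator"
  assumes T: "associated_operator D t T" and sec: "sectorial_form D t" and f: "f \<in> D" and weak: "\<And>g. g \<in> D \<Longrightarrow> t f g = cinner k g"
  shows "f \<in> Dom T \<and> T \<cdot> f = k"
proof -
  have t: "sesquilinear_on D t" using sec by (simp add: sectorial_form_def)
  obtain \<gamma> c where \<gamma>: "\<And>f. f \<in> D \<Longrightarrow> \<gamma> * (norm f)\<^sup>2 \<le> Re (t f f)" using sectorial_form_bound[OF sec] by blast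
  obtain \<alpha> where \<alpha>: "m_accretive (Operator (Dom T) (\<lambda>f. T \<cdot> f + \<alpha> *\<^sub>C f))"
    using T by (auto simp: associated_operator_def m_sectorial_def quasi_m_accretive_def)
  \<comment> \<open>Large enough for \<open>- w - \<alpha>\<close> to have real part below the
    vertex \<gamma>, and positive, so that \<open>- w\<close> lies in the resolvent set of the
    shifted operator.\<close>
  define w where "w = \<bar>\<gamma>\<bar> + cmod \<alpha> + 1"
  define l where "l = - complex_of_real w - \<alpha>"
  have "0 < w" by (simp add: w_def add_nonneg_pos)
  then have "- complex_of_real w \<in> resolvent_set (Operator (Dom T) (\<lambda>f. T \<cdot> f + \<alpha> *\<^sub>C f))"
    using \<alpha> by (simp add: m_accretive_def)
  then have "bij_betw (\<lambda>f. (- complex_of_real w) *\<^sub>C f - (T \<cdot> f + \<alpha> *\<^sub>C f)) (Dom T) UNIV"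
    by (simp add: resolvent_set_def)
  \<comment> \<open>The equation reads \<open>l f' - T f' = l f - k\<close>, which \<open>f\<close>
    satisfies weakly. The difference \<open>u\<close> is then a weak eigenvector at
    \<open>l\<close>, which the position of \<open>l\<close> excludes unless
    \<open>u = 0\<close>.\<close>
  then obtain f' where f': "f' \<in> Dom T" "(- complex_of_real w) *\<^sub>C f' - (T \<cdot> f' + \<alpha> *\<^sub>C f') = l *\<^sub>C f - k"
    unfolding bij_betw_def by (metis (no_types, lifting) UNIV_I imageE)
  have f'D: "f' \<in> D" and tf': "\<And>g. g \<in> D \<Longrightarrow> cinner (T \<cdot> f') g = t f' g" using T f'(1) by (auto simp: associated_operator_def)
  have Tf': "T \<cdot> f' = l *\<^sub>C f' - l *\<^sub>C f + k" using f'(2) by (simp add: l_def scaleC_diff_left algebra_simps)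
  define u where "u = f' - f"
  have u: "u \<in> D" unfolding u_def using csubspaceD(4)[OF sesquilinear_onD(1)[OF t]] f'D f by blast
  have "t u u = cinner (T \<cdot> f') u - cinner k u"
    using sesquilinear_on_diff(1)[OF t f'D f u] weak[OF u] tf'[OF u] by (simp add: u_def)
  also have "\<dots> = l * cinner u u" by (simp add: Tf' u_def cinner_simps algebra_simps)
  finally have "Re (t u u) = Re l * (norm u)\<^sup>2" by (simp add: cinner_self)
  then have "\<gamma> * (norm u)\<^sup>2 \<le> Re l * (norm u)\<^sup>2" using \<gamma>[OF u] by simp
  moreover have "Re l < \<gamma>" using abs_Re_le_cmod[of \<alpha>] by (simp add: l_def w_def)
  ultimately have "(norm u)\<^sup>2 \<le> 0" by (metis mult_less_cancel_right_pos not_le)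
  then have "u = 0" by simp
  then show ?thesis using f'(1) Tf' by (simp add: u_def)
qed

section \<open>The perturbed form\<close>

text \<open>\<open>B\<close> is the square root of \<open>A\<close>, diagonal with entries
  \<open>sqrt (m k)\<close> in the resolution \<open>P\<close>; indices start at 0.\<close>

locale perturbed_form = orthogonal_resolution P for P :: "nat \<Rightarrow> 'a::chilbert_space \<Rightarrow> 'a" +
  fixes m w :: "nat \<Rightarrow> real" and B :: "'a operator" and v :: "'a \<Rightarrow> 'a \<Rightarrow> complex"
  assumes m_bound: "\<exists>e>0. \<forall>k. e \<le> m k" and m_top: "filterlim m at_top sequentially"
    and w_nonneg: "0 \<le> w k" and w_summable: "summable (\<lambda>k. (w k)\<^sup>2 / m k)"
    and B: "self_adjoint B" and P_Dom: "P k x \<in> Dom B" and B_P: "B \<cdot> P k x = complex_of_real (sqrt (m k)) *\<^sub>C P k x"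
    and v: "sesquilinear_on (Dom B) v"
    and v_bound: "f \<in> Dom B \<Longrightarrow> g \<in> Dom B \<Longrightarrow> cmod (v (P j f) (P k g)) \<le> w j * w k * norm (P j f) * norm (P k g)"
    and sectorial: "sectorial_form (Dom B) (\<lambda>f g. cinner (B \<cdot> f) (B \<cdot> g) + v f g)"
    and closed: "closed_form (Dom B) (\<lambda>f g. cinner (B \<cdot> f) (B \<cdot> g) + v f g)"
begin

abbreviation t :: "'a \<Rightarrow> 'a \<Rightarrow> complex" where "t \<equiv> \<lambda>f g. cinner (B \<cdot> f) (B \<cdot> g) + v f g"

lemmas lin_B = linear_operatorD[OF self_adjointD(1)[OF B]]

lemma m_pos: "0 < m k"
  using m_bound less_le_trans by blast

lemma P_B: "f \<in> Dom B \<Longrightarrow> P k (B \<cdot> f) = complex_of_real (sqrt (m k)) *\<^sub>C P k f"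
proof (rule cinner_ext)
  fix y assume f: "f \<in> Dom B"
  have "cinner (P k (B \<cdot> f)) y = cinner (B \<cdot> f) (P k y)" by (rule sym_P)
  also have "\<dots> = cinner f (B \<cdot> P k y)" by (rule self_adjointD(2)[OF B f P_Dom])
  also have "\<dots> = complex_of_real (sqrt (m k)) * cinner (P k f) y" by (simp add: B_P cinner_scaleC_right sym_P)
  finally show "cinner (P k (B \<cdot> f)) y = cinner (complex_of_real (sqrt (m k)) *\<^sub>C P k f) y" by (simp add: cinner_scaleC_left)
qed

lemma sum_Dom: "(\<Sum>k\<in>I. P k f) \<in> Dom B"
  by (intro csubspace_sum[OF lin_B(1)] P_Dom)

lemma B_sum:
  assumes "finite I" "f \<in> Dom B" shows "B \<cdot> (\<Sum>k\<in>I. P k f) = (\<Sum>k\<in>I. P k (B \<cdot> f))"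
  using assms(1)
proof (induction I rule: finite_induct)
  case (insert k I)
  then show ?case using lin_B(2)[OF P_Dom sum_Dom, of k f f I] by (simp add: B_P P_B[OF assms(2)])
qed (simp add: lin_B(4))

text \<open>The Cauchy-Schwarz inequality with the summability of
  \<open>(w k)\<^sup>2 / m k\<close>. The second estimate makes \<open>v\<close> a bounded form once
  its arguments are transported by the inverse of \<open>B\<close>.\<close>

lemma weighted_summable:
  shows "summable (\<lambda>k. w k / sqrt (m k) * norm (P k x))"
    and "(\<Sum>k. w k / sqrt (m k) * norm (P k x)) \<le> sqrt (\<Sum>k. (w k)\<^sup>2 / m k) * norm x"
proof -
  have sq: "(w k / sqrt (m k))\<^sup>2 = (w k)\<^sup>2 / m k" for k using m_pos[of k] by (simp add: power_divide)
  have nn: "0 \<le> w k / sqrt (m k)" for k using w_nonneg m_pos[of k] by simp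
  note CS = Cauchy_Schwarz_suminf[of "\<lambda>k. w k / sqrt (m k)" "\<lambda>k. norm (P k x)", unfolded sq, OF nn w_summable norm_ge_zero summable_norm_P]
  show "summable (\<lambda>k. w k / sqrt (m k) * norm (P k x))" by (rule CS(1))
  have pos: "0 \<le> (\<Sum>k. (w k)\<^sup>2 / m k)" using m_pos by (intro suminf_nonneg w_summable) (simp add: less_imp_le)
  have "(\<Sum>k. w k / sqrt (m k) * norm (P k x))\<^sup>2 \<le> (sqrt (\<Sum>k. (w k)\<^sup>2 / m k) * norm x)\<^sup>2"
    using CS(2) pos sums_unique[OF norm_sums[of x]] by (simp add: power_mult_distrib)
  then show "(\<Sum>k. w k / sqrt (m k) * norm (P k x)) \<le> sqrt (\<Sum>k. (w k)\<^sup>2 / m k) * norm x"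
    by (rule power2_le_imp_le) (simp add: pos)
qed

lemma norm_P_B: "f \<in> Dom B \<Longrightarrow> w k / sqrt (m k) * norm (P k (B \<cdot> f)) = w k * norm (P k f)"
  using m_pos[of k] by (simp add: P_B)

lemma v_sum_bound:
  assumes "finite I" "f \<in> Dom B" "g \<in> Dom B"
  shows "cmod (v (\<Sum>j\<in>I. P j f) (\<Sum>k\<in>I. P k g)) \<le> (\<Sum>j\<in>I. w j * norm (P j f)) * (\<Sum>k\<in>I. w k * norm (P k g))"
proof -
  have "v (\<Sum>j\<in>I. P j f) (\<Sum>k\<in>I. P k g) = (\<Sum>j\<in>I. \<Sum>k\<in>I. v (P j f) (P k g))"
    by (simp only: sesquilinear_on_sum(1)[OF v P_Dom sum_Dom assms(1)] sesquilinear_on_sum(2)[OF v P_Dom P_Dom assms(1)])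
  also have "cmod \<dots> \<le> (\<Sum>j\<in>I. \<Sum>k\<in>I. w j * norm (P j f) * (w k * norm (P k g)))"
    by (intro order_trans[OF norm_sum] sum_mono) (use v_bound[OF assms(2,3)] in \<open>auto simp: mult_ac\<close>)
  also have "\<dots> = (\<Sum>j\<in>I. w j * norm (P j f)) * (\<Sum>k\<in>I. w k * norm (P k g))"
    by (simp add: sum_product)
  finally show ?thesis .
qed

text \<open>The spectral partial sums of \<open>f\<close> converge to \<open>f\<close> in the norm of \<open>a\<close>, hence are Cauchy for \<open>t\<close>;
  closedness of \<open>t\<close> then yields convergence with respect to \<open>t\<close>, which identifies \<open>v\<close> with its matrix.\<close>

lemma t_partial_sums:
  assumes f: "f \<in> Dom B"
  shows "(\<lambda>n. t ((\<Sum>k<n. P k f) - f) ((\<Sum>k<n. P k f) - f)) \<longlonglongrightarrow> 0"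
proof -
  define F where "F n = (\<Sum>k<n. P k f)" for n
  have tend: "F \<longlonglongrightarrow> f" using sums_P[of f] by (simp add: F_def[abs_def] sums_def)
  have sm: "summable (\<lambda>k. w k * norm (P k f))"
    using weighted_summable(1)[of "B \<cdot> f"] by (simp only: norm_P_B[OF f])
  have sB: "summable (\<lambda>k. P k (B \<cdot> f))" using sums_P sums_summable by blast
  \<comment> \<open>With \<open>b \<le> a\<close> the difference is a sum over an interval of
    indices; the opposite order is reduced to it because the form takes the same value at a vector
    and at its negative. Each of the two parts of the form receives \<open>e / 2\<close>.\<close>
  have small: "cmod (t (F a - F b) (F a - F b)) < e"
    if e: "0 < e" and N: "\<And>a b. a \<ge> N \<Longrightarrow> norm (\<Sum>k=a..<b. w k * norm (P k f)) < sqrt (e / 2)"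
      "\<And>a b. a \<ge> N \<Longrightarrow> norm (\<Sum>k=a..<b. P k (B \<cdot> f)) < sqrt (e / 2)" and ab: "N \<le> b" "b \<le> a" for e N a b
  proof -
    have FF: "F a - F b = (\<Sum>k=b..<a. P k f)"
      using ab by (simp add: F_def sum_diff_nat_ivl lessThan_atLeast0)
    have "cmod (cinner (B \<cdot> (F a - F b)) (B \<cdot> (F a - F b))) = (norm (\<Sum>k=b..<a. P k (B \<cdot> f)))\<^sup>2"
      unfolding FF B_sum[OF finite_atLeastLessThan f] cinner_self by (simp add: norm_power)
    also have "\<dots> < (sqrt (e / 2))\<^sup>2" using N(2)[OF ab(1)] by (intro power_strict_mono) auto
    also have "\<dots> = e / 2" using e by simp
    finally have 1: "cmod (cinner (B \<cdot> (F a - F b)) (B \<cdot> (F a - F b))) < e / 2" .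
    have "cmod (v (F a - F b) (F a - F b)) \<le> (\<Sum>k=b..<a. w k * norm (P k f)) * (\<Sum>k=b..<a. w k * norm (P k f))"
      unfolding FF by (rule v_sum_bound[OF finite_atLeastLessThan f f])
    also have "\<dots> = (norm (\<Sum>k=b..<a. w k * norm (P k f)))\<^sup>2" by (simp add: power2_eq_square)
    also have "\<dots> < (sqrt (e / 2))\<^sup>2" using N(1)[OF ab(1)] by (intro power_strict_mono) auto
    also have "\<dots> = e / 2" using e by simp
    finally have 2: "cmod (v (F a - F b) (F a - F b)) < e / 2" .
    show ?thesis using norm_triangle_ineq[of "cinner (B \<cdot> (F a - F b)) (B \<cdot> (F a - F b))" "v (F a - F b) (F a - F b)"] 1 2 by linarith
  qed
  have "\<forall>e>0. \<exists>N. \<forall>a\<ge>N. \<forall>b\<ge>N. cmod (t (F a - F b) (F a - F b)) < e"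
  proof (intro allI impI)
    fix e :: real assume e: "0 < e"
    then have e2: "0 < sqrt (e / 2)" by simp
    obtain N1 where N1: "\<And>a b. a \<ge> N1 \<Longrightarrow> norm (\<Sum>k=a..<b. w k * norm (P k f)) < sqrt (e / 2)"
      using sm e2 unfolding summable_Cauchy by meson
    obtain N2 where N2: "\<And>a b. a \<ge> N2 \<Longrightarrow> norm (\<Sum>k=a..<b. P k (B \<cdot> f)) < sqrt (e / 2)"
      using sB e2 unfolding summable_Cauchy by meson
    note S = small[OF e, of "max N1 N2"]
    have "cmod (t (F a - F b) (F a - F b)) < e" if "a \<ge> max N1 N2" "b \<ge> max N1 N2" for a b
    proof (cases "b \<le> a")
      case True
      then show ?thesis using S[of b a] N1 N2 that by simp
    next
      case False
      then have less: "cmod (t (F b - F a) (F b - F a)) < e" using S[of a b] N1 N2 that by simp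
      have D: "F b - F a \<in> Dom B" using sum_Dom csubspaceD(4)[OF lin_B(1)] by (simp add: F_def)
      have "F a - F b = (- 1) *\<^sub>C (F b - F a)" by (simp add: scaleC_minus_one)
      moreover have "B \<cdot> ((- 1) *\<^sub>C (F b - F a)) = (- 1) *\<^sub>C (B \<cdot> (F b - F a))" by (rule lin_B(3)[OF D])
      moreover have "v ((- 1) *\<^sub>C (F b - F a)) ((- 1) *\<^sub>C (F b - F a)) = v (F b - F a) (F b - F a)"
        using sesquilinear_onD(4)[OF v D csubspaceD(3)[OF lin_B(1) D], of "- 1" "- 1"] sesquilinear_onD(5)[OF v D D, of "- 1"] by simp
      ultimately have "t (F a - F b) (F a - F b) = t (F b - F a) (F b - F a)" by (simp only: cinner_scaleC_left cinner_scaleC_right) simp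
      then show ?thesis using less by simp
    qed
    then show "\<exists>N. \<forall>a\<ge>N. \<forall>b\<ge>N. cmod (t (F a - F b) (F a - F b)) < e" by blast
  qed
  moreover have "\<forall>n. F n \<in> Dom B" using sum_Dom by (simp add: F_def)
  ultimately have "(\<lambda>n. t (F n - f) (F n - f)) \<longlonglongrightarrow> 0"
    using closed[unfolded closed_form_def, THEN spec, THEN spec, of F f] tend by simp
  then show ?thesis by (simp only: F_def)
qed

text \<open>The bound holds for partial sums by the matrix estimate. Along them \<open>t\<close>
  converges by sectoriality and the unperturbed part converges by itself, hence so does
  \<open>v\<close>, and the bound survives the limit.\<close>

lemma v_form_bound:
  assumes f: "f \<in> Dom B" and g: "g \<in> Dom B"
  shows "cmod (v f g) \<le> (\<Sum>k. w k / sqrt (m k) * norm (P k (B \<cdot> f))) * (\<Sum>k. w k / sqrt (m k) * norm (P k (B \<cdot> g)))"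
proof -
  define F where "F n = (\<Sum>k<n. P k f)" for n
  define G where "G n = (\<Sum>k<n. P k g)" for n
  have tend: "F \<longlonglongrightarrow> f" "G \<longlonglongrightarrow> g" using sums_P[of f] sums_P[of g] by (simp_all add: F_def[abs_def] G_def[abs_def] sums_def)
  have FG: "F n \<in> Dom B" "G n \<in> Dom B" for n using sum_Dom by (simp_all add: F_def G_def)
  have "(\<lambda>n. t (F n) (G n)) \<longlonglongrightarrow> t f g"
    by (rule sectorial_form_tendsto[OF sectorial FG(1) f tend(1) _ FG(2) g tend(2)])
       (use t_partial_sums[OF f] t_partial_sums[OF g] in \<open>simp_all add: F_def G_def\<close>)
  moreover have "(\<lambda>n. cinner (B \<cdot> F n) (B \<cdot> G n)) \<longlonglongrightarrow> cinner (B \<cdot> f) (B \<cdot> g)"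
    unfolding F_def G_def B_sum[OF finite_lessThan f] B_sum[OF finite_lessThan g]
    using sums_P[of "B \<cdot> f"] sums_P[of "B \<cdot> g"] unfolding sums_def by (rule tendsto_cinner)
  ultimately have "(\<lambda>n. t (F n) (G n) - cinner (B \<cdot> F n) (B \<cdot> G n)) \<longlonglongrightarrow> t f g - cinner (B \<cdot> f) (B \<cdot> g)" by (rule tendsto_diff)
  then have "(\<lambda>n. v (F n) (G n)) \<longlonglongrightarrow> v f g" by simp
  then have "(\<lambda>n. cmod (v (F n) (G n))) \<longlonglongrightarrow> cmod (v f g)" by (rule tendsto_norm)
  moreover have "cmod (v (F n) (G n)) \<le> (\<Sum>k. w k * norm (P k f)) * (\<Sum>k. w k * norm (P k g))" for n
  proof -
    have sm: "summable (\<lambda>k. w k * norm (P k f))" "summable (\<lambda>k. w k * norm (P k g))"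
      using weighted_summable(1)[of "B \<cdot> f"] weighted_summable(1)[of "B \<cdot> g"] by (simp_all only: norm_P_B[OF f] norm_P_B[OF g])
    have "cmod (v (F n) (G n)) \<le> (\<Sum>k<n. w k * norm (P k f)) * (\<Sum>k<n. w k * norm (P k g))"
      unfolding F_def G_def by (rule v_sum_bound[OF finite_lessThan f g])
    also have "\<dots> \<le> (\<Sum>k. w k * norm (P k f)) * (\<Sum>k. w k * norm (P k g))"
      by (intro mult_mono sum_le_suminf sm sum_nonneg suminf_nonneg) (simp_all add: w_nonneg)
    finally show ?thesis .
  qed
  ultimately have "cmod (v f g) \<le> (\<Sum>k. w k * norm (P k f)) * (\<Sum>k. w k * norm (P k g))"
    by (intro LIMSEQ_le_const2) auto
  then show ?thesis by (simp only: norm_P_B[OF f] norm_P_B[OF g])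
qed

text \<open>The same operator as \<open>C\<close> of \<open>form_perturbation\<close>; it is needed
  already for the construction of \<open>V\<close>, before that locale can be entered.\<close>

definition Binv :: "'a \<Rightarrow> 'a" where "Binv = diag (\<lambda>k. complex_of_real (1 / sqrt (m k)))"

text \<open>\<open>B\<close> maps the partial sums of the series for \<open>Binv x\<close> to those
  of the series for \<open>x\<close>, and \<open>B\<close> is closed.\<close>

lemma Binv:
  shows bounded_clinear_Binv: "bounded_clinear Binv" and P_Binv: "P k (Binv x) = complex_of_real (1 / sqrt (m k)) *\<^sub>C P k x"
    and Binv_Dom: "Binv x \<in> Dom B" and B_Binv: "B \<cdot> Binv x = x"
proof -
  obtain e where e: "e > 0" "\<And>k. e \<le> m k" using m_bound by blast
  have c: "cmod (complex_of_real (1 / sqrt (m k))) \<le> 1 / sqrt e" for k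
  proof -
    have "0 < sqrt e" "sqrt e \<le> sqrt (m k)" using e(1) e(2)[of k] by auto
    then have "1 / sqrt (m k) \<le> 1 / sqrt e" by (intro frac_le) auto
    then show ?thesis using m_pos[of k] by (simp add: norm_divide)
  qed
  show bc: "bounded_clinear Binv" unfolding Binv_def by (rule bounded_clinear_diag[OF c])
  show P: "P k (Binv x) = complex_of_real (1 / sqrt (m k)) *\<^sub>C P k x" for k x unfolding Binv_def by (rule P_diag[OF c])
  have "(\<lambda>n. \<Sum>k<n. P k (Binv x)) \<longlonglongrightarrow> Binv x" using sums_P unfolding sums_def .
  moreover have "B \<cdot> (\<Sum>k\<in>I. P k (Binv x)) = (\<Sum>k\<in>I. P k x)" if "finite I" for I
    using that
  proof (induction I rule: finite_induct)
    case (insert k I)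
    have "B \<cdot> P k (Binv x) = (complex_of_real (1 / sqrt (m k)) * complex_of_real (sqrt (m k))) *\<^sub>C P k x"
      by (simp only: P lin_B(3)[OF P_Dom] B_P scaleC_scaleC)
    also have "\<dots> = P k x" unfolding of_real_mult[symmetric] using m_pos[of k] by simp
    finally have "B \<cdot> P k (Binv x) = P k x" .
    then show ?case using insert lin_B(2)[OF P_Dom sum_Dom, of k "Binv x" "Binv x" I] by simp
  qed (simp add: lin_B(4))
  then have "(\<lambda>n. B \<cdot> (\<Sum>k<n. P k (Binv x))) \<longlonglongrightarrow> x" using sums_P[of x] by (simp add: sums_def)
  ultimately show "Binv x \<in> Dom B" "B \<cdot> Binv x = x" 
    using self_adjoint_closed[OF B, of "\<lambda>n. \<Sum>k<n. P k (Binv x)" "Binv x" x] sum_Dom by auto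
qed

lemma Binv_B: "f \<in> Dom B \<Longrightarrow> Binv (B \<cdot> f) = f"
proof (rule P_ext)
  fix k assume f: "f \<in> Dom B"
  show "P k (Binv (B \<cdot> f)) = P k f"
    using m_pos[of k] by (simp add: P_Binv P_B[OF f] scaleC_scaleC flip: of_real_mult)
qed

text \<open>Transported by \<open>Binv\<close>, the form \<open>v\<close> is defined and bounded on
  the whole space; the Riesz representation in its second argument yields \<open>V\<close>.\<close>

lemma form_operator:
  obtains V where "form_perturbation P m w V" "\<And>f g. f \<in> Dom B \<Longrightarrow> g \<in> Dom B \<Longrightarrow> v f g = cinner (V (B \<cdot> f)) (B \<cdot> g)"
proof -
  define K where "K = sqrt (\<Sum>k. (w k)\<^sup>2 / m k)"
  note S = sesquilinear_onD[OF v] and Bl = bounded_clinearD[OF bounded_clinear_Binv]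
  have K0: "0 \<le> K" using m_pos unfolding K_def by (intro real_sqrt_ge_zero suminf_nonneg w_summable) (simp add: less_imp_le)
  have bd: "cmod (v (Binv x) (Binv y)) \<le> (\<Sum>k. w k / sqrt (m k) * norm (P k x)) * (\<Sum>k. w k / sqrt (m k) * norm (P k y))" for x y
    using v_form_bound[OF Binv_Dom Binv_Dom, of x y] by (simp only: B_Binv)
  have bd': "cmod (v (Binv x) (Binv y)) \<le> (K * norm x) * (K * norm y)" for x y
  proof -
    have "(\<Sum>k. w k / sqrt (m k) * norm (P k x)) * (\<Sum>k. w k / sqrt (m k) * norm (P k y)) \<le> (K * norm x) * (K * norm y)"
      unfolding K_def
      by (intro mult_mono weighted_summable(2) suminf_nonneg weighted_summable(1) mult_nonneg_nonneg)
         (use K0 w_nonneg m_pos in \<open>auto simp: K_def less_imp_le\<close>)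
    then show ?thesis using bd order_trans by blast
  qed
  have "\<exists>u. \<forall>y. v (Binv x) (Binv y) = cinner u y" for x
  proof (rule Riesz_representation[of "\<lambda>y. v (Binv x) (Binv y)" "K * norm x * K"])
    show "v (Binv x) (Binv (y + z)) = v (Binv x) (Binv y) + v (Binv x) (Binv z)" for y z
      by (simp only: Bl(2) S(3)[OF Binv_Dom Binv_Dom Binv_Dom])
    show "v (Binv x) (Binv (c *\<^sub>C y)) = cnj c * v (Binv x) (Binv y)" for c y
      by (simp only: Bl(3) S(5)[OF Binv_Dom Binv_Dom])
    show "cmod (v (Binv x) (Binv y)) \<le> K * norm x * K * norm y" for y using bd'[of x y] by (simp add: mult.assoc)
  qed blast
  then obtain V where V: "\<And>x y. v (Binv x) (Binv y) = cinner (V x) y" by metis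
  have "bounded_clinear V"
  proof (rule bounded_clinearI)
    show "V (x + y) = V x + V y" for x y
      by (rule cinner_ext) (simp only: V[symmetric] cinner_add_left Bl(2) S(2)[OF Binv_Dom Binv_Dom Binv_Dom])
    show "V (c *\<^sub>C x) = c *\<^sub>C V x" for c x
      by (rule cinner_ext) (simp only: V[symmetric] cinner_scaleC_left Bl(3) S(4)[OF Binv_Dom Binv_Dom])
    show "norm (V x) \<le> (K * K) * norm x" for x
      by (rule norm_le_by_cinner) (use K0 bd'[of x] in \<open>auto simp: V mult_ac\<close>)
  qed
  then have "form_perturbation P m w V"
    using bd by unfold_locales (auto simp: m_bound m_top w_nonneg w_summable V)
  moreover have "v f g = cinner (V (B \<cdot> f)) (B \<cdot> g)" if "f \<in> Dom B" "g \<in> Dom B" for f g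
    using V[of "B \<cdot> f" "B \<cdot> g"] by (simp add: Binv_B that)
  ultimately show ?thesis using that by blast
qed

text \<open>Existence: the factorised inverse gives a form solution, which lies in
  \<open>Dom T\<close> by \<open>associated_operator_weak\<close>. Uniqueness: the difference of two
  solutions is mapped to 0 by \<open>M 1 z\<close> after \<open>B\<close>, and both maps are
  injective.\<close>

lemma resolvent_associated_operator:
  assumes fp: "form_perturbation P m w V" and V: "\<And>f g. f \<in> Dom B \<Longrightarrow> g \<in> Dom B \<Longrightarrow> v f g = cinner (V (B \<cdot> f)) (B \<cdot> g)"
    and T: "associated_operator (Dom B) t T" and z: "z \<in> form_perturbation.U m w"
  shows "z \<in> resolvent_set T \<and> resolvent T z = form_perturbation.R P m V 1 z"
proof -
  interpret fp: form_perturbation P m w V by (rule fp)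
  have C: "fp.C = Binv" by (simp add: fp.C_def Binv_def)
  have T': "Dom T \<subseteq> Dom B" "\<And>f g. f \<in> Dom T \<Longrightarrow> g \<in> Dom B \<Longrightarrow> cinner (T \<cdot> f) g = t f g"
    using T by (auto simp: associated_operator_def)
  have form: "t f g - z * cinner f g = cinner (fp.M 1 z (B \<cdot> f)) (B \<cdot> g)" if f: "f \<in> Dom B" and g: "g \<in> Dom B" for f g
  proof -
    have "cinner f g = cinner (Binv (B \<cdot> f)) (Binv (B \<cdot> g))" by (simp add: Binv_B f g)
    also have "\<dots> = cinner (fp.J (B \<cdot> f)) (B \<cdot> g)"
      using fp.sym_C[of "fp.C (B \<cdot> f)" "B \<cdot> g"] by (simp only: fp.C_C[symmetric] C)
    finally show ?thesis by (simp add: fp.M_def V[OF f g] cinner_simps)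
  qed
  have Rc: "bounded_clinear (fp.R 1 z)" by (rule pseudo_resolvent.bounded_clinear[OF fp.pseudo_resolvent_R z]) auto
  have sol: "fp.R 1 z h \<in> Dom T \<and> z *\<^sub>C fp.R 1 z h - T \<cdot> fp.R 1 z h = h" for h
  proof -
    define f where "f = fp.R 1 z h"
    have f_eq: "f = Binv (- inv (fp.M 1 z) (Binv h))" by (simp add: f_def fp.R_def C bounded_clinearD(6)[OF bounded_clinear_Binv])
    have f: "f \<in> Dom B" and Bf: "B \<cdot> f = - inv (fp.M 1 z) (Binv h)" unfolding f_eq by (rule Binv_Dom, rule B_Binv)
    have MB: "fp.M 1 z (B \<cdot> f) = - Binv h"
      unfolding Bf bounded_clinearD(6)[OF fp.bounded_clinear_M] using fp.M_inv(2)[OF z, of 1] by simp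
    have "f \<in> Dom T \<and> T \<cdot> f = z *\<^sub>C f - h"
    proof (rule associated_operator_weak[OF T sectorial f])
      fix g assume g: "g \<in> Dom B"
      have "cinner (Binv h) (B \<cdot> g) = cinner h (Binv (B \<cdot> g))" using fp.sym_C by (simp add: C)
      then have "t f g - z * cinner f g = - cinner h g"
        unfolding form[OF f g] MB by (simp add: cinner_minus_left Binv_B[OF g])
      then show "t f g = cinner (z *\<^sub>C f - h) g" by (simp add: cinner_simps algebra_simps)
    qed
    then show ?thesis by (simp add: f_def)
  qed
  have inj: "inj_on (\<lambda>f. z *\<^sub>C f - T \<cdot> f) (Dom T)"
  proof (rule inj_onI)
    fix f1 f2 assume f12: "f1 \<in> Dom T" "f2 \<in> Dom T" and eq: "z *\<^sub>C f1 - T \<cdot> f1 = z *\<^sub>C f2 - T \<cdot> f2"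
    have D: "f1 \<in> Dom B" "f2 \<in> Dom B" using T' f12 by auto
    define f where "f = f1 - f2"
    have f: "f \<in> Dom B" unfolding f_def by (rule csubspaceD(4)[OF lin_B(1) D])
    \<comment> \<open>The images \<open>B g\<close> exhaust the whole space, so testing against them
      is enough.\<close>
    have "fp.M 1 z (B \<cdot> f) = 0"
    proof -
      have zero: "cinner (fp.M 1 z (B \<cdot> f)) (B \<cdot> g) = 0" if g: "g \<in> Dom B" for g
      proof -
        have "t f1 g - z * cinner f1 g = - cinner (z *\<^sub>C f1 - T \<cdot> f1) g" "t f2 g - z * cinner f2 g = - cinner (z *\<^sub>C f2 - T \<cdot> f2) g"
          using T'(2)[OF f12(1) g] T'(2)[OF f12(2) g] by (simp_all add: cinner_simps)
        then have "cinner (fp.M 1 z (B \<cdot> f1)) (B \<cdot> g) = cinner (fp.M 1 z (B \<cdot> f2)) (B \<cdot> g)"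
          using form[OF D(1) g] form[OF D(2) g] eq by simp
        then show ?thesis
          by (simp add: f_def lin_B(5)[OF D] bounded_clinearD(5)[OF fp.bounded_clinear_M] cinner_diff_left)
      qed
      show ?thesis
      proof (rule cinner_ext)
        fix y show "cinner (fp.M 1 z (B \<cdot> f)) y = cinner 0 y" using zero[OF Binv_Dom, of y] by (simp add: B_Binv)
      qed
    qed
    then have "B \<cdot> f = 0"
      using fp.M_inv(3)[OF z, of 1 "B \<cdot> f"] bounded_clinearD(4)[OF fp.M_inv(1)[OF z, of 1]] by simp
    then have "f = 0" using Binv_B[OF f] bounded_clinearD(4)[OF bounded_clinear_Binv] by simp
    then show "f1 = f2" by (simp add: f_def)
  qed
  moreover have "(\<lambda>f. z *\<^sub>C f - T \<cdot> f) ` Dom T = UNIV"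
    using sol by (metis (no_types, lifting) UNIV_eq_I imageI)
  moreover have res: "resolvent T z = fp.R 1 z"
  proof
    fix h
    have "resolvent T z (z *\<^sub>C fp.R 1 z h - T \<cdot> fp.R 1 z h) = fp.R 1 z h"
      unfolding resolvent_def by (rule inv_into_f_f[OF inj]) (use sol in blast)
    then show "resolvent T z h = fp.R 1 z h" using sol by simp
  qed
  ultimately show ?thesis
    using bounded_clinearD(1)[OF Rc] by (simp add: resolvent_set_def bij_betw_def)
qed

end

section \<open>Estimates on the spectral gaps\<close>

locale spectral_gaps =
  fixes m w \<rho> :: "nat \<Rightarrow> real"
  assumes m_mono: "strict_mono m" and m_0: "0 < m 0" and m_top: "filterlim m at_top sequentially"
    and w_summable: "summable (\<lambda>k. (w k)\<^sup>2 / m k)"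
    and \<rho>_pos: "0 < \<rho> i" and gap: "j \<noteq> k \<Longrightarrow> 2 * \<rho> j \<le> \<bar>m j - m k\<bar>"
begin

text \<open>The bound on \<open>s\<close> in purely numerical terms. The first conjunct is stated
  separately because a vanishing denominator contributes 0 to the sum and would go
  unnoticed.\<close>

definition good :: "complex \<Rightarrow> bool" where
  "good z \<longleftrightarrow> (\<forall>k. complex_of_real (m k) \<noteq> z) \<and> (\<Sum>k. (w k)\<^sup>2 / cmod (complex_of_real (m k) - z)) \<le> 1 / 2"

lemma m_pos: "0 < m k"
  using m_0 strict_mono_less_eq[OF m_mono, of 0 k] by simp

lemma m_less: "j < k \<Longrightarrow> m j < m k"
  using m_mono by (simp add: strict_monoD)

lemma summable_off_spectrum:
  assumes "0 < H" and "\<And>k. k \<in> S \<Longrightarrow> H \<le> d k" and "\<And>k. k \<in> S \<Longrightarrow> k0 \<le> k \<Longrightarrow> m k / 2 \<le> d k"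
  shows "summable (\<lambda>k. if k \<in> S then (w k)\<^sup>2 / d k else 0)"
proof (rule summable_comparison_test'[OF summable_mult[OF w_summable, of 2], of k0])
  fix k assume k: "k0 \<le> k"
  show "norm (if k \<in> S then (w k)\<^sup>2 / d k else 0) \<le> 2 * ((w k)\<^sup>2 / m k)"
  proof (cases "k \<in> S")
    case True
    then have "0 < d k" using assms by (meson less_le_trans)
    moreover have "(w k)\<^sup>2 / d k \<le> (w k)\<^sup>2 / (m k / 2)"
      using assms(3)[OF True k] m_pos[of k] by (intro divide_left_mono) auto
    ultimately show ?thesis using True by (simp add: mult.commute)
  qed (simp add: m_pos less_imp_le)
qed

lemma eventually_large: "\<exists>k0. \<forall>k\<ge>k0. c \<le> m k"
  using m_top unfolding filterlim_at_top eventually_sequentially by blast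

text \<open>Beyond \<open>n\<close> the denominators are at least \<open>m k / 2\<close>, so twice a
  tail of the convergent series remains, at most 1/4. The \<open>n\<close> leading terms are
  controlled by the distance \<open>H\<close> and contribute another 1/4.\<close>

lemma good_far:
  shows "\<exists>H>0. \<forall>z. (\<forall>k. H \<le> cmod (complex_of_real (m k) - z)) \<longrightarrow> (\<forall>k\<ge>k0. m k / 2 \<le> cmod (complex_of_real (m k) - z)) \<longrightarrow> good z"
proof -
  have "\<exists>N. \<forall>n\<ge>N. norm (\<Sum>i. (w (i + n))\<^sup>2 / m (i + n)) < 1 / 8"
    by (rule suminf_exist_split[OF _ w_summable]) simp
  then obtain N where N: "\<And>n. n \<ge> N \<Longrightarrow> norm (\<Sum>i. (w (i + n))\<^sup>2 / m (i + n)) < 1 / 8" by blast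
  define n where "n = max N k0"
  \<comment> \<open>Four times the leading weights, so that division by \<open>H\<close> leaves at
    most 1/4; the 1 makes \<open>H\<close> positive.\<close>
  define H where "H = 4 * (\<Sum>k<n. (w k)\<^sup>2) + 1"
  have H: "0 < H" unfolding H_def by (intro add_nonneg_pos mult_nonneg_nonneg sum_nonneg) auto
  have "good z" if z: "\<forall>k. H \<le> cmod (complex_of_real (m k) - z)" "\<forall>k\<ge>k0. m k / 2 \<le> cmod (complex_of_real (m k) - z)" for z
  proof -
    let ?d = "\<lambda>k. cmod (complex_of_real (m k) - z)"
    have sm: "summable (\<lambda>k. (w k)\<^sup>2 / ?d k)"
      using summable_off_spectrum[OF H, of UNIV ?d k0] z by simp
    have "(\<Sum>k. (w k)\<^sup>2 / ?d k) = (\<Sum>k. (w (k + n))\<^sup>2 / ?d (k + n)) + (\<Sum>k<n. (w k)\<^sup>2 / ?d k)"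
      by (rule suminf_split_initial_segment[OF sm])
    also have "(\<Sum>k<n. (w k)\<^sup>2 / ?d k) \<le> (\<Sum>k<n. (w k)\<^sup>2 / H)"
    proof (rule sum_mono)
      fix k show "(w k)\<^sup>2 / ?d k \<le> (w k)\<^sup>2 / H"
        using z(1)[rule_format, of k] H by (intro divide_left_mono mult_pos_pos) (auto intro: less_le_trans)
    qed
    also have "\<dots> \<le> 1 / 4"
    proof -
      have "4 * (\<Sum>k<n. (w k)\<^sup>2) \<le> H" by (simp add: H_def)
      then show ?thesis using H by (simp add: sum_divide_distrib[symmetric] divide_le_eq)
    qed
    also have "(\<Sum>k. (w (k + n))\<^sup>2 / ?d (k + n)) \<le> (\<Sum>k. 2 * ((w (k + n))\<^sup>2 / m (k + n)))"
    proof (rule suminf_le)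
      show "summable (\<lambda>k. (w (k + n))\<^sup>2 / ?d (k + n))" using sm by (rule summable_ignore_initial_segment)
      show "summable (\<lambda>k. 2 * ((w (k + n))\<^sup>2 / m (k + n)))"
        by (intro summable_mult summable_ignore_initial_segment[OF w_summable])
      fix k
      have le: "m (k + n) / 2 \<le> ?d (k + n)" using z(2) by (simp add: n_def)
      moreover have "0 < m (k + n) / 2" by (simp add: m_pos)
      ultimately have "(w (k + n))\<^sup>2 / ?d (k + n) \<le> (w (k + n))\<^sup>2 / (m (k + n) / 2)"
        by (intro divide_left_mono mult_pos_pos) (auto intro: less_le_trans)
      then show "(w (k + n))\<^sup>2 / ?d (k + n) \<le> 2 * ((w (k + n))\<^sup>2 / m (k + n))" by (simp add: mult.commute)
    qed
    also have "\<dots> = 2 * (\<Sum>k. (w (k + n))\<^sup>2 / m (k + n))"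
      by (rule suminf_mult[OF summable_ignore_initial_segment[OF w_summable]])
    also have "\<dots> \<le> 1 / 4" using N[of n] by (simp add: n_def)
    finally have "(\<Sum>k. (w k)\<^sup>2 / ?d k) \<le> 1 / 2" by simp
    moreover have "complex_of_real (m k) \<noteq> z" for k using z(1)[rule_format, of k] H by auto
    ultimately show "good z" by (simp add: good_def)
  qed
  then show ?thesis using H by blast
qed

lemma gap_summable: "summable (\<lambda>k. if k = i then 0 else (w k)\<^sup>2 / \<bar>m i - m k\<bar>)"
proof -
  obtain k0 where k0: "\<And>k. k \<ge> k0 \<Longrightarrow> 2 * m i \<le> m k" using eventually_large by blast
  have "summable (\<lambda>k. if k \<in> - {i} then (w k)\<^sup>2 / \<bar>m i - m k\<bar> else 0)"
  proof (rule summable_off_spectrum[of "2 * \<rho> i" _ _ k0])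
    show "2 * \<rho> i \<le> \<bar>m i - m k\<bar>" if "k \<in> - {i}" for k using gap[of i k] that by simp
    show "m k / 2 \<le> \<bar>m i - m k\<bar>" if "k0 \<le> k" for k using k0[OF that] by linarith
  qed (simp add: \<rho>_pos)
  then show ?thesis by (rule back_subst[of summable]) auto
qed

text \<open>If \<open>m i\<close> is nearest to \<open>Re z\<close>, then
  \<open>\<bar>m i - m k\<bar>\<close> is at most twice the distance of \<open>z\<close> from
  \<open>m k\<close>. Comparing \<open>z\<close> with \<open>m i\<close> thus costs a factor 2,
  which is why 1/4 is required in order to reach 1/2. The term of \<open>m i\<close> itself is
  bounded through the radius.\<close>

lemma good_nearest:
  assumes nearest: "\<And>k. \<bar>Re z - m i\<bar> \<le> \<bar>Re z - m k\<bar>" and dist: "\<rho> i \<le> cmod (z - complex_of_real (m i))"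
    and sm4: "(\<Sum>k. if k = i then 0 else (w k)\<^sup>2 / \<bar>m i - m k\<bar>) + (w i)\<^sup>2 / \<rho> i \<le> 1 / 4"
  shows "good z"
proof -
  let ?d = "\<lambda>k. cmod (complex_of_real (m k) - z)"
  have far: "\<bar>m i - m k\<bar> \<le> 2 * ?d k" for k
  proof -
    have "\<bar>Re z - m k\<bar> \<le> ?d k" using abs_Re_le_cmod[of "complex_of_real (m k) - z"] by simp
    then show ?thesis using nearest[of k] by linarith
  qed
  have pos: "0 < ?d k" for k
  proof (cases "k = i")
    case True
    have "0 < cmod (z - complex_of_real (m i))" by (rule less_le_trans[OF \<rho>_pos dist])
    then show ?thesis unfolding True by (subst norm_minus_commute)
  next
    case False
    then show ?thesis using far[of k] gap[of i k] \<rho>_pos[of i] by linarith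
  qed
  define f where "f k = (if k = i then 0 else (w k)\<^sup>2 / \<bar>m i - m k\<bar>)" for k
  have f: "summable f" unfolding f_def by (rule gap_summable)
  define g where "g k = (if k = i then (w i)\<^sup>2 / \<rho> i else 0)" for k
  have g: "g sums ((w i)\<^sup>2 / \<rho> i)" unfolding g_def using sums_single[of i "\<lambda>k. (w i)\<^sup>2 / \<rho> i"] by simp
  have le: "(w k)\<^sup>2 / ?d k \<le> 2 * f k + g k" for k
  proof (cases "k = i")
    case True
    have "(w i)\<^sup>2 / ?d i \<le> (w i)\<^sup>2 / \<rho> i"
      using dist \<rho>_pos[of i] pos[of i] by (intro divide_left_mono mult_pos_pos) (auto simp: norm_minus_commute)
    then show ?thesis using True by (simp add: f_def g_def)
  next
    case False
    have p: "0 < \<bar>m i - m k\<bar> / 2" using False gap[of i k] \<rho>_pos[of i] by simp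
    have "(w k)\<^sup>2 / ?d k \<le> (w k)\<^sup>2 / (\<bar>m i - m k\<bar> / 2)"
      using far[of k] by (intro divide_left_mono mult_pos_pos pos p) auto
    then show ?thesis using False by (simp add: f_def g_def mult.commute)
  qed
  have fg: "(\<lambda>k. 2 * f k + g k) sums (2 * suminf f + (w i)\<^sup>2 / \<rho> i)"
    by (intro sums_add sums_mult summable_sums f g)
  have sm: "summable (\<lambda>k. (w k)\<^sup>2 / ?d k)"
    by (rule summable_comparison_test'[OF sums_summable[OF fg], of 0]) (use le in simp)
  have "(\<Sum>k. (w k)\<^sup>2 / ?d k) \<le> 2 * suminf f + (w i)\<^sup>2 / \<rho> i"
    using suminf_le[OF le sm sums_summable[OF fg]] sums_unique[OF fg] by simp
  also have "\<dots> \<le> 2 * (suminf f + (w i)\<^sup>2 / \<rho> i)"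
  proof -
    have "0 \<le> (w i)\<^sup>2 / \<rho> i" by (intro divide_nonneg_pos \<rho>_pos) simp
    moreover have "2 * S + W \<le> 2 * (S + W)" if "0 \<le> W" for S W :: real using that by simp
    ultimately show ?thesis by blast
  qed
  also have "\<dots> \<le> 2 * (1 / 4)" using sm4 unfolding f_def by (rule mult_left_mono) simp
  finally have "(\<Sum>k. (w k)\<^sup>2 / ?d k) \<le> 1 / 2" by simp
  then show ?thesis using pos by (auto simp: good_def)
qed

lemma exists_nearest:
  obtains i where "\<And>k. \<bar>x - m i\<bar> \<le> \<bar>x - m k\<bar>"
proof -
  \<comment> \<open>From this index on no \<open>m k\<close> is closer to \<open>x\<close> than
    \<open>m 0\<close>, so a minimum over finitely many indices is global.\<close>
  obtain n where n: "\<And>k. k \<ge> n \<Longrightarrow> \<bar>x - m 0\<bar> + x \<le> m k" using eventually_large by blast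
  define D where "D = (\<lambda>k. \<bar>x - m k\<bar>) ` {..n}"
  have "finite D" "D \<noteq> {}" by (auto simp: D_def)
  then have "Min D \<in> D" by (rule Min_in)
  moreover have "\<exists>i. \<bar>x - m i\<bar> = y" if "y \<in> D" for y using that by (auto simp: D_def)
  ultimately obtain i where i: "\<bar>x - m i\<bar> = Min D" by blast
  have "\<bar>x - m i\<bar> \<le> \<bar>x - m k\<bar>" for k
  proof (cases "k \<le> n")
    case True
    then show ?thesis unfolding i using \<open>finite D\<close> by (intro Min_le) (auto simp: D_def)
  next
    case False
    have "\<bar>x - m i\<bar> \<le> \<bar>x - m 0\<bar>" unfolding i using \<open>finite D\<close> by (intro Min_le) (auto simp: D_def)
    also have "\<dots> \<le> \<bar>x - m k\<bar>" using n[of k] False by linarith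
    finally show ?thesis .
  qed
  then show ?thesis using that by blast
qed

text \<open>To the right of \<open>m N + \<rho> N\<close> the nearest index is at least
  \<open>N\<close>, where the smallness hypothesis applies. To the left, and above or below, all
  distances are large and the tail condition of \<open>good_far\<close> holds; the same
  \<open>h\<close> serves both directions.\<close>

theorem good_region:
  assumes small: "\<exists>N. \<forall>i\<ge>N. (\<Sum>k. if k = i then 0 else (w k)\<^sup>2 / \<bar>m i - m k\<bar>) + (w i)\<^sup>2 / \<rho> i \<le> 1 / 4"
  shows "\<exists>N. \<exists>h>0. (\<forall>z. Re z \<le> - h \<longrightarrow> good z) \<and>
    (\<forall>z. h \<le> \<bar>Im z\<bar> \<longrightarrow> Re z \<le> m N + \<rho> N \<longrightarrow> good z) \<and>
    (\<forall>z. m N + \<rho> N \<le> Re z \<longrightarrow> (\<forall>i>N. \<rho> i \<le> cmod (z - complex_of_real (m i))) \<longrightarrow> good z)"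
proof -
  obtain N where N: "\<And>i. i \<ge> N \<Longrightarrow> (\<Sum>k. if k = i then 0 else (w k)\<^sup>2 / \<bar>m i - m k\<bar>) + (w i)\<^sup>2 / \<rho> i \<le> 1 / 4"
    using small by blast
  define X where "X = m N + \<rho> N"
  \<comment> \<open>For these indices, \<open>m k - Re z\<close> is at least \<open>m k / 2\<close>
    whenever \<open>Re z \<le> X\<close>.\<close>
  obtain k0 where k0: "\<And>k. k \<ge> k0 \<Longrightarrow> 2 * X \<le> m k" using eventually_large by blast
  obtain h where h: "0 < h" "\<And>z. (\<forall>k. h \<le> cmod (complex_of_real (m k) - z)) \<Longrightarrow> (\<forall>k\<ge>k0. m k / 2 \<le> cmod (complex_of_real (m k) - z)) \<Longrightarrow> good z"
    using good_far[of k0] by blast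
  show ?thesis
  proof (intro exI[of _ N] exI[of _ h] conjI allI impI)
    show "0 < h" by fact
    show "good z" if "Re z \<le> - h" for z
    proof (rule h(2))
      have "m k + h \<le> cmod (complex_of_real (m k) - z)" for k
        using complex_Re_le_cmod[of "complex_of_real (m k) - z"] that by simp
      then show "\<forall>k. h \<le> cmod (complex_of_real (m k) - z)" "\<forall>k\<ge>k0. m k / 2 \<le> cmod (complex_of_real (m k) - z)"
        using m_pos h(1) by (smt (verit) field_sum_of_halves)+
    qed
    show "good z" if z: "h \<le> \<bar>Im z\<bar>" "Re z \<le> m N + \<rho> N" for z
    proof (rule h(2))
      show "\<forall>k. h \<le> cmod (complex_of_real (m k) - z)"
        using abs_Im_le_cmod[of "complex_of_real (m k) - z" for k] z(1) by (auto intro: order_trans)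
      show "\<forall>k\<ge>k0. m k / 2 \<le> cmod (complex_of_real (m k) - z)"
      proof (intro allI impI)
        fix k assume "k0 \<le> k"
        then have "m k / 2 \<le> m k - Re z" using k0[of k] z(2) by (simp add: X_def)
        also have "\<dots> \<le> cmod (complex_of_real (m k) - z)"
          using complex_Re_le_cmod[of "complex_of_real (m k) - z"] by simp
        finally show "m k / 2 \<le> cmod (complex_of_real (m k) - z)" .
      qed
    qed
    show "good z" if z: "m N + \<rho> N \<le> Re z" "\<forall>i>N. \<rho> i \<le> cmod (z - complex_of_real (m i))" for z
    proof -
      obtain i where i: "\<And>k. \<bar>Re z - m i\<bar> \<le> \<bar>Re z - m k\<bar>" using exists_nearest by blast
      have "N \<le> i"
      proof (rule ccontr)
        assume "\<not> N \<le> i"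
        then have "m i < m N" by (simp add: m_less)
        then show False using i[of N] z(1) \<rho>_pos[of N] by linarith
      qed
      moreover have "\<rho> i \<le> cmod (z - complex_of_real (m i))"
      proof (cases "i = N")
        case True
        then show ?thesis using complex_Re_le_cmod[of "z - complex_of_real (m N)"] z(1) by simp
      next
        case False
        then show ?thesis using \<open>N \<le> i\<close> z(2) by simp
      qed
      ultimately show ?thesis by (intro good_nearest[OF i] N)
    qed
  qed
qed

end

section \<open>The perturbation theorem\<close>

text \<open>The vector \<open>g = B e - sqrt l e\<close> satisfies \<open>B g = - sqrt l g\<close>,
  and a nonnegative \<open>B\<close> admits this only for \<open>g = 0\<close>.\<close>

lemma positive_sqrt_eigenvector:
  assumes sqrt: "positive_sqrt A B" and l: "0 < l" and e: "e \<in> eigenspace A (complex_of_real l)"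
  shows "e \<in> Dom B \<and> B \<cdot> e = complex_of_real (sqrt l) *\<^sub>C e"
proof -
  have B: "self_adjoint B" and nonneg: "\<And>f. f \<in> Dom B \<Longrightarrow> 0 \<le> Re (cinner (B \<cdot> f) f)"
    and eD: "e \<in> Dom B" "B \<cdot> e \<in> Dom B" and Ae: "B \<cdot> B \<cdot> e = complex_of_real l *\<^sub>C e"
    using sqrt e by (auto simp: positive_sqrt_def eigenspace_def)
  note lin = linear_operatorD[OF self_adjointD(1)[OF B]]
  let ?c = "complex_of_real (sqrt l)"
  have ce: "?c *\<^sub>C e \<in> Dom B" by (rule csubspaceD(3)[OF lin(1) eD(1)])
  define g where "g = B \<cdot> e - ?c *\<^sub>C e"
  have g: "g \<in> Dom B" unfolding g_def by (rule csubspaceD(4)[OF lin(1) eD(2) ce])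
  have cc: "?c * ?c = complex_of_real l" using l by (simp flip: of_real_mult)
  have "B \<cdot> g = complex_of_real l *\<^sub>C e - ?c *\<^sub>C (B \<cdot> e)"
    unfolding g_def by (simp only: lin(5)[OF eD(2) ce] Ae lin(3)[OF eD(1)])
  also have "\<dots> = (- ?c) *\<^sub>C g"
    by (simp add: g_def scaleC_diff_right scaleC_minus_left scaleC_scaleC cc)
  finally have "Re (cinner (B \<cdot> g) g) = - sqrt l * (norm g)\<^sup>2"
    by (simp add: cinner_scaleC_left cinner_minus_left cinner_self)
  then have "0 \<le> - sqrt l * (norm g)\<^sup>2" using nonneg[OF g] by simp
  then have "(norm g)\<^sup>2 \<le> 0" using l by (simp add: mult_le_0_iff)
  then have "g = 0" by simp
  then show ?thesis using eD by (simp add: g_def)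
qed

text \<open>The radius involves the neighbours only; monotonicity extends the gap estimate to all
  other indices. The shift by \<open>Suc\<close> turns the special case of the first radius into
  \<open>i = 0\<close>.\<close>

lemma gap_radius_bounds:
  assumes \<mu>: "strict_mono_on {1..} \<mu>"
  shows "0 < gap_radius \<mu> (Suc i)" and "i \<noteq> k \<Longrightarrow> 2 * gap_radius \<mu> (Suc i) \<le> \<bar>\<mu> (Suc i) - \<mu> (Suc k)\<bar>"
proof -
  have less: "\<mu> (Suc j) < \<mu> (Suc k)" if "j < k" for j k
    using \<mu> that by (simp add: strict_mono_onD)
  have le: "\<mu> (Suc j) \<le> \<mu> (Suc k)" if "j \<le> k" for j k
    using less[of j k] that by (cases "j = k") auto
  have up: "2 * gap_radius \<mu> (Suc i) \<le> \<mu> (Suc (Suc i)) - \<mu> (Suc i)"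
    by (simp add: gap_radius_def numeral_2_eq_2)
  have down: "2 * gap_radius \<mu> (Suc (Suc j)) \<le> \<mu> (Suc (Suc j)) - \<mu> (Suc j)" for j
    by (simp add: gap_radius_def)
  show "0 < gap_radius \<mu> (Suc i)"
    using less[of i "Suc i"] less[of "i - 1" i] by (cases i) (auto simp: gap_radius_def numeral_2_eq_2)
  show "2 * gap_radius \<mu> (Suc i) \<le> \<bar>\<mu> (Suc i) - \<mu> (Suc k)\<bar>" if "i \<noteq> k"
  proof (cases "i < k")
    case True
    then show ?thesis using up le[of "Suc i" k] by simp
  next
    case False
    then have "k < i" using that by simp
    then obtain j where j: "i = Suc j" "k \<le> j" by (cases i) auto
    then show ?thesis using down[of j] le[of k j] by simp
  qed
qed

lemma resolvent_integrand_eq: "resolvent_integrand T \<gamma> = cintegrand (resolvent T) \<gamma>"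
  by (simp add: fun_eq_iff resolvent_integrand_def cintegrand_def)

lemma riesz_projection_eq: "riesz_projection T \<gamma> = cintegral (resolvent T) \<gamma>"
  by (simp add: fun_eq_iff riesz_projection_def cintegral_def resolvent_integrand_eq)

theorem proposition2p2:
  fixes A sqrtA T :: "'a::chilbert_space operator"
    and \<mu> \<omega> r :: "nat \<Rightarrow> real"
    and P0 :: "nat \<Rightarrow> 'a \<Rightarrow> 'a"
    and a v :: "'a \<Rightarrow> 'a \<Rightarrow> complex"
  assumes "r = gap_radius \<mu>"
    and "P0 = (\<lambda>k. orth_proj (eigenspace A (complex_of_real (\<mu> k))))"
    and "a = (\<lambda>f g. cinner (sqrtA \<cdot> f) (sqrtA \<cdot> g))"
    and "separable_space (euclidean :: 'a topology)"
    and "self_adjoint A"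
    and "0 < \<mu> 1" and "strict_mono_on {1..} \<mu>" and "filterlim \<mu> at_top sequentially"
    and "spectrum A = (\<lambda>k. complex_of_real (\<mu> k)) ` {1..}"
    and "positive_sqrt A sqrtA"
    and "sesquilinear_on (Dom sqrtA) v"
    and "\<And>j. 1 \<le> j \<Longrightarrow> 0 \<le> \<omega> j"
    and "\<And>j k f g. \<lbrakk>1 \<le> j; 1 \<le> k; f \<in> Dom sqrtA; g \<in> Dom sqrtA\<rbrakk> \<Longrightarrow>
           cmod (v (P0 j f) (P0 k g)) \<le> \<omega> j * \<omega> k * norm (P0 j f) * norm (P0 k g)"
    and "(\<lambda>j. (\<omega> j)\<^sup>2 / \<mu> j) summable_on {1..}"
    and "(\<lambda>n. (\<Sum>\<^sub>\<infinity>j\<in>{1..} - {n}. (\<omega> j)\<^sup>2 / \<bar>\<mu> n - \<mu> j\<bar>) + (\<omega> n)\<^sup>2 / r n) \<in> o(\<lambda>_. 1)"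
    and "sectorial_form (Dom sqrtA) (\<lambda>f g. a f g + v f g)"
    and "closed_form (Dom sqrtA) (\<lambda>f g. a f g + v f g)"
    and "associated_operator (Dom sqrtA) (\<lambda>f g. a f g + v f g) T"
  shows "\<exists>N0\<ge>1. \<exists>h1>0. \<exists>h2>0.
    (let \<Omega>0 = {z. - h1 < Re z \<and> Re z \<le> \<mu> N0 + r N0 \<and> \<bar>Im z\<bar> \<le> h2};
         \<Omega> = (\<lambda>k. {z. cmod (z - complex_of_real (\<mu> k)) < r k});
         \<gamma>0 = rectpath (Complex (- h1) (- h2)) (Complex (\<mu> N0 + r N0) h2);
         \<gamma> = (\<lambda>k. circlepath (complex_of_real (\<mu> k)) (r k));
         S0 = riesz_projection T \<gamma>0;
         P = (\<lambda>k. riesz_projection T (\<gamma> k))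
     in spectrum T \<subseteq> \<Omega>0 \<union> (\<Union>k\<in>{N0<..}. \<Omega> k) \<and>
        riesz_well_defined T \<gamma>0 \<and> (\<forall>k>N0. riesz_well_defined T (\<gamma> k)) \<and>
        S0 \<circ> S0 = S0 \<and> (\<forall>k>N0. P k \<circ> P k = P k) \<and>
        (\<forall>k>N0. S0 \<circ> P k = (\<lambda>_. 0) \<and> P k \<circ> S0 = (\<lambda>_. 0)) \<and>
        (\<forall>j>N0. \<forall>k>N0. j \<noteq> k \<longrightarrow> P j \<circ> P k = (\<lambda>_. 0)) \<and>
        rank_op S0 = rank_op (\<lambda>f. \<Sum>k=1..N0. P0 k f) \<and>
        (\<forall>k>N0. rank_op (P k) = rank_op (P0 k)))"
proof -
  \<comment> \<open>The sequences of the theorem start at 1 and nothing is known about their value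
    at 0; from here on they are shifted by one.\<close>
  define m where "m k = \<mu> (Suc k)" for k
  define w where "w k = \<omega> (Suc k)" for k
  define \<rho> where "\<rho> k = r (Suc k)" for k
  define Q where "Q k = P0 (Suc k)" for k
  note A = assms(5) and sqrtA = assms(10)
  have m_mono: "strict_mono m"
    using assms(7) by (auto simp: strict_mono_def m_def strict_mono_onD)
  have m0: "0 < m 0" using assms(6) by (simp add: m_def)
  have m_top: "filterlim m at_top sequentially"
    unfolding m_def by (rule filterlim_compose[OF assms(8) filterlim_Suc])
  have m_ge: "m 0 \<le> m k" for k using strict_mono_less_eq[OF m_mono, of 0 k] by simp
  have Suc_im: "Suc ` UNIV = {1..}" by (auto simp: image_iff Suc_le_eq gr0_conv_Suc)
  have w0: "0 \<le> w k" for k unfolding w_def by (rule assms(12)) simp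
  have w_summable: "summable (\<lambda>k. (w k)\<^sup>2 / m k)"
  proof -
    have "((\<lambda>j. (\<omega> j)\<^sup>2 / \<mu> j) \<circ> Suc) summable_on UNIV"
      using assms(14) unfolding Suc_im[symmetric] by (subst (asm) summable_on_reindex) auto
    then show ?thesis
      unfolding w_def m_def o_def by (rule summable_on_imp_summable)
  qed
  interpret gaps: spectral_gaps m w \<rho>
    using m_mono m0 m_top w_summable gap_radius_bounds[OF assms(7)]
    by unfold_locales (auto simp: m_def \<rho>_def assms(1))
  have small: "\<exists>N. \<forall>i\<ge>N. (\<Sum>k. if k = i then 0 else (w k)\<^sup>2 / \<bar>m i - m k\<bar>) + (w i)\<^sup>2 / \<rho> i \<le> 1 / 4"
  proof -
    \<comment> \<open>The unordered sum agrees with the ordinary series because the terms are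
      nonnegative and the series converges.\<close>
    have conv: "(\<Sum>\<^sub>\<infinity>j\<in>{1..} - {Suc i}. (\<omega> j)\<^sup>2 / \<bar>\<mu> (Suc i) - \<mu> j\<bar>) = (\<Sum>k. if k = i then 0 else (w k)\<^sup>2 / \<bar>m i - m k\<bar>)" for i
    proof -
      have im: "{1..} - {Suc i} = Suc ` (- {i})" unfolding Suc_im[symmetric] by auto
      have "(\<Sum>\<^sub>\<infinity>j\<in>{1..} - {Suc i}. (\<omega> j)\<^sup>2 / \<bar>\<mu> (Suc i) - \<mu> j\<bar>) = (\<Sum>\<^sub>\<infinity>k\<in>- {i}. (w k)\<^sup>2 / \<bar>m i - m k\<bar>)"
        unfolding im by (subst infsum_reindex) (auto simp: w_def m_def o_def)
      also have "\<dots> = (\<Sum>\<^sub>\<infinity>k. if k = i then 0 else (w k)\<^sup>2 / \<bar>m i - m k\<bar>)"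
        by (rule infsum_cong_neutral) auto
      also have "\<dots> = (\<Sum>k. if k = i then 0 else (w k)\<^sup>2 / \<bar>m i - m k\<bar>)"
        by (intro infsumI sums_nonneg_imp_has_sum summable_sums gaps.gap_summable) simp
      finally show ?thesis .
    qed
    \<comment> \<open>The asymptotic condition is applied with the constant 1/4 that
      \<open>good_nearest\<close> calls for.\<close>
    have "\<forall>\<^sub>F n in sequentially. norm ((\<Sum>\<^sub>\<infinity>j\<in>{1..} - {n}. (\<omega> j)\<^sup>2 / \<bar>\<mu> n - \<mu> j\<bar>) + (\<omega> n)\<^sup>2 / r n) \<le> 1 / 4 * norm (1 :: real)"
      by (rule landau_o.smallD[OF assms(15)]) simp
    then obtain N where N: "\<And>n. n \<ge> N \<Longrightarrow> norm ((\<Sum>\<^sub>\<infinity>j\<in>{1..} - {n}. (\<omega> j)\<^sup>2 / \<bar>\<mu> n - \<mu> j\<bar>) + (\<omega> n)\<^sup>2 / r n) \<le> 1 / 4"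
      unfolding eventually_sequentially by auto
    have "(\<Sum>k. if k = i then 0 else (w k)\<^sup>2 / \<bar>m i - m k\<bar>) + (w i)\<^sup>2 / \<rho> i \<le> 1 / 4" if "N \<le> i" for i
      using abs_le_D1[OF N[OF le_SucI[OF that], unfolded conv real_norm_def]] by (simp only: w_def \<rho>_def)
    then show ?thesis by blast
  qed

  \<comment> \<open>The eigenspaces of \<open>A\<close> form a resolution of the identity\<close>
  define E where "E k = eigenspace A (complex_of_real (m k))" for k
  have E: "csubspace (E k)" "closed (E k)" for k unfolding E_def by (rule eigenspace_closed_csubspace[OF A])+
  have Q: "Q = (\<lambda>k. orth_proj (E k))" by (simp add: fun_eq_iff Q_def E_def m_def assms(2))
  have QE: "Q k x \<in> E k" for k x unfolding Q by (rule orth_proj_in[OF E])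
  have spec: "spectrum A = range (\<lambda>k. complex_of_real (m k))"
    unfolding assms(9) m_def Suc_im[symmetric] by (simp add: image_image)
  interpret proj: orthogonal_projections Q
    unfolding Q by (rule orthogonal_projections_orth_proj[OF E])
      (use eigenspaces_orthogonal[OF A] strict_mono_eq[OF m_mono] in \<open>auto simp: E_def\<close>)
  have "orthogonal_resolution Q"
  proof (rule proj.orthogonal_resolutionI)
    fix x assume x: "\<And>k. Q k x = 0"
    show "x = 0"
    proof (rule self_adjoint_discrete_complete[OF A])
      show "spectrum A \<subseteq> range complex_of_real" by (auto simp: spec)
      have "m k \<noteq> 0" for k using gaps.m_pos[of k] by simp
      then show "0 \<notin> spectrum A" by (auto simp: spec)
      show "\<not> z islimpt spectrum A" for z
      proof -
        obtain k0 where k0: "\<And>k. k \<ge> k0 \<Longrightarrow> cmod z + 1 \<le> m k" using gaps.eventually_large by blast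
        have "spectrum A \<inter> ball z 1 \<subseteq> (\<lambda>k. complex_of_real (m k)) ` {..<k0}"
        proof
          fix y assume y: "y \<in> spectrum A \<inter> ball z 1"
          then obtain k where k: "y = complex_of_real (m k)" by (auto simp: spec)
          have "cmod y \<le> cmod z + cmod (z - y)" using norm_triangle_ineq4[of z "z - y"] by simp
          then have "m k < cmod z + 1" using y gaps.m_pos[of k] by (simp add: k dist_norm)
          then have "k < k0" using k0[of k] by (cases "k < k0") auto
          then show "y \<in> (\<lambda>k. complex_of_real (m k)) ` {..<k0}" using k by blast
        qed
        then have "finite (spectrum A \<inter> ball z 1)" by (rule finite_subset) simp
        then show ?thesis unfolding islimpt_eq_infinite_ball by (metis zero_less_one)
      qed
      fix s e assume "complex_of_real s \<in> spectrum A" and e: "e \<in> eigenspace A (complex_of_real s)"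
      then obtain k where "s = m k" by (auto simp: spec)
      then have "cinner (x - orth_proj (E k) x) e = 0" using e by (intro orth_proj_orth[OF E]) (simp add: E_def)
      then show "cinner x e = 0" using x[of k] by (simp add: Q)
    qed
  qed
  then interpret res: orthogonal_resolution Q .
  have QD: "Q k x \<in> Dom sqrtA \<and> sqrtA \<cdot> Q k x = complex_of_real (sqrt (m k)) *\<^sub>C Q k x" for k x
    using positive_sqrt_eigenvector[OF sqrtA gaps.m_pos] QE unfolding E_def by blast

  \<comment> \<open>The form, its bounded representative and the resolvent of
    \<open>T\<close>\<close>
  interpret pf: perturbed_form Q m w sqrtA v
  proof
    show "\<exists>e>0. \<forall>k. e \<le> m k" using m0 m_ge by blast
    show "self_adjoint sqrtA" using sqrtA by (simp add: positive_sqrt_def)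
    show "cmod (v (Q j f) (Q k g)) \<le> w j * w k * norm (Q j f) * norm (Q k g)" if "f \<in> Dom sqrtA" "g \<in> Dom sqrtA" for f g j k
      unfolding Q_def w_def by (rule assms(13)) (use that in auto)
    show "sectorial_form (Dom sqrtA) (\<lambda>f g. cinner (sqrtA \<cdot> f) (sqrtA \<cdot> g) + v f g)"
      "closed_form (Dom sqrtA) (\<lambda>f g. cinner (sqrtA \<cdot> f) (sqrtA \<cdot> g) + v f g)"
      using assms(16,17) by (simp_all add: assms(3))
  qed (use QD m_top w0 w_summable assms(11) in auto)
  obtain V where fp: "form_perturbation Q m w V" and V: "\<And>f g. f \<in> Dom sqrtA \<Longrightarrow> g \<in> Dom sqrtA \<Longrightarrow> v f g = cinner (V (sqrtA \<cdot> f)) (sqrtA \<cdot> g)"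
    using pf.form_operator by blast
  interpret fp: form_perturbation Q m w V by (rule fp)
  interpret R: pseudo_resolvent fp.U "fp.R 1" by (rule fp.pseudo_resolvent_R) auto
  have good: "z \<notin> fp.spec" "fp.s z \<le> 1 / 2" "z \<in> fp.U" if "gaps.good z" for z
    using that by (force simp: gaps.good_def fp.spec_def fp.s_def fp.U_def)+
  have T: "associated_operator (Dom sqrtA) pf.t T" using assms(18) by (simp add: assms(3))
  have resT: "z \<in> resolvent_set T" "resolvent T z = fp.R 1 z" if "z \<in> fp.U" for z
    using pf.resolvent_associated_operator[OF fp V T that] by auto
  have riesz: "riesz_well_defined T \<gamma>" "riesz_projection T \<gamma> = cintegral (fp.R 1) \<gamma>" "path_image \<gamma> \<subseteq> fp.U"
    "rank_op (riesz_projection T \<gamma>) = rank_op (\<lambda>x. \<Sum>k | complex_of_real (m k) \<in> interior K. Q k x)"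
    if c: "contour \<gamma> K" and g: "\<forall>z\<in>path_image \<gamma>. gaps.good z" for \<gamma> K
  proof -
    show U: "path_image \<gamma> \<subseteq> fp.U" using g good(3) by blast
    have cong: "\<And>z. z \<in> path_image \<gamma> \<Longrightarrow> resolvent T z = fp.R 1 z" using U resT(2) by blast
    show eq: "riesz_projection T \<gamma> = cintegral (fp.R 1) \<gamma>"
      unfolding riesz_projection_eq by (rule cintegral_cong(1)[OF cong])
    have "cintegrand (resolvent T) \<gamma> integrable_on {0..1}"
      by (rule iffD2[OF cintegral_cong(2)[OF cong] R.integrable[OF c U]])
    moreover have "path_image \<gamma> \<subseteq> resolvent_set T" using U resT(1) by (meson subset_iff)
    ultimately show "riesz_well_defined T \<gamma>"
      by (simp only: riesz_well_defined_def resolvent_integrand_eq simp_thms)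
    show "rank_op (riesz_projection T \<gamma>) = rank_op (\<lambda>x. \<Sum>k | complex_of_real (m k) \<in> interior K. Q k x)"
      unfolding eq by (rule fp.rank_cintegral_R[OF c]) (use g good in auto)
  qed

  \<comment> \<open>Position of the contours relative to the eigenvalues\<close>
  from gaps.good_region[OF small] obtain N h where h: "0 < h"
    and good_left: "\<forall>z. Re z \<le> - h \<longrightarrow> gaps.good z"
    and good_high: "\<forall>z. h \<le> \<bar>Im z\<bar> \<longrightarrow> Re z \<le> m N + \<rho> N \<longrightarrow> gaps.good z"
    and good_right: "\<forall>z. m N + \<rho> N \<le> Re z \<longrightarrow> (\<forall>i>N. \<rho> i \<le> cmod (z - complex_of_real (m i))) \<longrightarrow> gaps.good z"
    by blast
  note left = good_left[rule_format] and high = good_high[rule_format] and right = good_right[rule_format]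
  define X where "X = m N + \<rho> N"
  have X: "0 < X" using gaps.m_pos[of N] gaps.\<rho>_pos[of N] by (simp add: X_def)
  have sep: "\<rho> i + \<rho> j \<le> \<bar>m i - m j\<bar>" if "i \<noteq> j" for i j
    using gaps.gap[of i j] gaps.gap[of j i] that by linarith
  \<comment> \<open>The disc about \<open>m i\<close> may touch the line \<open>Re z = X\<close> but
    does not cross it, since the radii at \<open>N\<close> and \<open>i\<close> together do not
    exceed the distance of the centres.\<close>
  have X_le: "X + \<rho> i \<le> m i" if "N < i" for i
    using sep[of i N] gaps.m_less[OF that] that by (simp add: X_def)
  define \<gamma>0 where "\<gamma>0 = rectpath (Complex (- h) (- h)) (Complex X h)"
  define K0 where "K0 = cbox (Complex (- h) (- h)) (Complex X h)"
  define \<gamma> where "\<gamma> i = circlepath (complex_of_real (m i)) (\<rho> i)" for i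
  define K where "K i = cball (complex_of_real (m i)) (\<rho> i)" for i
  have c0: "contour \<gamma>0 K0" unfolding contour_def \<gamma>0_def K0_def
    using h X by (intro disjI2 exI[of _ "Complex (- h) (- h)"] exI[of _ "Complex X h"]) auto
  have c: "contour (\<gamma> i) (K i)" for i unfolding contour_def \<gamma>_def K_def using gaps.\<rho>_pos by blast
  have g0: "gaps.good z" if z: "z \<in> path_image \<gamma>0" for z
  proof -
    have "z \<in> K0 - interior K0" using z contourD(3)[OF c0] by simp
    then have b: "- h \<le> Re z" "Re z \<le> X" "- h \<le> Im z" "Im z \<le> h" and
      "Re z = - h \<or> Re z = X \<or> \<bar>Im z\<bar> = h"
      by (auto simp: K0_def interior_cbox in_cbox_complex_iff in_box_complex_iff)
    then consider "Re z \<le> - h" | "Re z = X" | "h \<le> \<bar>Im z\<bar>" by auto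
    then show ?thesis
    proof cases
      case 2
      show ?thesis
      \<comment> \<open>On the right edge of the rectangle all later centres lie at least their
        radius further to the right.\<close>
      proof (rule right)
        fix i assume "N < i"
        then have "\<rho> i \<le> Re (complex_of_real (m i) - z)" using X_le[of i] 2 by simp
        also have "\<dots> \<le> cmod (z - complex_of_real (m i))" by (subst norm_minus_commute) (rule complex_Re_le_cmod)
        finally show "\<rho> i \<le> cmod (z - complex_of_real (m i))" .
      qed (use 2 in \<open>simp add: X_def\<close>)
    qed (use b left high in \<open>auto simp: X_def\<close>)
  qed
  have g: "gaps.good z" if i: "N < i" and z: "z \<in> path_image (\<gamma> i)" for i z
  proof -
    have d: "cmod (z - complex_of_real (m i)) = \<rho> i"
      using z gaps.\<rho>_pos[of i] by (auto simp: \<gamma>_def dist_norm norm_minus_commute)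
    show ?thesis
    proof (rule right)
      have "m i - Re z \<le> cmod (z - complex_of_real (m i))"
        using complex_Re_le_cmod[of "complex_of_real (m i) - z"] by (simp add: norm_minus_commute)
      then show "m N + \<rho> N \<le> Re z" using d X_le[OF i] by (simp add: X_def)
      fix j assume "N < j"
      show "\<rho> j \<le> cmod (z - complex_of_real (m j))"
      proof (cases "j = i")
        case False
        have "\<bar>m j - m i\<bar> = cmod (complex_of_real (m i) - complex_of_real (m j))"
          by (simp flip: of_real_diff)
        also have "\<dots> \<le> cmod (z - complex_of_real (m j)) + cmod (z - complex_of_real (m i))"
          using norm_triangle_ineq4[of "z - complex_of_real (m j)" "z - complex_of_real (m i)"] by simp
        finally show ?thesis using sep[OF False] d by linarith
      qed (simp add: d)
    qed
  qed
  have disj0: "interior K0 \<inter> interior (K i) = {}" if "N < i" for i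
  proof -
    have "\<not> Re z < X" if "dist (complex_of_real (m i)) z < \<rho> i" for z
      using that complex_Re_le_cmod[of "complex_of_real (m i) - z"] X_le[OF \<open>N < i\<close>] by (simp add: dist_norm)
    then show ?thesis by (auto simp: K0_def K_def interior_cbox interior_cball in_box_complex_iff)
  qed
  have disj: "interior (K i) \<inter> interior (K j) = {}" if "i \<noteq> j" for i j
    unfolding K_def interior_cball
    by (rule disjoint_ballI) (use sep[OF that] in \<open>simp add: dist_norm flip: of_real_diff\<close>)
  \<comment> \<open>The rectangle encloses the indices 0 to \<open>N\<close> after the shift, which
    are the first \<open>Suc N\<close> eigenvalues; hence \<open>N0\<close> is
    \<open>Suc N\<close>.\<close>
  have set0: "{k. complex_of_real (m k) \<in> interior K0} = {..<Suc N}"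
  proof -
    have "m k < X \<longleftrightarrow> k \<le> N" for k
    proof (cases "k \<le> N")
      case True
      then have "m k \<le> m N" using strict_mono_less_eq[OF m_mono] by simp
      then show ?thesis using True gaps.\<rho>_pos[of N] by (simp add: X_def)
    next
      case False
      then show ?thesis using X_le[of k] gaps.\<rho>_pos[of k] by simp
    qed
    then show ?thesis
      using h gaps.m_pos by (auto simp: K0_def interior_cbox in_box_complex_iff less_Suc_eq_le intro: less_trans[of "- h" 0])
  qed
  have set_i: "{k. complex_of_real (m k) \<in> interior (K i)} = {i}" for i
  proof -
    have "complex_of_real (m k) \<in> interior (K i) \<longleftrightarrow> k = i" for k
    proof (cases "k = i")
      case False
      then show ?thesis using sep[of i k] gaps.\<rho>_pos[of k]
        by (simp add: K_def interior_cball dist_norm flip: of_real_diff)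
    qed (simp add: K_def interior_cball gaps.\<rho>_pos)
    then show ?thesis by auto
  qed

  \<comment> \<open>The spectral inclusion, the projections and their ranks\<close>
  have "\<forall>z\<in>path_image \<gamma>0. gaps.good z" using g0 by blast
  note r0 = riesz[OF c0 this]
  have "\<forall>z\<in>path_image (\<gamma> i). gaps.good z" if "N < i" for i using g[OF that] by blast
  note ri = riesz[OF c this]
  define S0 where "S0 = riesz_projection T \<gamma>0"
  define S where "S i = riesz_projection T (\<gamma> i)" for i
  have spectrum: "spectrum T \<subseteq> {z. - h < Re z \<and> Re z \<le> X \<and> \<bar>Im z\<bar> \<le> h} \<union> (\<Union>i\<in>{N<..}. {z. cmod (z - complex_of_real (m i)) < \<rho> i})"
  proof
    fix z assume z: "z \<in> spectrum T"
    show "z \<in> {z. - h < Re z \<and> Re z \<le> X \<and> \<bar>Im z\<bar> \<le> h} \<union> (\<Union>i\<in>{N<..}. {z. cmod (z - complex_of_real (m i)) < \<rho> i})"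
    proof (rule ccontr)
      assume n: "\<not> ?thesis"
      then have out: "\<And>i. N < i \<Longrightarrow> \<rho> i \<le> cmod (z - complex_of_real (m i))" by (auto simp: not_less)
      from n consider "Re z \<le> - h" | "X < Re z" | "h \<le> \<bar>Im z\<bar>" "Re z \<le> X" by fastforce
      then have "gaps.good z" using left high right[OF _ out] by cases (auto simp: X_def)
      then have "z \<in> resolvent_set T" using good resT by blast
      then show False using z by (simp add: spectrum_def)
    qed
  qed
  have idem0: "S0 \<circ> S0 = S0"
    unfolding S0_def r0(2) by (rule ext) (simp add: R.cintegral_idem[OF c0 r0(3)])
  have idem: "S i \<circ> S i = S i" if "N < i" for i
    unfolding S_def ri(2)[OF that] by (rule ext) (simp add: R.cintegral_idem[OF c ri(3)[OF that]])
  have prod0: "S0 \<circ> S i = (\<lambda>_. 0)" "S i \<circ> S0 = (\<lambda>_. 0)" if "N < i" for i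
    unfolding S0_def S_def r0(2) ri(2)[OF that] fun_eq_iff o_def
    using R.cintegral_disjoint[OF c0 r0(3) c ri(3)[OF that] disj0[OF that]]
      R.cintegral_disjoint[OF c ri(3)[OF that] c0 r0(3)] disj0[OF that] by (auto simp: Int_commute)
  have prod: "S i \<circ> S j = (\<lambda>_. 0)" if "N < i" "N < j" "i \<noteq> j" for i j
    unfolding S_def ri(2)[OF that(1)] ri(2)[OF that(2)] fun_eq_iff o_def
    using R.cintegral_disjoint[OF c ri(3)[OF that(2)] c ri(3)[OF that(1)] disj] that(3) by auto
  have rank0: "rank_op S0 = rank_op (\<lambda>f. \<Sum>k=1..Suc N. P0 k f)"
    unfolding S0_def r0(4) set0 by (simp only: sum.atLeast1_atMost_eq One_nat_def Q_def)
  have rank: "rank_op (S i) = rank_op (P0 (Suc i))" if "N < i" for i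
    unfolding S_def ri(4)[OF that] set_i by (simp add: Q_def)
  have shift: "(\<forall>k>Suc N. \<Phi> k) \<longleftrightarrow> (\<forall>i>N. \<Phi> (Suc i))" for \<Phi> :: "nat \<Rightarrow> bool"
    by (metis Suc_less_eq Suc_less_eq2)
  have im: "{Suc N<..} = Suc ` {N<..}" by (auto simp: image_iff Suc_less_eq2)
  have \<gamma>0_eq: "rectpath (Complex (- h) (- h)) (Complex (\<mu> (Suc N) + r (Suc N)) h) = \<gamma>0"
    by (simp add: \<gamma>0_def X_def m_def \<rho>_def)
  have \<gamma>_eq: "circlepath (complex_of_real (\<mu> (Suc i))) (r (Suc i)) = \<gamma> i" for i
    by (simp add: \<gamma>_def m_def \<rho>_def)
  show ?thesis
    unfolding Let_def
  \<comment> \<open>The number \<open>h\<close> is taken for both \<open>h1\<close> and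
    \<open>h2\<close>.\<close>
  proof (rule exI[of _ "Suc N"], intro conjI exI[of _ h])
    show "spectrum T \<subseteq> {z. - h < Re z \<and> Re z \<le> \<mu> (Suc N) + r (Suc N) \<and> \<bar>Im z\<bar> \<le> h} \<union>
        (\<Union>k\<in>{Suc N<..}. {z. cmod (z - complex_of_real (\<mu> k)) < r k})"
      using spectrum unfolding im by (simp add: X_def m_def \<rho>_def)
  qed (unfold shift \<gamma>0_eq \<gamma>_eq S0_def[symmetric] S_def[symmetric],
      use h r0(1) ri(1) idem0 idem prod0 prod rank0 rank in \<open>simp_all\<close>)
qed

end
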